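(* Let $I$ be a compact interval, let $\beta,\epsilon>0$, $0<s<\beta<1$, $q\in[1,\infty]$. Let $\Lambda_1$ be a finite partition of $I$ by intervals and let $f\colon\bigcup_{J\in\Lambda_1}J\to I$ be a map such that for every $J\in\Lambda_1$ the restriction of $f$ to $J$ is (i) (branch of Type I) either a $C^{1+\beta+\epsilon}$-diffeomorphism onto its image, (ii) (branch of Type II) or of the form $$f(x)=\psi_J\big((D_J\phi_J(x)-a_J)^{1/(1+\gamma)}\big),\qquad x\in J=[a_J,b_J],$$ where $D_J>0$, $D_J\phi_J(x)-a_J\ge0$ on $J$, $\gamma>0$ satisfies $\beta<\min\{1,\gamma\}$, and $\phi_J,\psi_J$ are $C^{1+\beta+\epsilon}$-diffeomorphisms. If $\alpha=\inf|f'|>1$, then the Ruelle–Perron–Frobenius operator $\Phi$ of $f$ is a quasi-compact operator acting on $\mathcal{B}^s_{1,q}$ and $$r_{ess}(\Phi,\mathcal{B}^s_{1,q})\le\alpha^{-s}.$$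
   Context: $I$ carries Lebesgue measure $m$, $|A|=m(A)$, and the dyadic grid $\mathcal{D}=(\mathcal{D}^k)_k$, $\mathcal{D}^k$ being the partition of $I$ into $2^k$ intervals of equal length. $C^{1+\gamma'}$ means $C^1$ with $\gamma'$-Hölder derivative; diffeomorphisms are between compact intervals (partitions are understood up to endpoints). Besov space. Put $a_Q=|Q|^{s-1}1_Q$. $\mathcal{B}^s_{1,q}=\mathcal{B}^s_{1,q}(I,m,\mathcal{D})$ is the space of $\psi\in L^1(m)$ that can be written $\psi=\sum_k\sum_{Q\in\mathcal{D}^k}c_Qa_Q$ (the series in $k$ converging in $L^1$) with $\big(\sum_k(\sum_{Q\in\mathcal{D}^k}|c_Q|)^{q}\big)^{1/q}<\infty$ (supremum over $k$ if $q=\infty$); its norm is the infimum of this quantity over all representations. Transfer operator: with $h_J\colon f(J)\to J$ the inverse branches, $(\Phi\psi)(x)=\sum_{J:\,x\in f(J)}|h_J'(x)|\,\psi(h_J(x))$. $r_{ess}$ is the essential spectral radius. *)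

theory Defs
  imports "HOL-Analysis.Analysis"
begin

section \<open>Operators on seminormed spaces of functions\<close>

text \<open>
  A complex normed space of classes of functions is represented by a set V of functions together
  with a seminorm N; two elements psi, phi of V represent the same vector iff N (psi - phi) = 0.
  Linearity, inverses, kernels, ranges and dimensions below are those of the quotient space.
\<close>

type_synonym cfun = "real \<Rightarrow> complex"

definition bounded_operator :: "cfun set \<Rightarrow> (cfun \<Rightarrow> real) \<Rightarrow> (cfun \<Rightarrow> cfun) \<Rightarrow> bool" where
  "bounded_operator V N T \<longleftrightarrow>
     (\<forall>\<psi>\<in>V. T \<psi> \<in> V) \<and>
     (\<forall>\<psi>\<in>V. \<forall>\<phi>\<in>V. \<forall>c. N (\<lambda>x. T (\<lambda>y. c * \<psi> y + \<phi> y) x - (c * T \<psi> x + T \<phi> x)) = 0) \<and>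
     (\<exists>C. \<forall>\<psi>\<in>V. N (T \<psi>) \<le> C * N \<psi>)"

definition shifted :: "complex \<Rightarrow> (cfun \<Rightarrow> cfun) \<Rightarrow> cfun \<Rightarrow> cfun" where
  "shifted z T \<psi> = (\<lambda>x. z * \<psi> x - T \<psi> x)"

definition spectrum_on :: "cfun set \<Rightarrow> (cfun \<Rightarrow> real) \<Rightarrow> (cfun \<Rightarrow> cfun) \<Rightarrow> complex set" where
  "spectrum_on V N T =
     {z. \<not> (\<exists>R. bounded_operator V N R \<and>
             (\<forall>\<psi>\<in>V. N (\<lambda>x. R (shifted z T \<psi>) x - \<psi> x) = 0 \<and>
                    N (\<lambda>x. shifted z T (R \<psi>) x - \<psi> x) = 0))}"

text \<open>Finite-dimensional kernel, closed range, range of finite codimension.\<close>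

definition fredholm_on :: "cfun set \<Rightarrow> (cfun \<Rightarrow> real) \<Rightarrow> (cfun \<Rightarrow> cfun) \<Rightarrow> bool" where
  "fredholm_on V N A \<longleftrightarrow>
     (\<exists>B. finite B \<and> B \<subseteq> V \<and>
        (\<forall>\<psi>\<in>V. N (A \<psi>) = 0 \<longrightarrow> (\<exists>u. N (\<lambda>x. \<psi> x - (\<Sum>e\<in>B. u e * e x)) = 0))) \<and>
     (\<forall>\<phi> \<psi>. (\<forall>n::nat. \<phi> n \<in> V) \<and> \<psi> \<in> V \<and> (\<lambda>n. N (\<lambda>x. A (\<phi> n) x - \<psi> x)) \<longlonglongrightarrow> 0 \<longrightarrow>
        (\<exists>\<xi>\<in>V. N (\<lambda>x. A \<xi> x - \<psi> x) = 0)) \<and>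
     (\<exists>B. finite B \<and> B \<subseteq> V \<and>
        (\<forall>\<psi>\<in>V. \<exists>\<xi>\<in>V. \<exists>u. N (\<lambda>x. \<psi> x - (A \<xi> x + (\<Sum>e\<in>B. u e * e x))) = 0))"

definition ess_spectrum_on :: "cfun set \<Rightarrow> (cfun \<Rightarrow> real) \<Rightarrow> (cfun \<Rightarrow> cfun) \<Rightarrow> complex set" where
  "ess_spectrum_on V N T = {z. \<not> fredholm_on V N (shifted z T)}"

text \<open>The radii are \<open>ennreal\<close>-valued, so that both suprema are meaningful without side conditions.\<close>

definition spectral_radius_on :: "cfun set \<Rightarrow> (cfun \<Rightarrow> real) \<Rightarrow> (cfun \<Rightarrow> cfun) \<Rightarrow> ennreal" where
  "spectral_radius_on V N T = (SUP z\<in>spectrum_on V N T. ennreal (cmod z))"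

definition ess_spectral_radius_on :: "cfun set \<Rightarrow> (cfun \<Rightarrow> real) \<Rightarrow> (cfun \<Rightarrow> cfun) \<Rightarrow> ennreal" where
  "ess_spectral_radius_on V N T = (SUP z\<in>ess_spectrum_on V N T. ennreal (cmod z))"

definition quasi_compact_on :: "cfun set \<Rightarrow> (cfun \<Rightarrow> real) \<Rightarrow> (cfun \<Rightarrow> cfun) \<Rightarrow> bool" where
  "quasi_compact_on V N T \<longleftrightarrow>
     bounded_operator V N T \<and> ess_spectral_radius_on V N T < spectral_radius_on V N T"

section \<open>The Besov space on the interval from a to b\<close>

definition dyadic :: "real \<Rightarrow> real \<Rightarrow> nat \<Rightarrow> real set set" where
  "dyadic a b k =
     (\<lambda>j. {a + real j * (b - a) / 2 ^ k ..< a + real (Suc j) * (b - a) / 2 ^ k}) ` {..<2 ^ k}"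

definition atom :: "real \<Rightarrow> real set \<Rightarrow> cfun" where
  "atom s Q x = complex_of_real (measure lebesgue Q powr (s - 1) * indicator Q x)"

text \<open>
  Cells of different levels are different sets (their lengths differ), so one coefficient
  function on cells serves all levels.
\<close>

definition besov_rep :: "real \<Rightarrow> real \<Rightarrow> real \<Rightarrow> cfun \<Rightarrow> (real set \<Rightarrow> complex) \<Rightarrow> bool" where
  "besov_rep a b s \<psi> c \<longleftrightarrow>
     (\<lambda>n. LINT x|lebesgue_on {a..b}.
        cmod (\<psi> x - (\<Sum>k<n. \<Sum>Q\<in>dyadic a b k. c Q * atom s Q x))) \<longlonglongrightarrow> 0"

definition level_sum :: "real \<Rightarrow> real \<Rightarrow> (real set \<Rightarrow> complex) \<Rightarrow> nat \<Rightarrow> real" where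
  "level_sum a b c k = (\<Sum>Q\<in>dyadic a b k. cmod (c Q))"

definition finite_cost :: "real \<Rightarrow> real \<Rightarrow> ereal \<Rightarrow> (real set \<Rightarrow> complex) \<Rightarrow> bool" where
  "finite_cost a b q c \<longleftrightarrow>
     (if q = \<infinity> then bdd_above (range (level_sum a b c))
      else summable (\<lambda>k. level_sum a b c k powr real_of_ereal q))"

definition cost :: "real \<Rightarrow> real \<Rightarrow> ereal \<Rightarrow> (real set \<Rightarrow> complex) \<Rightarrow> real" where
  "cost a b q c =
     (if q = \<infinity> then (SUP k. level_sum a b c k)
      else (\<Sum>k. level_sum a b c k powr real_of_ereal q) powr (1 / real_of_ereal q))"

definition besov :: "real \<Rightarrow> real \<Rightarrow> real \<Rightarrow> ereal \<Rightarrow> cfun set" where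
  "besov a b s q =
     {\<psi>. integrable (lebesgue_on {a..b}) \<psi> \<and> (\<exists>c. besov_rep a b s \<psi> c \<and> finite_cost a b q c)}"

text \<open>
  For s > 0 and q at least 1, the \<open>L\<^sup>1\<close> norm is at most a constant times besov_norm, so besov_norm
  vanishes exactly on the elements of besov that are 0 almost everywhere on the interval: the
  identification made by the seminorm is the usual one.
\<close>

definition besov_norm :: "real \<Rightarrow> real \<Rightarrow> real \<Rightarrow> ereal \<Rightarrow> cfun \<Rightarrow> real" where
  "besov_norm a b s q \<psi> = Inf {cost a b q c | c. besov_rep a b s \<psi> c \<and> finite_cost a b q c}"

section \<open>Piecewise expanding maps and the transfer operator\<close>

definition C1_holder :: "real \<Rightarrow> real set \<Rightarrow> (real \<Rightarrow> real) \<Rightarrow> bool" where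
  "C1_holder \<eta> S g \<longleftrightarrow>
     (\<exists>g'. (\<forall>x\<in>S. (g has_real_derivative g' x) (at x within S)) \<and> continuous_on S g' \<and>
        (\<exists>C. \<forall>x\<in>S. \<forall>y\<in>S. \<bar>g' x - g' y\<bar> \<le> C * \<bar>x - y\<bar> powr \<eta>))"

text \<open>Diffeomorphism of the compact interval S onto its image.\<close>

definition C1_holder_diffeo :: "real \<Rightarrow> real set \<Rightarrow> (real \<Rightarrow> real) \<Rightarrow> bool" where
  "C1_holder_diffeo \<eta> S g \<longleftrightarrow>
     inj_on g S \<and> C1_holder \<eta> S g \<and> C1_holder \<eta> (g ` S) (inv_into S g)"

text \<open>
  Cells J of the partition are closed intervals that may share endpoints, where f may jump; hence f
  is only prescribed on the interior of J, and the regularity up to the boundary is that of its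
  extension to J.
\<close>

definition type_I_branch :: "real \<Rightarrow> real set \<Rightarrow> (real \<Rightarrow> real) \<Rightarrow> bool" where
  "type_I_branch \<eta> J f \<longleftrightarrow> (\<exists>g. C1_holder_diffeo \<eta> J g \<and> (\<forall>x\<in>interior J. f x = g x))"

definition type_II_branch :: "real \<Rightarrow> real \<Rightarrow> real set \<Rightarrow> (real \<Rightarrow> real) \<Rightarrow> bool" where
  "type_II_branch \<beta> \<eta> J f \<longleftrightarrow>
     (\<exists>D \<gamma> \<phi> \<psi>. D > 0 \<and> \<gamma> > 0 \<and> \<beta> < min 1 \<gamma> \<and>
        C1_holder_diffeo \<eta> J \<phi> \<and>
        (\<forall>x\<in>J. D * \<phi> x - Inf J \<ge> 0) \<and>
        C1_holder_diffeo \<eta> ((\<lambda>x. (D * \<phi> x - Inf J) powr (1 / (1 + \<gamma>))) ` J) \<psi> \<and>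
        (\<forall>x\<in>interior J. f x = \<psi> ((D * \<phi> x - Inf J) powr (1 / (1 + \<gamma>)))))"

definition transfer_operator :: "real set set \<Rightarrow> (real \<Rightarrow> real) \<Rightarrow> cfun \<Rightarrow> cfun" where
  "transfer_operator \<Lambda> f \<psi> x =
     (\<Sum>J\<in>{J\<in>\<Lambda>. x \<in> f ` interior J}.
        complex_of_real \<bar>deriv (inv_into (interior J) f) x\<bar> * \<psi> (inv_into (interior J) f x))"

end

theory Submission imports Defs "HOL-Library.Function_Algebras" begin

text \<open>
  Let h be an inverse branch of an iterate of f and Q a dyadic cell, and put \<open>P = h\<^sup>-\<^sup>1 Q\<close>. The transferred atom is
  \<open>|Q| powr (s - 1) * |h'|\<close> restricted to P. Replacing \<open>|h'|\<close> by its mean over P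
  gives \<open>(|Q| / |P|) powr s\<close> times the normalised indicator \<open>|P| powr (s - 1) * 1\<^sub>P\<close>, and \<open>|Q| / |P| \<le> \<alpha>\<^sup>-\<^sup>n\<close> for the n-th iterate.
  The oscillation of \<open>h'\<close> is controlled by the mean of \<open>|h'|\<close> over P, also at the points where a branch of
  Type II has \<open>h' = 0\<close>. Since a fine cell meets at most two images of branches, the n-th power
  of the transfer operator has norm at most \<open>C \<alpha> powr (- n s)\<close> on functions with no coarse dyadic components,
  with C independent of n. Hence it is, up to finite rank, of norm less than \<open>|z|\<^sup>n\<close> when \<open>|z| > \<alpha> powr (- s)\<close>, and
  a Neumann series shows that z minus the operator is Fredholm. As the operator preserves the integral,
  1 belongs to the spectrum.
\<close>

section \<open>Finite rank perturbations of invertible operators\<close>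

text \<open>The Besov norm is an infimum over representations that are far from unique. It is
  compared with the levels \<open>lev\<close> of the dyadic martingale decomposition, whose
  coefficients are linear in the function: they supply the functionals of the finite rank part, and
  Young's inequality over levels reduces everything to single atoms. An atom of level k, once
  transferred, has two bounds at level j: conservation of the L1 norm, which decays as j gets
  coarser than k, and the oscillation of the derivative, which decays as j gets finer. The minimum
  of both, summed over k - j, is of order \<open>E powr (s / \<beta>)\<close>, where E bounds the
  \<beta>-th power of the mean of \<open>|h'|\<close> times one plus the distortion. The obstacle is
  that the distortion constant of n composed branches depends on n. On cells finer than a threshold
  depending on n it no longer enters, so that \<open>E = 2 * (\<mu> ^ n) powr \<beta>\<close> with
  \<open>\<mu> = 1 / \<alpha>\<close>, and the rate is \<open>\<mu> powr (n * s)\<close> up to a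
  constant; the finitely many coarser levels form the finite rank part.\<close>

locale complete_seminorm = vector_space scale
  for scale :: "complex \<Rightarrow> 'v::ab_group_add \<Rightarrow> 'v" (infixr "\<odot>" 75) +
  fixes V :: "'v set" and N :: "'v \<Rightarrow> real"
  assumes subspace_V: "subspace V"
    and N_nonneg: "x \<in> V \<Longrightarrow> 0 \<le> N x"
    and N_add: "x \<in> V \<Longrightarrow> y \<in> V \<Longrightarrow> N (x + y) \<le> N x + N y"
    and N_scale: "x \<in> V \<Longrightarrow> N (c \<odot> x) \<le> cmod c * N x"
    and N_complete: "(\<And>n. f n \<in> V) \<Longrightarrow> summable (\<lambda>n. N (f n)) \<Longrightarrow>
      \<exists>x\<in>V. (\<lambda>n. N (x - (\<Sum>i<n. f i))) \<longlonglongrightarrow> 0"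
begin

text \<open>Linearity holds exactly and not just modulo null vectors, since the transfer operator is
  a pointwise formula. Telescoping and finite sums are then identities of vectors, and
  \<open>N\<close> enters only where equations are solved.\<close>

definition linear_in :: "('v \<Rightarrow> 'v) \<Rightarrow> bool" where
  "linear_in T \<longleftrightarrow> (\<forall>x\<in>V. T x \<in> V) \<and> (\<forall>x\<in>V. \<forall>y\<in>V. \<forall>c. T (c \<odot> x + y) = c \<odot> T x + T y)"

definition functional_in :: "('v \<Rightarrow> complex) \<Rightarrow> bool" where
  "functional_in l \<longleftrightarrow> (\<forall>x\<in>V. \<forall>y\<in>V. \<forall>c. l (c \<odot> x + y) = c * l x + l y) \<and>
     (\<exists>C. \<forall>x\<in>V. cmod (l x) \<le> C * N x)"

lemma V_add [intro, simp]: "x \<in> V \<Longrightarrow> y \<in> V \<Longrightarrow> x + y \<in> V"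
  and V_diff [intro, simp]: "x \<in> V \<Longrightarrow> y \<in> V \<Longrightarrow> x - y \<in> V"
  and V_scale [intro, simp]: "x \<in> V \<Longrightarrow> c \<odot> x \<in> V"
  and V_zero [intro, simp]: "0 \<in> V"
  using subspace_V by (auto simp: subspace_add subspace_diff subspace_scale subspace_0)

lemma V_sum [intro]: "(\<And>i. i \<in> A \<Longrightarrow> f i \<in> V) \<Longrightarrow> sum f A \<in> V"
  using subspace_V by (rule subspace_sum)

lemma N_zero [simp]: "N 0 = 0"
  using N_scale[of 0 0] N_nonneg[of 0] by simp

lemma N_minus: assumes "x \<in> V" shows "N (- x) = N x"
proof -
  have m: "N (- y) \<le> N y" if "y \<in> V" for y
    using N_scale[OF that, of "-1"] by simp
  have "- x \<in> V" using V_scale[OF assms, of "-1"] by simp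
  then show ?thesis using m[of x] m[of "- x"] assms by simp
qed

lemma N_minus_commute: "x \<in> V \<Longrightarrow> y \<in> V \<Longrightarrow> N (x - y) = N (y - x)"
  using N_minus[of "x - y"] by simp

lemma N_diff: "x \<in> V \<Longrightarrow> y \<in> V \<Longrightarrow> N (x - y) \<le> N x + N y"
  using N_add[of x "- y"] N_minus[of y] V_scale[of y "-1"] by simp

lemma N_triangle: "x \<in> V \<Longrightarrow> y \<in> V \<Longrightarrow> z \<in> V \<Longrightarrow> N (x - z) \<le> N (x - y) + N (y - z)"
  using N_add[of "x - y" "y - z"] by simp

lemma N_null_trans: "x \<in> V \<Longrightarrow> y \<in> V \<Longrightarrow> z \<in> V \<Longrightarrow> N (x - y) = 0 \<Longrightarrow> N (y - z) = 0 \<Longrightarrow> N (x - z) = 0"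
  using N_triangle[of x y z] N_nonneg[of "x - z"] by simp

lemma N_sum: "finite A \<Longrightarrow> (\<And>i. i \<in> A \<Longrightarrow> f i \<in> V) \<Longrightarrow> N (sum f A) \<le> (\<Sum>i\<in>A. N (f i))"
proof (induction A rule: finite_induct)
  case (insert i A)
  then have "N (f i + sum f A) \<le> N (f i) + N (sum f A)" by (intro N_add V_sum) auto
  with insert show ?case by simp
qed simp

lemma linear_in_zero: assumes "linear_in T" shows "T 0 = 0"
proof -
  have "T (1 \<odot> 0 + 0) = 1 \<odot> T 0 + T 0" using assms unfolding linear_in_def by blast
  then show ?thesis by simp
qed

lemma linear_inD:
  assumes "linear_in T"
  shows "x \<in> V \<Longrightarrow> T x \<in> V"
    and "x \<in> V \<Longrightarrow> T (c \<odot> x) = c \<odot> T x"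
    and "x \<in> V \<Longrightarrow> y \<in> V \<Longrightarrow> T (x + y) = T x + T y"
    and "x \<in> V \<Longrightarrow> y \<in> V \<Longrightarrow> T (x - y) = T x - T y"
proof -
  have l: "T (c \<odot> x + y) = c \<odot> T x + T y" if "x \<in> V" "y \<in> V" for x y c
    using assms that by (auto simp: linear_in_def)
  show "x \<in> V \<Longrightarrow> T x \<in> V" using assms by (auto simp: linear_in_def)
  show "x \<in> V \<Longrightarrow> T (c \<odot> x) = c \<odot> T x"
    using l[of x 0 c] linear_in_zero[OF assms] by simp
  show "x \<in> V \<Longrightarrow> y \<in> V \<Longrightarrow> T (x + y) = T x + T y"
    using l[of x y 1] by simp
  show "x \<in> V \<Longrightarrow> y \<in> V \<Longrightarrow> T (x - y) = T x - T y"
    using l[of y x "-1"] by simp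
qed

lemma linear_in_sum:
  assumes "linear_in T" "finite A" "\<And>i. i \<in> A \<Longrightarrow> f i \<in> V"
  shows "T (sum f A) = (\<Sum>i\<in>A. T (f i))"
  using assms(2,3)
proof (induction A rule: finite_induct)
  case (insert i A)
  then show ?case using linear_inD(3)[OF assms(1), of "f i" "sum f A"] by (simp add: V_sum)
qed (simp add: linear_in_zero[OF assms(1)])

lemma linear_in_funpow: "linear_in T \<Longrightarrow> linear_in (T ^^ n)"
proof (induction n)
  case (Suc n)
  then show ?case unfolding linear_in_def by simp
qed (simp add: linear_in_def)

lemma functional_inD:
  assumes "functional_in l"
  shows "x \<in> V \<Longrightarrow> l (c \<odot> x) = c * l x"
    and "x \<in> V \<Longrightarrow> y \<in> V \<Longrightarrow> l (x + y) = l x + l y"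
    and "x \<in> V \<Longrightarrow> y \<in> V \<Longrightarrow> l (x - y) = l x - l y"
    and "x \<in> V \<Longrightarrow> N x = 0 \<Longrightarrow> l x = 0"
proof -
  have l: "l (c \<odot> x + y) = c * l x + l y" if "x \<in> V" "y \<in> V" for x y c
    using assms that by (auto simp: functional_in_def)
  have z: "l 0 = 0" using l[of 0 0 1] by simp
  show "x \<in> V \<Longrightarrow> l (c \<odot> x) = c * l x" using l[of x 0 c] z by simp
  show "x \<in> V \<Longrightarrow> y \<in> V \<Longrightarrow> l (x + y) = l x + l y" using l[of x y 1] by simp
  show "x \<in> V \<Longrightarrow> y \<in> V \<Longrightarrow> l (x - y) = l x - l y" using l[of y x "-1"] by simp
  show "x \<in> V \<Longrightarrow> N x = 0 \<Longrightarrow> l x = 0" using assms by (force simp: functional_in_def)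
qed

lemma functional_in_tendsto:
  assumes l: "functional_in l" and y: "\<And>n. y n \<in> V" "x \<in> V" "(\<lambda>n. N (y n - x)) \<longlonglongrightarrow> 0"
  shows "(\<lambda>n. l (y n)) \<longlonglongrightarrow> l x"
proof -
  obtain C where C: "\<And>x. x \<in> V \<Longrightarrow> cmod (l x) \<le> C * N x"
    using l unfolding functional_in_def by blast
  have "(\<lambda>n. l (y n) - l x) \<longlonglongrightarrow> 0"
  proof (rule Lim_null_comparison)
    show "\<forall>\<^sub>F n in sequentially. cmod (l (y n) - l x) \<le> C * N (y n - x)"
      using C[of "y _ - x"] functional_inD(3)[OF l] y(1,2) by (auto intro!: always_eventually)
    show "(\<lambda>n. C * N (y n - x)) \<longlonglongrightarrow> 0" using tendsto_mult_right_zero[OF y(3)] .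
  qed
  then show ?thesis by (simp add: LIM_zero_iff)
qed

text \<open>Induction over the functionals, cutting \<open>X\<close> and \<open>Y\<close> down to
  the kernel of one of them. If it vanishes on \<open>Y\<close>, it vanishes at the limit by
  continuity. Otherwise some \<open>y0\<close> in \<open>Y\<close> has value 1, and subtracting
  multiples of \<open>y0\<close> moves the sequence and its limit into the kernel without losing
  convergence. The use is for ranges: one that contains the common kernel of finitely many
  continuous functionals is closed.\<close>

lemma closed_finite_codim:
  assumes "finite I" "\<And>i. i \<in> I \<Longrightarrow> functional_in (l i)"
    and "subspace X" "X \<subseteq> V" "subspace Y" "Y \<subseteq> X"
    and "\<And>x. x \<in> X \<Longrightarrow> (\<forall>i\<in>I. l i x = 0) \<Longrightarrow> x \<in> Y"
    and "\<And>n. y n \<in> Y" "x \<in> X" "(\<lambda>n. N (y n - x)) \<longlonglongrightarrow> 0"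
  shows "x \<in> Y"
  using assms
proof (induction I arbitrary: X Y y x rule: finite_induct)
  case empty
  then show ?case by simp
next
  case (insert r I)
  let ?K = "{x. l r x = 0}"
  note X = insert.prems(2,3) and Y = insert.prems(4,5) and y = insert.prems(7-9)
  have lr: "functional_in (l r)" using insert.prems(1) by blast
  note lrD = functional_inD[OF lr]
  have sub: "subspace (Z \<inter> ?K)" if "subspace Z" "Z \<subseteq> V" for Z
  proof -
    have [simp]: "l r 0 = 0" using lrD(4)[of 0] by simp
    show ?thesis using that lrD(1,2) unfolding subspace_def by (auto simp: subsetD)
  qed
  have yV: "y n \<in> V" and xV: "x \<in> V" for n using X Y y by blast+
  have lim: "(\<lambda>n. l r (y n)) \<longlonglongrightarrow> l r x"
    using functional_in_tendsto[OF lr yV xV insert.prems(9)] .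
  have IH: "x' \<in> Y \<inter> ?K" if "x' \<in> X \<inter> ?K" "\<And>n. y' n \<in> Y \<inter> ?K" "(\<lambda>n. N (y' n - x')) \<longlonglongrightarrow> 0" for x' y'
  proof (rule insert.IH[of "X \<inter> ?K" "Y \<inter> ?K" y' x'])
    show "functional_in (l i)" if "i \<in> I" for i using insert.prems(1) that by blast
    show "subspace (X \<inter> ?K)" "subspace (Y \<inter> ?K)" "X \<inter> ?K \<subseteq> V" "Y \<inter> ?K \<subseteq> X \<inter> ?K"
      using sub[of X] sub[of Y] insert.prems(2-5) by blast+
    show "x \<in> Y \<inter> ?K" if "x \<in> X \<inter> ?K" "\<forall>i\<in>I. l i x = 0" for x
      using insert.prems(6)[of x] that by blast
    show "x' \<in> X \<inter> ?K" "\<And>n. y' n \<in> Y \<inter> ?K" "(\<lambda>n. N (y' n - x')) \<longlonglongrightarrow> 0" by fact+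
  qed
  show ?case
  proof (cases "\<forall>y\<in>Y. l r y = 0")
    case True
    then have "(\<lambda>n. l r (y n)) \<longlonglongrightarrow> 0" using y(1) by simp
    then have "l r x = 0" using lim LIMSEQ_unique by blast
    then show ?thesis using IH[of x y] y True by blast
  next
    case False
    then obtain y1 where y1: "y1 \<in> Y" "l r y1 \<noteq> 0" by auto
    define y0 where "y0 = (1 / l r y1) \<odot> y1"
    have y0: "y0 \<in> Y" using y1 Y(1) by (simp add: y0_def subspace_scale)
    have y0V: "y0 \<in> V" "y0 \<in> X" using y0 X Y by blast+
    have ly0: "l r y0 = 1" unfolding y0_def using y1 X Y by (subst lrD(1)) auto
    let ?x = "x - l r x \<odot> y0" and ?y = "\<lambda>n. y n - l r (y n) \<odot> y0"
    have "?x \<in> Y \<inter> ?K"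
    proof (rule IH)
      show "?x \<in> X \<inter> ?K"
        using X y y0V xV ly0 by (simp add: lrD subspace_diff subspace_scale)
      show "?y n \<in> Y \<inter> ?K" for n
        using Y y y0 y0V yV ly0 by (simp add: lrD subspace_diff subspace_scale)
      have bound: "norm (N (?y n - ?x)) \<le> N (y n - x) + cmod (l r (y n) - l r x) * N y0" for n
      proof -
        have eq: "?y n - ?x = (y n - x) - (l r (y n) - l r x) \<odot> y0"
          by (simp add: scale_left_diff_distrib)
        have "N (?y n - ?x) \<le> N (y n - x) + N ((l r (y n) - l r x) \<odot> y0)"
          unfolding eq using yV xV y0V by (intro N_diff) auto
        then have "N (?y n - ?x) \<le> N (y n - x) + cmod (l r (y n) - l r x) * N y0"
          using N_scale[OF y0V(1), of "l r (y n) - l r x"] by linarith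
        then show "norm (N (?y n - ?x)) \<le> N (y n - x) + cmod (l r (y n) - l r x) * N y0"
          using N_nonneg[of "?y n - ?x"] yV xV y0V by auto
      qed
      have lim0: "(\<lambda>n. N (y n - x) + cmod (l r (y n) - l r x) * N y0) \<longlonglongrightarrow> 0"
        using tendsto_add[OF y(3) tendsto_mult_left_zero[OF tendsto_norm_zero[OF LIM_zero[OF lim]], of "N y0"]]
        by simp
      show "(\<lambda>n. N (?y n - ?x)) \<longlonglongrightarrow> 0"
        by (rule Lim_null_comparison[OF always_eventually lim0]) (rule allI, rule bound)
    qed
    then have "?x + l r x \<odot> y0 \<in> Y"
      using y0 Y(1) by (intro subspace_add subspace_scale) auto
    then show ?thesis by simp
  qed
qed

text \<open>The solution is the sum of the Neumann series with terms \<open>f n\<close>.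
  Completeness is assumed for absolutely convergent series, which is the form needed here. The
  partial sums solve the equation up to \<open>w \<odot> f n\<close> (\<open>tele\<close>), and this
  error tends to 0 in \<open>N\<close>.\<close>

lemma neumann_surj:
  assumes S: "linear_in S" "\<And>x. x \<in> V \<Longrightarrow> N (S x) \<le> \<kappa> * N x" "0 \<le> \<kappa>" "\<kappa> < cmod w"
    and y: "y \<in> V"
  shows "\<exists>x\<in>V. N (w \<odot> x - S x - y) = 0"
proof -
  have w: "w \<noteq> 0" using S by auto
  define f where "f n = (1 / w) ^ Suc n \<odot> (S ^^ n) y" for n
  have SV: "(S ^^ n) y \<in> V" for n
    using linear_in_funpow[OF S(1)] y by (auto simp: linear_in_def)
  have fV: "f n \<in> V" for n using SV by (simp add: f_def)
  have Nf: "N (f n) \<le> (\<kappa> / cmod w) ^ n * (N y / cmod w)" for n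
  proof -
    have "N ((S ^^ n) y) \<le> \<kappa> ^ n * N y"
    proof (induction n)
      case (Suc n)
      have "N (S ((S ^^ n) y)) \<le> \<kappa> * N ((S ^^ n) y)" using S(2) SV by blast
      also have "\<dots> \<le> \<kappa> * (\<kappa> ^ n * N y)" using Suc S(3) by (intro mult_left_mono)
      finally show ?case by simp
    qed simp
    then have "N (f n) \<le> cmod ((1 / w) ^ Suc n) * (\<kappa> ^ n * N y)"
      unfolding f_def using N_scale[OF SV] by (meson mult_left_mono norm_ge_zero order_trans)
    then show ?thesis by (simp add: norm_mult norm_power norm_divide power_divide field_simps)
  qed
  have r: "0 \<le> \<kappa> / cmod w" "\<kappa> / cmod w < 1" using S w by (auto simp: field_simps)
  have sumf: "summable (\<lambda>n. N (f n))"
    by (rule summable_comparison_test'[where g="\<lambda>n. (\<kappa> / cmod w) ^ n * (N y / cmod w)" and N=0])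
      (use Nf r N_nonneg[OF fV] S in \<open>auto intro!: summable_mult2 summable_geometric\<close>)
  obtain x where x: "x \<in> V" "(\<lambda>n. N (x - (\<Sum>i<n. f i))) \<longlonglongrightarrow> 0"
    using N_complete[OF fV sumf] by blast
  let ?s = "\<lambda>n. \<Sum>i<n. f i"
  have sV: "?s n \<in> V" for n using fV by (intro V_sum)
  have tele: "w \<odot> ?s n - S (?s n) = y - w \<odot> f n" for n
  proof (induction n)
    case 0
    then show ?case using w by (simp add: linear_in_zero[OF S(1)] f_def)
  next
    case (Suc n)
    have "S (f n) = w \<odot> f (Suc n)"
      using linear_inD(2)[OF S(1) SV] w by (simp add: f_def)
    moreover have "S (?s n + f n) = S (?s n) + S (f n)"
      using linear_inD(3)[OF S(1) sV fV] .
    ultimately show ?case using Suc by (simp add: scale_right_distrib algebra_simps)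
  qed
  let ?e = "w \<odot> x - S x - y"
  have bound: "N ?e \<le> (cmod w + \<kappa>) * N (x - ?s n) + cmod w * N (f n)" for n
  proof -
    have d: "x - ?s n \<in> V" using x sV by auto
    have y_eq: "y = w \<odot> ?s n - S (?s n) + w \<odot> f n" using tele[of n] by simp
    have "?e = (w \<odot> (x - ?s n) - S (x - ?s n)) - w \<odot> f n"
      using linear_inD(4)[OF S(1) x(1) sV] by (subst y_eq) (simp add: scale_right_diff_distrib)
    also have "N \<dots> \<le> N (w \<odot> (x - ?s n) - S (x - ?s n)) + N (w \<odot> f n)"
      using d fV linear_inD(1)[OF S(1)] by (intro N_diff) auto
    also have "\<dots> \<le> (N (w \<odot> (x - ?s n)) + N (S (x - ?s n))) + N (w \<odot> f n)"
      using d linear_inD(1)[OF S(1)] by (intro add_right_mono N_diff) auto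
    also have "\<dots> \<le> (cmod w * N (x - ?s n) + \<kappa> * N (x - ?s n)) + cmod w * N (f n)"
      using d fV S(2) by (intro add_mono N_scale) auto
    finally show ?thesis by (simp add: algebra_simps)
  qed
  have "(\<lambda>n. (cmod w + \<kappa>) * N (x - ?s n) + cmod w * N (f n)) \<longlonglongrightarrow> 0"
    using tendsto_add[OF tendsto_mult_right_zero[OF x(2)] tendsto_mult_right_zero[OF summable_LIMSEQ_zero[OF sumf]]] by simp
  then have "N ?e \<le> 0"
    using bound by (intro LIMSEQ_le_const[where a="N ?e"]) auto
  moreover have "0 \<le> N ?e" using x y linear_inD(1)[OF S(1)] by (intro N_nonneg) auto
  ultimately show ?thesis using x by (intro bexI[of _ x]) auto
qed

text \<open>Off a finite rank operator, \<open>z\<^sup>n - T\<^sup>n = (z - T) R = R (z - T)\<close> is invertible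
  by a Neumann series; the Fredholm property of \<open>z - T\<close> follows.\<close>

lemma fredholm_finite_rank_perturbation:
  assumes T: "linear_in T" and Tb: "\<And>x. x \<in> V \<Longrightarrow> N (T x) \<le> C * N x"
    and I: "finite I" "\<And>i. i \<in> I \<Longrightarrow> functional_in (l i)" "\<And>i. i \<in> I \<Longrightarrow> g i \<in> V"
    and small: "\<And>x. x \<in> V \<Longrightarrow> N ((T ^^ n) x - (\<Sum>i\<in>I. l i x \<odot> g i)) \<le> \<kappa> * N x"
    and \<kappa>: "0 \<le> \<kappa>" "\<kappa> < cmod z ^ n"
  defines "A \<equiv> \<lambda>x. z \<odot> x - T x"
  shows "\<exists>B. finite B \<and> B \<subseteq> V \<and> (\<forall>x\<in>V. N (A x) = 0 \<longrightarrow> (\<exists>u. N (x - (\<Sum>e\<in>B. u e \<odot> e)) = 0))"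
    and "\<And>f y. (\<And>k::nat. f k \<in> V) \<Longrightarrow> y \<in> V \<Longrightarrow> (\<lambda>k. N (A (f k) - y)) \<longlonglongrightarrow> 0 \<Longrightarrow>
           \<exists>x\<in>V. N (A x - y) = 0"
    and "\<exists>B. finite B \<and> B \<subseteq> V \<and> (\<forall>y\<in>V. \<exists>x\<in>V. \<exists>u. N (y - (A x + (\<Sum>e\<in>B. u e \<odot> e))) = 0)"
proof -
  define K where "K x = (\<Sum>i\<in>I. l i x \<odot> g i)" for x
  define S where "S x = (T ^^ n) x - K x" for x
  define L where "L x = z ^ n \<odot> x - S x" for x
  have KV: "K x \<in> V" for x unfolding K_def using I by (intro V_sum) auto
  have TnV: "(T ^^ m) x \<in> V" if "x \<in> V" for x m
    using linear_in_funpow[OF T] that by (auto simp: linear_in_def)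
  have linK: "K (c \<odot> x + y) = c \<odot> K x + K y" if "x \<in> V" "y \<in> V" for x y c
  proof -
    have "K (c \<odot> x + y) = (\<Sum>i\<in>I. c \<odot> l i x \<odot> g i + l i y \<odot> g i)"
      unfolding K_def using that functional_inD(1,2)[OF I(2)]
      by (intro sum.cong) (auto simp: scale_left_distrib)
    then show ?thesis by (simp add: K_def sum.distrib scale_sum_right)
  qed
  have linS: "linear_in S"
    unfolding linear_in_def
    using linear_in_funpow[OF T, of n] linK KV
    by (auto simp: S_def linear_in_def scale_right_diff_distrib)
  have linL: "linear_in L"
    using linS unfolding linear_in_def L_def
    by (auto simp: scale_right_diff_distrib scale_right_distrib scale_left_commute)
  have linA: "linear_in A"
    using T unfolding linear_in_def A_def
    by (auto simp: scale_right_diff_distrib scale_right_distrib scale_left_commute)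
  have Sb: "N (S x) \<le> \<kappa> * N x" if "x \<in> V" for x
    using small[OF that] by (simp add: S_def K_def)
  have zn: "\<kappa> < cmod (z ^ n)" using \<kappa> by (simp add: norm_power)
  have L_surj: "\<exists>x\<in>V. N (L x - y) = 0" if "y \<in> V" for y
    using neumann_surj[OF linS Sb \<kappa>(1) zn that] by (simp add: L_def)
  \<comment> \<open>Since \<open>z ^ n\<close> beats the norm of \<open>S\<close>, \<open>L\<close>
    is bounded below. This gives injectivity modulo null vectors and the continuity of the inverse
    \<open>M\<close>.\<close>
  have L_below: "(cmod (z ^ n) - \<kappa>) * N x \<le> N (L x)" if "x \<in> V" for x
  proof -
    have z0: "z ^ n \<noteq> 0"
    proof
      assume z: "z ^ n = 0"
      show False using zn \<kappa>(1) unfolding z by simp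
    qed
    have "x = (1 / z ^ n) \<odot> (L x + S x)" unfolding L_def using scale_scale[of "1 / z ^ n" "z ^ n" x] z0 by auto
    then have "N x \<le> cmod (1 / z ^ n) * N (L x + S x)"
      using N_scale[of "L x + S x" "1 / z ^ n"] linear_inD(1)[OF linL] linear_inD(1)[OF linS] that by auto
    then have "cmod (z ^ n) * N x \<le> N (L x + S x)"
      using z0 by (simp add: norm_divide field_simps)
    also have "\<dots> \<le> N (L x) + \<kappa> * N x"
      using N_add[of "L x" "S x"] Sb[OF that] linear_inD(1)[OF linL] linear_inD(1)[OF linS] that by force
    finally show ?thesis by (simp add: algebra_simps)
  qed
  have L_inj: "N x = 0" if "x \<in> V" "N (L x) = 0" for x
    using L_below[OF that(1)] that zn N_nonneg[OF that(1)] by (simp add: mult_le_0_iff)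
  \<comment> \<open>A right inverse of \<open>L\<close> chosen pointwise. It is linear and bounded
    modulo null vectors, which is enough once it is followed by a continuous functional.\<close>
  define M where "M y = (SOME x. x \<in> V \<and> N (L x - y) = 0)" for y
  have M: "M y \<in> V" "N (L (M y) - y) = 0" if "y \<in> V" for y
    using someI_ex[of "\<lambda>x. x \<in> V \<and> N (L x - y) = 0"] L_surj[OF that] unfolding M_def by blast+
  have W: "z ^ n \<odot> x - (T ^^ n) x = L x - K x" for x
    by (simp add: L_def S_def)
  \<comment> \<open>The factorisation of \<open>z ^ m - T ^^ m\<close> through \<open>z - T\<close>,
    with the preimage built by recursion as \<open>z \<odot> y + (T ^^ m) x\<close>.\<close>
  have factor: "\<exists>y\<in>V. A y = z ^ m \<odot> x - (T ^^ m) x" if "x \<in> V" for x m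
  proof (induction m)
    case 0
    then show ?case using linear_in_zero[OF linA] by (intro bexI[of _ 0]) auto
  next
    case (Suc m)
    then obtain y where y: "y \<in> V" "A y = z ^ m \<odot> x - (T ^^ m) x" by blast
    have "A (z \<odot> y + (T ^^ m) x) = z \<odot> A y + A ((T ^^ m) x)"
      using linA y TnV[OF that] by (auto simp: linear_in_def)
    also have "\<dots> = z ^ Suc m \<odot> x - (T ^^ Suc m) x"
      unfolding y by (simp add: A_def scale_right_diff_distrib)
    finally show ?case using y TnV[OF that] by (intro bexI[of _ "z \<odot> y + (T ^^ m) x"]) auto
  qed
  \<comment> \<open>The Fredholm property asks for combinations over a set of vectors, whereas the
    family \<open>e\<close> may repeat a vector; coefficients of equal vectors are added up.\<close>
  have range_finite: "\<exists>u. (\<Sum>i\<in>I. c i \<odot> e i) = (\<Sum>v\<in>e ` I. u v \<odot> v)" for c :: "_ \<Rightarrow> complex" and e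
  proof (rule exI[of _ "\<lambda>v. \<Sum>i\<in>{i \<in> I. e i = v}. c i"])
    have "(\<Sum>i\<in>I. c i \<odot> e i) = (\<Sum>v\<in>e ` I. \<Sum>i\<in>{i \<in> I. e i = v}. c i \<odot> e i)"
      using I(1) by (rule sum.image_gen)
    also have "\<dots> = (\<Sum>v\<in>e ` I. (\<Sum>i\<in>{i \<in> I. e i = v}. c i) \<odot> v)"
      by (intro sum.cong refl) (simp add: scale_sum_left)
    finally show "(\<Sum>i\<in>I. c i \<odot> e i) = (\<Sum>v\<in>e ` I. (\<Sum>i\<in>{i \<in> I. e i = v}. c i) \<odot> v)" .
  qed

  \<comment> \<open>If \<open>A x\<close> is null, so is
    \<open>z ^ n \<odot> x - (T ^^ n) x\<close>. Hence \<open>L x\<close> agrees with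
    \<open>K x\<close>, and \<open>x\<close> with a combination of the vectors
    \<open>M (g i)\<close>.\<close>
  show "\<exists>B. finite B \<and> B \<subseteq> V \<and> (\<forall>x\<in>V. N (A x) = 0 \<longrightarrow> (\<exists>u. N (x - (\<Sum>e\<in>B. u e \<odot> e)) = 0))"
  proof (intro exI[of _ "(\<lambda>i. M (g i)) ` I"] conjI ballI impI)
    show "finite ((\<lambda>i. M (g i)) ` I)" "(\<lambda>i. M (g i)) ` I \<subseteq> V" using I M by auto
    fix x assume x: "x \<in> V" "N (A x) = 0"
    have Tx: "N (T y) = 0" if "y \<in> V" "N y = 0" for y
      using Tb[OF that(1)] N_nonneg[OF linear_inD(1)[OF T that(1)]] that by simp
    have pw: "N (z ^ m \<odot> x - (T ^^ m) x) = 0" for m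
    proof (induction m)
      case (Suc m)
      let ?d = "z ^ m \<odot> x - (T ^^ m) x"
      have dV: "?d \<in> V" using x TnV by auto
      have "z ^ Suc m \<odot> x - (T ^^ Suc m) x = z ^ m \<odot> A x + T ?d"
        using linear_inD(2)[OF T x(1)] linear_inD(4)[OF T, of "z ^ m \<odot> x" "(T ^^ m) x"] x TnV
        by (simp add: A_def scale_right_diff_distrib mult.commute)
      also have "N \<dots> \<le> N (z ^ m \<odot> A x) + N (T ?d)"
        using linear_inD(1)[OF linA x(1)] linear_inD(1)[OF T dV] by (intro N_add) auto
      also have "\<dots> \<le> 0"
        using N_scale[OF linear_inD(1)[OF linA x(1)], of "z ^ m"] x Tx[OF dV Suc] by simp
      finally show ?case using N_nonneg[of "z ^ Suc m \<odot> x - (T ^^ Suc m) x"] x TnV[OF x(1), of "Suc m"] by fastforce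
    qed simp
    have LK: "N (L x - K x) = 0" using pw[of n] unfolding W .
    define v where "v = (\<Sum>i\<in>I. l i x \<odot> M (g i))"
    have vV: "v \<in> V" unfolding v_def using I M by (intro V_sum) auto
    have Lv: "L v = (\<Sum>i\<in>I. l i x \<odot> L (M (g i)))"
      unfolding v_def using linear_in_sum[OF linL I(1)] linear_inD(2)[OF linL] M I(3) by simp
    have "N (K x - L v) = N (\<Sum>i\<in>I. l i x \<odot> (g i - L (M (g i))))"
      unfolding K_def Lv by (simp add: sum_subtractf scale_right_diff_distrib)
    also have "\<dots> \<le> (\<Sum>i\<in>I. N (l i x \<odot> (g i - L (M (g i)))))"
      using I M linear_inD(1)[OF linL] by (intro N_sum) auto
    also have "\<dots> \<le> (\<Sum>i\<in>I. 0)"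
    proof (intro sum_mono)
      fix i assume i: "i \<in> I"
      have "N (g i - L (M (g i))) = 0"
        using M[OF I(3)[OF i]] N_minus_commute[OF I(3)[OF i] linear_inD(1)[OF linL]] by simp
      then show "N (l i x \<odot> (g i - L (M (g i)))) \<le> 0"
        using N_scale[of "g i - L (M (g i))" "l i x"] I(3)[OF i] M linear_inD(1)[OF linL] by auto
    qed
    finally have "N (K x - L v) = 0"
      using N_nonneg[of "K x - L v"] KV linear_inD(1)[OF linL vV] by fastforce
    then have "N (L x - L v) = 0"
      using N_null_trans[OF _ KV _ LK] linear_inD(1)[OF linL] x vV by blast
    then have "N (x - v) = 0"
      using L_inj[of "x - v"] linear_inD(4)[OF linL x(1) vV] x vV by auto
    then show "\<exists>u. N (x - (\<Sum>e\<in>(\<lambda>i. M (g i)) ` I. u e \<odot> e)) = 0"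
      using range_finite[of "\<lambda>i. l i x" "\<lambda>i. M (g i)"] unfolding v_def by auto
  qed

  \<comment> \<open>Modulo null vectors \<open>y\<close> is \<open>L (M y)\<close>, which is
    \<open>z ^ n - T ^^ n\<close> applied to \<open>M y\<close>, an element of the range of
    \<open>A\<close>, plus \<open>K (M y)\<close>, an element of the span of the
    \<open>g i\<close>.\<close>
  show "\<exists>B. finite B \<and> B \<subseteq> V \<and> (\<forall>y\<in>V. \<exists>x\<in>V. \<exists>u. N (y - (A x + (\<Sum>e\<in>B. u e \<odot> e))) = 0)"
  proof (intro exI[of _ "g ` I"] conjI ballI)
    show "finite (g ` I)" "g ` I \<subseteq> V" using I by auto
    fix y assume y: "y \<in> V"
    obtain x where x: "x \<in> V" "A x = z ^ n \<odot> M y - (T ^^ n) (M y)"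
      using factor[OF M(1)[OF y]] by blast
    have "A x + K (M y) = L (M y)" unfolding x W by simp
    then have "N (y - (A x + K (M y))) = 0"
      using M[OF y] N_minus_commute[OF y linear_inD(1)[OF linL M(1)[OF y]]] by simp
    moreover obtain u where "K (M y) = (\<Sum>v\<in>g ` I. u v \<odot> v)"
      using range_finite[of "\<lambda>i. l i (M y)" g] unfolding K_def by blast
    ultimately have "N (y - (A x + (\<Sum>v\<in>g ` I. u v \<odot> v))) = 0" by simp
    then show "\<exists>x\<in>V. \<exists>u. N (y - (A x + (\<Sum>e\<in>g ` I. u e \<odot> e))) = 0"
      using x(1) by blast
  qed

  fix f :: "nat \<Rightarrow> 'v" and y
  assume f: "\<And>k. f k \<in> V" "y \<in> V" "(\<lambda>k. N (A (f k) - y)) \<longlonglongrightarrow> 0"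
  define Y where "Y = {y \<in> V. \<exists>x\<in>V. N (A x - y) = 0}"
  have "subspace Y"
    unfolding subspace_def
  proof (intro conjI ballI allI)
    show "0 \<in> Y" using linear_in_zero[OF linA] by (auto simp: Y_def intro!: bexI[of _ 0])
  next
    fix c u assume "u \<in> Y"
    then obtain x where x: "u \<in> V" "x \<in> V" "N (A x - u) = 0" by (auto simp: Y_def)
    have "A (c \<odot> x) - c \<odot> u = c \<odot> (A x - u)"
      using linear_inD(2)[OF linA x(2)] by (simp add: scale_right_diff_distrib)
    then have "N (A (c \<odot> x) - c \<odot> u) \<le> 0"
      using N_scale[of "A x - u" c] x linear_inD(1)[OF linA x(2)] by simp
    then show "c \<odot> u \<in> Y" unfolding Y_def
      using x N_nonneg[of "A (c \<odot> x) - c \<odot> u"] linear_inD(1)[OF linA, of "c \<odot> x"]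
      by (auto intro!: bexI[of _ "c \<odot> x"])
  next
    fix u v assume "u \<in> Y" "v \<in> Y"
    then obtain x x' where x: "u \<in> V" "x \<in> V" "N (A x - u) = 0" and x': "v \<in> V" "x' \<in> V" "N (A x' - v) = 0"
      by (auto simp: Y_def)
    have eq: "A (x + x') - (u + v) = (A x - u) + (A x' - v)"
      using linear_inD(3)[OF linA x(2) x'(2)] by simp
    have "N (A (x + x') - (u + v)) \<le> 0"
      unfolding eq using N_add[of "A x - u" "A x' - v"] x x' linear_inD(1)[OF linA] by simp
    then show "u + v \<in> Y" unfolding Y_def
      using x x' N_nonneg[of "A (x + x') - (u + v)"] linear_inD(1)[OF linA, of "x + x'"]
      by (auto intro!: bexI[of _ "x + x'"])
  qed
  \<comment> \<open>If all \<open>l i (M x)\<close> vanish, then \<open>K (M x) = 0\<close>, and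
    \<open>x\<close>, represented by \<open>L (M x)\<close>, lies in the range of
    \<open>z ^ n - T ^^ n\<close> and so in that of \<open>A\<close>.\<close>
  have "y \<in> Y"
  proof (rule closed_finite_codim[where I=I and l="\<lambda>i y. l i (M y)" and X=V and y="\<lambda>k. A (f k)"])
    show "finite I" "subspace V" "V \<subseteq> V" "subspace Y" "Y \<subseteq> V" "y \<in> V" "(\<lambda>k. N (A (f k) - y)) \<longlonglongrightarrow> 0"
      using I subspace_V \<open>subspace Y\<close> f by (auto simp: Y_def)
    show "A (f k) \<in> Y" for k
      using f linear_inD(1)[OF linA] by (auto simp: Y_def intro!: bexI[of _ "f k"])
  next
    fix x assume x: "x \<in> V" "\<forall>i\<in>I. l i (M x) = 0"
    then have "K (M x) = 0" by (simp add: K_def)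
    then obtain x' where x': "x' \<in> V" "A x' = L (M x)"
      using factor[OF M(1)[OF x(1)], of n] unfolding W by auto
    then show "x \<in> Y" using x M by (auto simp: Y_def intro!: bexI[of _ x'])
  next
    fix i assume i: "i \<in> I"
    note li = I(2)[OF i]
    obtain c where c: "\<And>x. x \<in> V \<Longrightarrow> cmod (l i x) \<le> c * N x"
      using li unfolding functional_in_def by blast
    show "functional_in (\<lambda>y. l i (M y))"
      unfolding functional_in_def
    proof (intro conjI ballI allI exI)
      fix x y k assume x: "x \<in> V" and y: "y \<in> V"
      let ?d = "M (k \<odot> x + y) - (k \<odot> M x + M y)"
      have dV: "?d \<in> V" using M x y by auto
      have "L ?d = (L (M (k \<odot> x + y)) - (k \<odot> x + y)) - (k \<odot> (L (M x) - x) + (L (M y) - y))"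
        using linear_inD[OF linL] M x y by (simp add: scale_right_diff_distrib)
      also have "N \<dots> \<le> N (L (M (k \<odot> x + y)) - (k \<odot> x + y)) + (cmod k * N (L (M x) - x) + N (L (M y) - y))"
      proof -
        have *: "L (M (k \<odot> x + y)) - (k \<odot> x + y) \<in> V" "L (M x) - x \<in> V" "L (M y) - y \<in> V"
          using linear_inD(1)[OF linL] M x y by auto
        show ?thesis
          using N_diff[OF *(1), of "k \<odot> (L (M x) - x) + (L (M y) - y)"] N_add[of "k \<odot> (L (M x) - x)" "L (M y) - y"]
            N_scale[OF *(2), of k] * by fastforce
      qed
      also have "\<dots> = 0" using M x y by simp
      finally have "N ?d = 0" using L_inj[OF dV] N_nonneg[OF linear_inD(1)[OF linL dV]] by simp
      then have "l i ?d = 0" using functional_inD(4)[OF li dV] by simp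
      then show "l i (M (k \<odot> x + y)) = k * l i (M x) + l i (M y)"
        using functional_inD[OF li] M x y by simp
    next
      fix x assume x: "x \<in> V"
      have "cmod (l i (M x)) \<le> c * N (M x)" using c M x by blast
      also have "\<dots> \<le> \<bar>c\<bar> * N (M x)" using N_nonneg[OF M(1)[OF x]] by (intro mult_right_mono) auto
      also have "\<dots> \<le> \<bar>c\<bar> * (N x / (cmod (z ^ n) - \<kappa>))"
      proof (intro mult_left_mono)
        have "N (L (M x)) \<le> N (L (M x) - x) + N x"
          using N_add[of "L (M x) - x" x] M x linear_inD(1)[OF linL] by simp
        then have "(cmod (z ^ n) - \<kappa>) * N (M x) \<le> N x"
          using L_below[OF M(1)[OF x]] M(2)[OF x] by linarith
        then show "N (M x) \<le> N x / (cmod (z ^ n) - \<kappa>)" using zn by (simp add: field_simps)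
      qed simp
      finally show "cmod (l i (M x)) \<le> (\<bar>c\<bar> / (cmod (z ^ n) - \<kappa>)) * N x" by simp
    qed
  qed
  then show "\<exists>x\<in>V. N (A x - y) = 0" by (auto simp: Y_def)
qed

end

section \<open>The space of \<open>q\<close>-summable sequences\<close>

text \<open>The sequence is nonnegative with norm at most \<open>t\<close>. Partial sums in place of
  the series spare all summability conditions, treat finite and infinite q alike, and make the bound
  stable under pointwise limits (\<open>lq_le_lim\<close>).\<close>

definition lq_le :: "ereal \<Rightarrow> (nat \<Rightarrow> real) \<Rightarrow> real \<Rightarrow> bool" where
  "lq_le q x t \<longleftrightarrow> 0 \<le> t \<and> (\<forall>k. 0 \<le> x k) \<and>
     (if q = \<infinity> then \<forall>k. x k \<le> t
      else \<forall>n. (\<Sum>k<n. x k powr real_of_ereal q) \<le> t powr real_of_ereal q)"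

text \<open>Convexity of the power function, including the end point 0, where it amounts to
  \<open>c powr p \<le> c\<close> for c between 0 and 1.\<close>

lemma powr_convex_nonneg:
  fixes p u v A B :: real
  assumes p: "1 \<le> p" and "0 \<le> u" "0 \<le> v" "0 \<le> A" "0 \<le> B" "A + B = 1"
  shows "(A * u + B * v) powr p \<le> A * u powr p + B * v powr p"
proof -
  have zero: "(c * w) powr p \<le> c * w powr p" if "0 \<le> c" "c \<le> 1" "0 \<le> w" for c w
  proof -
    have "c powr p \<le> c powr 1 \<or> c = 0"
      using that p powr_mono'[of 1 p c] by blast
    then show ?thesis using that by (cases "c = 0") (auto simp: powr_mult intro!: mult_right_mono)
  qed
  show ?thesis
  proof (cases "u = 0 \<or> v = 0")
    case True
    then show ?thesis using zero[of B v] zero[of A u] assms by auto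
  next
    case False
    then have "u > 0" "v > 0" using assms by auto
    then show ?thesis
      using convex_onD[OF powr_convex[OF p], of B u v] assms by (simp add: eq_diff_eq[symmetric])
  qed
qed

lemma lq_leD: assumes "lq_le q x t" shows "0 \<le> t" "0 \<le> x k"
  using assms by (auto simp: lq_le_def)

context
  fixes q :: ereal
  assumes q: "1 \<le> q"
begin

lemma real_q: "q \<noteq> \<infinity> \<Longrightarrow> 1 \<le> real_of_ereal q"
  using q by (cases q) auto

lemma lq_le_mono:
  assumes "lq_le q x t" "\<And>k. 0 \<le> y k" "\<And>k. y k \<le> x k" "t \<le> u"
  shows "lq_le q y u"
proof (cases "q = \<infinity>")
  case True
  then show ?thesis using assms unfolding lq_le_def by (meson order_trans)
next
  case False
  note p = real_q[OF False]
  have "(\<Sum>k<n. y k powr real_of_ereal q) \<le> u powr real_of_ereal q" for n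
  proof -
    have "(\<Sum>k<n. y k powr real_of_ereal q) \<le> (\<Sum>k<n. x k powr real_of_ereal q)"
      using assms p by (intro sum_mono powr_mono2) auto
    also have "\<dots> \<le> t powr real_of_ereal q" using assms False by (auto simp: lq_le_def)
    also have "\<dots> \<le> u powr real_of_ereal q" using assms p by (intro powr_mono2) (auto simp: lq_le_def)
    finally show ?thesis .
  qed
  then show ?thesis using assms False by (auto simp: lq_le_def)
qed

lemma lq_le_component: assumes "lq_le q x t" shows "x k \<le> t"
proof (cases "q = \<infinity>")
  case True
  then show ?thesis using assms by (auto simp: lq_le_def)
next
  case False
  note p = real_q[OF False]
  have "x k powr real_of_ereal q \<le> (\<Sum>k<Suc k. x k powr real_of_ereal q)"
    by (rule member_le_sum) auto
  also have "\<dots> \<le> t powr real_of_ereal q" using assms False unfolding lq_le_def by metis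
  finally have *: "x k powr real_of_ereal q \<le> t powr real_of_ereal q" .
  show ?thesis
  proof (rule ccontr)
    assume "\<not> x k \<le> t"
    then have "t powr real_of_ereal q < x k powr real_of_ereal q"
      using lq_leD[OF assms] p by (intro powr_less_mono2) auto
    then show False using * by simp
  qed
qed

lemma lq_le_zero_bound: assumes "lq_le q x 0" shows "x k = 0"
  using lq_le_component[OF assms, of k] lq_leD(2)[OF assms, of k] by simp

lemma lq_le_zero: "0 \<le> t \<Longrightarrow> lq_le q (\<lambda>_. 0) t"
  using real_q by (auto simp: lq_le_def)

lemma lq_le_scale: assumes "lq_le q x t" "0 \<le> c" shows "lq_le q (\<lambda>k. c * x k) (c * t)"
  using assms
  by (auto simp: lq_le_def powr_mult sum_distrib_left[symmetric] intro!: mult_left_mono)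

text \<open>Minkowski's inequality: with \<open>w = t + u\<close>, \<open>(x + y) / w\<close> is the convex combination
  of \<open>x / t\<close> and \<open>y / u\<close> with weights \<open>t / w\<close> and \<open>u / w\<close>.\<close>

lemma lq_le_add:
  assumes x: "lq_le q x t" and y: "lq_le q y u"
  shows "lq_le q (\<lambda>k. x k + y k) (t + u)"
proof (cases "q = \<infinity>")
  case True
  then show ?thesis using assms by (auto simp: lq_le_def intro: add_mono)
next
  case False
  define p where "p = real_of_ereal q"
  have p: "1 \<le> p" using real_q[OF False] by (simp add: p_def)
  show ?thesis
  proof (cases "t = 0 \<or> u = 0")
    case True
    then show ?thesis
    proof
      assume "t = 0"
      then have "x = (\<lambda>_. 0)" using lq_le_zero_bound[of x] x by blast
      then show ?thesis using y \<open>t = 0\<close> by simp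
    next
      assume "u = 0"
      then have "y = (\<lambda>_. 0)" using lq_le_zero_bound[of y] y by blast
      then show ?thesis using x \<open>u = 0\<close> by simp
    qed
  next
    case False
    then have t: "0 < t" and u: "0 < u" using lq_leD(1)[OF x] lq_leD(1)[OF y] by auto
    note nn = lq_leD(2)[OF x] lq_leD(2)[OF y]
    have xs: "(\<Sum>k<n. x k powr p) \<le> t powr p" and ys: "(\<Sum>k<n. y k powr p) \<le> u powr p" for n
      using x y \<open>q \<noteq> \<infinity>\<close> by (auto simp: lq_le_def p_def)
    define A where "A = t / (t + u)"
    define B where "B = u / (t + u)"
    have AB: "0 \<le> A" "0 \<le> B" "A + B = 1" using t u by (auto simp: A_def B_def add_divide_distrib[symmetric])
    have pt: "(x k + y k) powr p \<le> (t + u) powr p * (A * (x k powr p / t powr p) + B * (y k powr p / u powr p))" for k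
    proof -
      have "x k + y k = (t + u) * (A * (x k / t) + B * (y k / u))"
      proof -
        have w: "t + u \<noteq> 0" using t u by simp
        have "(t + u) * (A * (x k / t)) = x k" "(t + u) * (B * (y k / u)) = y k"
          using t u w unfolding A_def B_def by simp_all
        then show ?thesis by (simp only: distrib_left)
      qed
      then have "(x k + y k) powr p = (t + u) powr p * (A * (x k / t) + B * (y k / u)) powr p"
        using t u AB nn by (simp add: powr_mult)
      also have "\<dots> \<le> (t + u) powr p * (A * (x k / t) powr p + B * (y k / u) powr p)"
        using t u AB nn p by (intro mult_left_mono powr_convex_nonneg) auto
      finally show ?thesis using t u nn by (simp add: powr_divide)
    qed
    have "(\<Sum>k<n. (x k + y k) powr p) \<le> (t + u) powr p" for n
    proof -
      have "(\<Sum>k<n. (x k + y k) powr p) \<le> (\<Sum>k<n. (t + u) powr p * (A * (x k powr p / t powr p) + B * (y k powr p / u powr p)))"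
        by (intro sum_mono pt)
      also have "\<dots> = (t + u) powr p * (A * ((\<Sum>k<n. x k powr p) / t powr p) + B * ((\<Sum>k<n. y k powr p) / u powr p))"
        by (simp add: sum_distrib_left sum.distrib sum_divide_distrib algebra_simps)
      also have "\<dots> \<le> (t + u) powr p * (A * 1 + B * 1)"
        using xs ys AB t u by (intro mult_left_mono add_mono) (auto simp: divide_le_eq_1)
      finally show ?thesis using AB by simp
    qed
    then show ?thesis using t u nn \<open>q \<noteq> \<infinity>\<close> by (auto simp: lq_le_def p_def)
  qed
qed

lemma lq_le_sum:
  assumes "finite A" "\<And>i. i \<in> A \<Longrightarrow> lq_le q (x i) (t i)"
  shows "lq_le q (\<lambda>k. \<Sum>i\<in>A. x i k) (\<Sum>i\<in>A. t i)"
  using assms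
proof (induction A rule: finite_induct)
  case (insert i A)
  then show ?case using lq_le_add[of "x i" "t i" "\<lambda>k. \<Sum>i\<in>A. x i k" "sum t A"] by simp
qed (simp add: lq_le_zero)

text \<open>Fatou's lemma for sequences: each partial sum has finitely many terms, so pointwise
  convergence carries the bound over.\<close>

lemma lq_le_lim:
  assumes "\<And>n. lq_le q (x n) (t n)" "\<And>k. (\<lambda>n. x n k) \<longlonglongrightarrow> y k" "t \<longlonglongrightarrow> u"
  shows "lq_le q y u"
proof -
  have y: "0 \<le> y k" for k
    using assms(1,2) by (intro LIMSEQ_le_const[OF assms(2)]) (auto simp: lq_le_def)
  have u: "0 \<le> u" using assms(1) by (intro LIMSEQ_le_const[OF assms(3)]) (auto simp: lq_le_def)
  show ?thesis
  proof (cases "q = \<infinity>")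
    case True
    have "y k \<le> u" for k
      using assms(1) True by (intro LIMSEQ_le[OF assms(2,3)]) (auto simp: lq_le_def)
    then show ?thesis using True y u by (auto simp: lq_le_def)
  next
    case False
    note p = real_q[OF False]
    have "(\<Sum>k<n. y k powr real_of_ereal q) \<le> u powr real_of_ereal q" for n
    proof (rule LIMSEQ_le)
      show "(\<lambda>m. \<Sum>k<n. x m k powr real_of_ereal q) \<longlonglongrightarrow> (\<Sum>k<n. y k powr real_of_ereal q)"
        using assms(1,2) p
        by (intro tendsto_sum tendsto_powr' tendsto_const) (auto simp: lq_le_def intro!: always_eventually)
      show "(\<lambda>m. t m powr real_of_ereal q) \<longlonglongrightarrow> u powr real_of_ereal q"
        using assms(1,3) p
        by (intro tendsto_powr' tendsto_const) (auto simp: lq_le_def intro!: always_eventually)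
      show "\<exists>N. \<forall>m\<ge>N. (\<Sum>k<n. x m k powr real_of_ereal q) \<le> t m powr real_of_ereal q"
        using assms(1) False by (auto simp: lq_le_def)
    qed
    then show ?thesis using False y u by (auto simp: lq_le_def)
  qed
qed

lemma lq_le_shift_left: assumes "lq_le q x t" shows "lq_le q (\<lambda>k. x (k + i)) t"
proof (cases "q = \<infinity>")
  case True
  then show ?thesis using assms by (auto simp: lq_le_def)
next
  case False
  have "(\<Sum>k<n. x (k + i) powr real_of_ereal q) \<le> t powr real_of_ereal q" for n
  proof -
    have "(\<Sum>k<n. x (k + i) powr real_of_ereal q) = (\<Sum>k\<in>(\<lambda>k. k + i) ` {..<n}. x k powr real_of_ereal q)"
      by (subst sum.reindex) auto
    also have "\<dots> \<le> (\<Sum>k<n+i. x k powr real_of_ereal q)"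
      by (intro sum_mono2) auto
    also have "\<dots> \<le> t powr real_of_ereal q" using assms False by (auto simp: lq_le_def)
    finally show ?thesis .
  qed
  then show ?thesis using assms False by (auto simp: lq_le_def)
qed

lemma lq_le_shift_right: assumes "lq_le q x t" shows "lq_le q (\<lambda>k. if i \<le> k then x (k - i) else 0) t"
proof (cases "q = \<infinity>")
  case True
  then show ?thesis using assms by (auto simp: lq_le_def)
next
  case False
  note p = real_q[OF False]
  have "(\<Sum>k<n. (if i \<le> k then x (k - i) else 0) powr real_of_ereal q) \<le> t powr real_of_ereal q" for n
  proof -
    have "(\<Sum>k<n. (if i \<le> k then x (k - i) else 0) powr real_of_ereal q) =
        (\<Sum>k\<in>{i..<n}. x (k - i) powr real_of_ereal q)"
      using p by (intro sum.mono_neutral_cong_right) auto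
    also have "\<dots> = (\<Sum>k<n-i. x k powr real_of_ereal q)"
      by (rule sum.reindex_bij_witness[of _ "\<lambda>k. k + i" "\<lambda>k. k - i"]) auto
    also have "\<dots> \<le> t powr real_of_ereal q" using assms False by (auto simp: lq_le_def)
    finally show ?thesis .
  qed
  then show ?thesis using assms False by (auto simp: lq_le_def)
qed

text \<open>Young's inequality. The convolution is the sum over i of \<open>K i\<close> times the
  shift of \<open>x\<close> by i; a shift does not increase the norm, and Minkowski's inequality
  adds up the weights. The kernel lives on the integers because a transferred atom spreads to
  coarser as well as to finer levels.\<close>

lemma lq_le_convolution:
  fixes K :: "int \<Rightarrow> real"
  assumes x: "lq_le q x t" and K: "\<And>i. 0 \<le> K i" "\<And>F. finite F \<Longrightarrow> sum K F \<le> \<kappa>"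
  shows "lq_le q (\<lambda>j. \<Sum>k<n. K (int k - int j) * x k) (\<kappa> * t)"
proof -
  note t = lq_leD(1)[OF x] and xn = lq_leD(2)[OF x]
  have nn: "0 \<le> (\<Sum>k<n. K (int k - int j) * x k)" for j
    using K xn by (intro sum_nonneg) auto
  define y where "y i j = (if 0 \<le> int j + i then x (nat (int j + i)) else 0)" for i :: int and j :: nat
  have ylq: "lq_le q (y i) t" for i
  proof (cases "0 \<le> i")
    case True
    then have "y i = (\<lambda>k. x (k + nat i))" by (auto simp: y_def nat_add_distrib)
    then show ?thesis using lq_le_shift_left[OF x] by simp
  next
    case False
    then have "y i = (\<lambda>k. if nat (- i) \<le> k then x (k - nat (- i)) else 0)"
      by (auto simp: y_def fun_eq_iff nat_le_iff intro!: arg_cong[of _ _ x])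
    then show ?thesis using lq_le_shift_right[OF x] by simp
  qed
  have fin: "lq_le q (\<lambda>j. \<Sum>i\<in>F. K i * y i j) (\<kappa> * t)" if "finite F" for F
  proof -
    have "lq_le q (\<lambda>j. \<Sum>i\<in>F. K i * y i j) (\<Sum>i\<in>F. K i * t)"
      using that K by (intro lq_le_sum lq_le_scale ylq)
    then show ?thesis
      by (rule lq_le_mono)
        (use K(1) lq_leD(2)[OF ylq] mult_right_mono[OF K(2)[OF that] t] in
          \<open>auto intro!: sum_nonneg simp: sum_distrib_right\<close>)
  qed
  \<comment> \<open>Only shifts between -m and n are visible at indices below \<open>m\<close>, so
    the finite version applies; its bound is independent of \<open>m\<close>.\<close>
  have part: "lq_le q (\<lambda>j. if j < m then \<Sum>k<n. K (int k - int j) * x k else 0) (\<kappa> * t)" for m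
  proof (rule lq_le_mono[OF fin[of "{- int m..int n}"]])
    fix j
    show "0 \<le> (if j < m then \<Sum>k<n. K (int k - int j) * x k else 0)" using nn by simp
    have nn': "0 \<le> (\<Sum>i\<in>{- int m..int n}. K i * y i j)"
      using K lq_leD(2)[OF ylq] by (intro sum_nonneg) auto
    have "(\<Sum>k<n. K (int k - int j) * x k) \<le> (\<Sum>i\<in>{- int m..int n}. K i * y i j)" if "j < m"
    proof -
      have "(\<Sum>k<n. K (int k - int j) * x k) = (\<Sum>i\<in>(\<lambda>k. int k - int j) ` {..<n}. K i * y i j)"
        by (subst sum.reindex) (auto simp: inj_on_def y_def)
      also have "\<dots> \<le> (\<Sum>i\<in>{- int m..int n}. K i * y i j)"
        using that K lq_leD(2)[OF ylq] by (intro sum_mono2) auto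
      finally show ?thesis .
    qed
    then show "(if j < m then \<Sum>k<n. K (int k - int j) * x k else 0) \<le> (\<Sum>i\<in>{- int m..int n}. K i * y i j)"
      using nn' by auto
  qed auto
  show ?thesis
  proof (rule lq_le_lim[OF part])
    show "(\<lambda>m. if j < m then \<Sum>k<n. K (int k - int j) * x k else 0) \<longlonglongrightarrow> (\<Sum>k<n. K (int k - int j) * x k)" for j
      by (rule tendsto_eventually[OF eventually_mono[OF eventually_gt_at_top[of j]]]) auto
  qed auto
qed

lemma lq_le_finite_support:
  assumes "\<And>k. 0 \<le> x k" "\<And>k. n \<le> k \<Longrightarrow> x k = 0"
  shows "\<exists>t. lq_le q x t"
proof -
  have unit: "lq_le q (\<lambda>k. if k = i then c else 0) c" if "0 \<le> c" for i c
  proof (cases "q = \<infinity>")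
    case False
    note p = real_q[OF False]
    have "(\<Sum>k<m. (if k = i then c else 0) powr real_of_ereal q) \<le> c powr real_of_ereal q" for m
    proof -
      have "(\<Sum>k<m. (if k = i then c else 0) powr real_of_ereal q) = (\<Sum>k<m. if k = i then c powr real_of_ereal q else 0)"
        using p by (intro sum.cong) auto
      also have "\<dots> \<le> c powr real_of_ereal q" by simp
      finally show ?thesis .
    qed
    then show ?thesis using that False by (auto simp: lq_le_def)
  qed (use that in \<open>auto simp: lq_le_def\<close>)
  have "lq_le q (\<lambda>k. \<Sum>i<n. if k = i then x i else 0) (\<Sum>i<n. x i)"
    using assms by (intro lq_le_sum unit) auto
  moreover have "(\<lambda>k. \<Sum>i<n. if k = i then x i else 0) = x"
    using assms(2) by (auto simp: fun_eq_iff not_less)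
  ultimately show ?thesis by auto
qed

text \<open>The bridge to \<open>lq_le\<close>: afterwards the supremum and the series in the
  definition of the cost are not unfolded again.\<close>

lemma finite_cost_iff: "finite_cost a b q c \<longleftrightarrow> (\<exists>t. lq_le q (level_sum a b c) t)"
  and cost_le_iff: "finite_cost a b q c \<Longrightarrow> cost a b q c \<le> t \<longleftrightarrow> lq_le q (level_sum a b c) t"
proof -
  have nn: "0 \<le> level_sum a b c k" for k by (simp add: level_sum_def sum_nonneg)
  have "(finite_cost a b q c \<longleftrightarrow> (\<exists>t. lq_le q (level_sum a b c) t)) \<and>
    (finite_cost a b q c \<longrightarrow> (cost a b q c \<le> t \<longleftrightarrow> lq_le q (level_sum a b c) t))"
  proof (cases "q = \<infinity>")
    case True
    have "lq_le q (level_sum a b c) t \<longleftrightarrow> (\<forall>k. level_sum a b c k \<le> t)" for t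
      using True nn[of 0] nn by (auto simp: lq_le_def intro: order_trans)
    then show ?thesis using True
      by (auto simp: finite_cost_def cost_def bdd_above_def cSUP_le_iff)
  next
    case False
    define p where "p = real_of_ereal q"
    have p: "1 \<le> p" using real_q[OF False] by (simp add: p_def)
    let ?f = "\<lambda>k. level_sum a b c k powr p"
    have fc: "finite_cost a b q c \<longleftrightarrow> summable ?f" using False by (simp add: finite_cost_def p_def)
    have lq: "lq_le q (level_sum a b c) t \<longleftrightarrow> 0 \<le> t \<and> (\<forall>n. (\<Sum>k<n. ?f k) \<le> t powr p)" for t
      using False nn by (simp add: lq_le_def p_def)
    have 1: "cost a b q c \<le> t \<longleftrightarrow> lq_le q (level_sum a b c) t" if s: "summable ?f" for t
    proof -
      have "0 \<le> suminf ?f" using s by (intro suminf_nonneg) auto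
      have c: "cost a b q c = suminf ?f powr (1 / p)" using False by (simp add: cost_def p_def)
      have "suminf ?f powr (1 / p) \<le> t \<longleftrightarrow> 0 \<le> t \<and> suminf ?f \<le> t powr p"
      proof
        assume a: "suminf ?f powr (1 / p) \<le> t"
        then have "0 \<le> t" by (meson order_trans powr_ge_zero)
        moreover have "(suminf ?f powr (1 / p)) powr p \<le> t powr p"
          using a p by (intro powr_mono2) auto
        ultimately show "0 \<le> t \<and> suminf ?f \<le> t powr p"
          using p \<open>0 \<le> suminf ?f\<close> by (simp add: powr_powr)
      next
        assume a: "0 \<le> t \<and> suminf ?f \<le> t powr p"
        then have "suminf ?f powr (1 / p) \<le> (t powr p) powr (1 / p)"
          using p \<open>0 \<le> suminf ?f\<close> by (intro powr_mono2) auto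
        then show "suminf ?f powr (1 / p) \<le> t" using a p by (simp add: powr_powr)
      qed
      also have "\<dots> \<longleftrightarrow> 0 \<le> t \<and> (\<forall>n. (\<Sum>k<n. ?f k) \<le> t powr p)"
      proof -
        have "suminf ?f \<le> w \<longleftrightarrow> (\<forall>n. (\<Sum>k<n. ?f k) \<le> w)" for w
        proof
          show "\<forall>n. (\<Sum>k<n. ?f k) \<le> w" if "suminf ?f \<le> w"
            using sum_le_suminf[OF s, of "{..<_}"] that by (auto intro: order_trans)
          show "suminf ?f \<le> w" if "\<forall>n. (\<Sum>k<n. ?f k) \<le> w"
            using suminf_le_const[OF s] that by blast
        qed
        then show ?thesis by simp
      qed
      finally show ?thesis unfolding c lq .
    qed
    have 2: "summable ?f" if "lq_le q (level_sum a b c) t" for t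
    proof (rule summableI_nonneg_bounded)
      show "(\<Sum>k<n. ?f k) \<le> t powr p" for n using that unfolding lq by blast
    qed simp
    have 3: "lq_le q (level_sum a b c) (cost a b q c)" if "summable ?f"
      using 1[OF that, of "cost a b q c"] by simp
    have "finite_cost a b q c \<longleftrightarrow> (\<exists>t. lq_le q (level_sum a b c) t)"
      unfolding fc using 2 3 by metis
    then show ?thesis using 1[of t] unfolding fc by metis
  qed
  then show "finite_cost a b q c \<longleftrightarrow> (\<exists>t. lq_le q (level_sum a b c) t)"
    "finite_cost a b q c \<Longrightarrow> cost a b q c \<le> t \<longleftrightarrow> lq_le q (level_sum a b c) t" by blast+
qed

end

section \<open>The dyadic martingale decomposition\<close>

text \<open>By monotone convergence the series of norms has a finite integral, so it is finite
  almost everywhere and dominates all remainders; dominated convergence does the rest.\<close>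

lemma integrable_series_complete:
  fixes f :: "nat \<Rightarrow> 'a \<Rightarrow> 'b::{banach, second_countable_topology}"
  assumes f: "\<And>n. integrable M (f n)" and s: "summable (\<lambda>n. LINT x|M. norm (f n x))"
  shows "\<exists>F. integrable M F \<and> (\<lambda>n. LINT x|M. norm (F x - (\<Sum>i<n. f i x))) \<longlonglongrightarrow> 0"
proof -
  have [measurable]: "f n \<in> borel_measurable M" for n using f by auto
  have "(\<integral>\<^sup>+x. (\<Sum>n. ennreal (norm (f n x))) \<partial>M) = (\<Sum>n. \<integral>\<^sup>+x. ennreal (norm (f n x)) \<partial>M)"
    by (intro nn_integral_suminf) auto
  also have "\<dots> = (\<Sum>n. ennreal (LINT x|M. norm (f n x)))"
    using f by (intro suminf_cong nn_integral_eq_integral) auto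
  also have "\<dots> = ennreal (\<Sum>n. LINT x|M. norm (f n x))"
    using s by (intro suminf_ennreal2) auto
  finally have "(\<integral>\<^sup>+x. (\<Sum>n. ennreal (norm (f n x))) \<partial>M) \<noteq> \<infinity>" by simp
  then have "AE x in M. (\<Sum>n. ennreal (norm (f n x))) \<noteq> \<infinity>"
    by (intro nn_integral_PInf_AE) auto
  then have ae: "AE x in M. summable (\<lambda>n. norm (f n x))"
    by eventually_elim (auto intro: summable_suminf_not_top)
  let ?F = "\<lambda>x. \<Sum>n. f n x"
  have F: "integrable M ?F" by (rule integrable_suminf[OF f ae s])
  have G: "integrable M (\<lambda>x. \<Sum>n. norm (f n x))"
    using f ae s by (intro integrable_suminf) auto
  have "(\<lambda>n. LINT x|M. norm (?F x - (\<Sum>i<n. f i x))) \<longlonglongrightarrow> (LINT x|M. 0)"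
  proof (rule integral_dominated_convergence[where w="\<lambda>x. \<Sum>n. norm (f n x)"])
    show "(\<lambda>x. norm (?F x - (\<Sum>i<n. f i x))) \<in> borel_measurable M" for n by measurable
    show "AE x in M. (\<lambda>n. norm (?F x - (\<Sum>i<n. f i x))) \<longlonglongrightarrow> 0"
      using ae
    proof eventually_elim
      case (elim x)
      have "(\<lambda>n. ?F x - (\<Sum>i<n. f i x)) \<longlonglongrightarrow> ?F x - ?F x"
        by (intro tendsto_diff tendsto_const summable_LIMSEQ summable_norm_cancel[OF elim])
      then show ?case by (intro tendsto_norm_zero) simp
    qed
    show "AE x in M. norm (norm (?F x - (\<Sum>i<n. f i x))) \<le> (\<Sum>n. norm (f n x))" for n
      using ae
    proof eventually_elim
      case (elim x)
      have "?F x - (\<Sum>i<n. f i x) = (\<Sum>i. f (i + n) x)"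
        using suminf_minus_initial_segment[OF summable_norm_cancel[OF elim], of n] by simp
      also have "norm \<dots> \<le> (\<Sum>i. norm (f (i + n) x))"
        using elim by (intro summable_norm) (simp add: summable_iff_shift[of "\<lambda>i. norm (f i x)"])
      also have "\<dots> = (\<Sum>i. norm (f i x)) - (\<Sum>i<n. norm (f i x))"
        by (rule suminf_minus_initial_segment[OF elim])
      also have "\<dots> \<le> (\<Sum>i. norm (f i x))" by (simp add: sum_nonneg)
      finally show ?case by simp
    qed
  qed (use G in auto)
  then show ?thesis using F by auto
qed

locale besov_scale =
  fixes a b s :: real and q :: ereal
  assumes ab: "a < b" and s: "0 < s" and q: "1 \<le> q"
begin

abbreviation "M \<equiv> lebesgue_on {a..b}"

definition l1 :: "cfun \<Rightarrow> real" where "l1 \<psi> = (LINT x|M. cmod (\<psi> x))"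

definition len :: "nat \<Rightarrow> real" where "len k = (b - a) / 2 ^ k"

definition cell :: "nat \<Rightarrow> nat \<Rightarrow> real set" where
  "cell k i = {a + real i * (b - a) / 2 ^ k ..< a + real (Suc i) * (b - a) / 2 ^ k}"

definition cint :: "nat \<Rightarrow> nat \<Rightarrow> cfun \<Rightarrow> complex" where
  "cint k i \<psi> = (LINT x|M. indicator (cell k i) x *\<^sub>R \<psi> x)"

definition avg :: "nat \<Rightarrow> nat \<Rightarrow> cfun \<Rightarrow> complex" where
  "avg k i \<psi> = cint k i \<psi> / complex_of_real (len k)"

definition incr :: "nat \<Rightarrow> nat \<Rightarrow> cfun \<Rightarrow> complex" where
  "incr k i \<psi> = avg k i \<psi> - (if k = 0 then 0 else avg (k - 1) (i div 2) \<psi>)"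

text \<open>The coefficients of the martingale decomposition of \<open>\<psi>\<close> along the dyadic filtration.\<close>

definition mcoef :: "nat \<Rightarrow> nat \<Rightarrow> cfun \<Rightarrow> complex" where
  "mcoef k i \<psi> = incr k i \<psi> * complex_of_real (len k powr (1 - s))"

text \<open>The norm of this sequence in the sense of \<open>lq_le\<close> is equivalent to the
  Besov norm (\<open>lev_besov_norm\<close>, \<open>besov_lev\<close>), but it is computed level by
  level and needs no infimum.\<close>

definition lev :: "cfun \<Rightarrow> nat \<Rightarrow> real" where
  "lev \<psi> k = (\<Sum>i<2^k. cmod (mcoef k i \<psi>))"

section \<open>Geometry of the dyadic cells\<close>

lemma len_pos [simp]: "0 < len k" and len_nonneg [simp]: "0 \<le> len k" and len_nz [simp]: "len k \<noteq> 0"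
  using ab by (auto simp: len_def)

lemma len_Suc: "len (Suc k) = len k / 2" by (simp add: len_def)

lemma len_add: "len (k + m) = len k / 2 ^ m" by (simp add: len_def power_add)

lemma len_tendsto: "len \<longlonglongrightarrow> 0"
proof -
  have "(\<lambda>k. (b - a) * (1 / 2) ^ k) \<longlonglongrightarrow> (b - a) * 0"
    by (intro tendsto_intros LIMSEQ_power_zero) auto
  then show ?thesis by (simp add: len_def[abs_def] power_divide)
qed

lemma mem_cell: "x \<in> cell k i \<longleftrightarrow> real i \<le> (x - a) / len k \<and> (x - a) / len k < real i + 1"
  using ab by (auto simp: cell_def len_def field_simps)

lemma cell_unique: "x \<in> cell k i \<Longrightarrow> x \<in> cell k j \<Longrightarrow> i = j"
  unfolding mem_cell by linarith

lemma cell_alt: "cell k i = {a + real i * len k ..< a + (real i + 1) * len k}"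
  by (auto simp: cell_def len_def algebra_simps)

lemma cell_subset: assumes "i < 2 ^ k" shows "cell k i \<subseteq> {a..<b}"
proof -
  have "real i + 1 \<le> 2 ^ k"
    using assms by (metis Suc_leI add.commute of_nat_Suc of_nat_le_iff of_nat_numeral of_nat_power)
  then have "(real i + 1) * len k \<le> 2 ^ k * len k" by (intro mult_right_mono) auto
  also have "\<dots> = b - a" by (simp add: len_def)
  finally have "(real i + 1) * len k \<le> b - a" .
  moreover have "0 \<le> real i * len k" by simp
  ultimately show ?thesis unfolding cell_alt by auto
qed

lemma cell_exists: assumes "x \<in> {a..<b}" shows "\<exists>i<2^k. x \<in> cell k i"
proof -
  let ?y = "(x - a) / len k"
  have y: "0 \<le> ?y" "?y < 2 ^ k"
  proof -
    show "0 \<le> ?y" using assms by simp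
    have "x - a < 2 ^ k * len k" using assms by (simp add: len_def)
    then show "?y < 2 ^ k" by (simp add: divide_less_eq)
  qed
  have "x \<in> cell k (nat \<lfloor>?y\<rfloor>)" unfolding mem_cell using y by simp
  moreover have "nat \<lfloor>?y\<rfloor> < 2 ^ k"
  proof -
    have "\<lfloor>?y\<rfloor> < 2 ^ k" using y(2) by (simp add: floor_less_iff)
    then show ?thesis using y(1) by (simp add: nat_less_iff)
  qed
  ultimately show ?thesis by blast
qed

lemma cell_parent: "x \<in> cell (Suc k) i \<Longrightarrow> x \<in> cell k (i div 2)"
proof -
  assume "x \<in> cell (Suc k) i"
  moreover have "(x - a) / len (Suc k) = 2 * ((x - a) / len k)" by (simp add: len_Suc)
  ultimately have 1: "real i \<le> 2 * ((x - a) / len k)" "2 * ((x - a) / len k) < real i + 1"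
    unfolding mem_cell by simp_all
  moreover have "real i = 2 * real (i div 2) + real (i mod 2)"
    by (metis div_mult_mod_eq mult.commute of_nat_add of_nat_mult of_nat_numeral)
  moreover have "real (i mod 2) \<le> 1" by simp
  moreover have "real (i mod 2) \<ge> 0" by simp
  ultimately show ?thesis unfolding mem_cell by linarith
qed

lemma cell_split: "cell k i = cell (Suc k) (2 * i) \<union> cell (Suc k) (2 * i + 1)"
proof (intro set_eqI)
  fix x
  define y where "y = (x - a) / len k"
  have y: "(x - a) / len (Suc k) = 2 * y" by (simp add: y_def len_Suc)
  show "x \<in> cell k i \<longleftrightarrow> x \<in> cell (Suc k) (2 * i) \<union> cell (Suc k) (2 * i + 1)"
    unfolding Un_iff mem_cell y y_def[symmetric] by auto
qed

lemma cell_inj: assumes "cell k i = cell m j" shows "k = m \<and> i = j"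
proof -
  have "a + real i * len k < a + (real i + 1) * len k" "a + real j * len m < a + (real j + 1) * len m"
    by (simp_all add: distrib_right)
  then have *: "a + real i * len k = a + real j * len m" "a + (real i + 1) * len k = a + (real j + 1) * len m"
    using assms unfolding cell_alt by (metis atLeastLessThan_eq_iff)+
  then have "len k = len m" by (simp add: distrib_right)
  then have "(2::real) ^ k = 2 ^ m" using ab by (simp add: len_def field_simps)
  then have "k = m" by simp
  then show ?thesis using * by simp
qed

lemma inj_cell: "inj_on (cell k) A"
  using cell_inj by (auto simp: inj_on_def)

lemma dyadic_cell: "dyadic a b k = cell k ` {..<2^k}"
  by (simp add: dyadic_def cell_def)

lemma cell_measure: "measure lebesgue (cell k i) = len k"
  by (simp add: cell_alt distrib_right)

lemma atom_cell: "atom s (cell k i) x = complex_of_real (len k powr (s - 1) * indicator (cell k i) x)"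
  by (simp add: atom_def cell_measure)

lemma cell_sets [measurable, simp]: "i < 2 ^ k \<Longrightarrow> cell k i \<in> sets M"
  using cell_subset[of i k] by (auto simp: sets_restrict_space_iff cell_def)

lemma integral_cell: assumes "i < 2 ^ k" shows "(LINT x|M. indicator (cell k i) x) = len k"
    and "integrable M (indicator (cell k i) :: real \<Rightarrow> real)"
proof -
  have "measure M (cell k i) = measure lebesgue (cell k i)"
    using cell_subset[OF assms] by (intro measure_restrict_space) auto
  moreover have "cell k i \<inter> {a..b} = cell k i" using cell_subset[OF assms] by auto
  ultimately show "(LINT x|M. indicator (cell k i) x) = len k"
    by (simp add: cell_measure)
  have "emeasure M (cell k i) = emeasure lebesgue (cell k i)"
    using cell_subset[OF assms] by (intro emeasure_restrict_space) auto
  also have "\<dots> < \<infinity>" by (simp add: cell_alt distrib_right)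
  finally show "integrable M (indicator (cell k i) :: real \<Rightarrow> real)"
    using assms by (intro integrable_real_indicator) auto
qed

lemma integrable_cell: "integrable M \<psi> \<Longrightarrow> i < 2 ^ k \<Longrightarrow> integrable M (\<lambda>x. indicator (cell k i) x *\<^sub>R \<psi> x :: complex)"
  by (intro integrable_mult_indicator) auto

lemma integrable_atom: "i < 2 ^ k \<Longrightarrow> integrable M (atom s (cell k i))"
  unfolding atom_cell[abs_def] using integral_cell(2)[of i k] by simp

section \<open>L1 norms, integrals over cells and martingale levels\<close>

lemma l1_nonneg [simp]: "0 \<le> l1 \<psi>" by (simp add: l1_def)

lemma l1_triangle: "integrable M \<psi> \<Longrightarrow> integrable M \<phi> \<Longrightarrow> l1 (\<lambda>x. \<psi> x + \<phi> x) \<le> l1 \<psi> + l1 \<phi>"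
proof -
  assume *: "integrable M \<psi>" "integrable M \<phi>"
  then have "l1 (\<lambda>x. \<psi> x + \<phi> x) \<le> (LINT x|M. cmod (\<psi> x) + cmod (\<phi> x))"
    unfolding l1_def by (intro integral_mono) (auto intro: norm_triangle_ineq)
  also have "\<dots> = l1 \<psi> + l1 \<phi>"
    unfolding l1_def using * by (intro Bochner_Integration.integral_add) auto
  finally show ?thesis .
qed

lemma l1_scale: "l1 (\<lambda>x. c * \<psi> x) = cmod c * l1 \<psi>"
  by (simp add: l1_def norm_mult)

lemma l1_minus_commute: "l1 (\<lambda>x. \<psi> x - \<phi> x) = l1 (\<lambda>x. \<phi> x - \<psi> x)"
  by (simp add: l1_def norm_minus_commute)

lemma l1_sum: "finite A \<Longrightarrow> (\<And>i. i \<in> A \<Longrightarrow> integrable M (f i)) \<Longrightarrow> l1 (\<lambda>x. \<Sum>i\<in>A. f i x) \<le> (\<Sum>i\<in>A. l1 (f i))"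
proof (induction A rule: finite_induct)
  case (insert i A)
  then have "l1 (\<lambda>x. f i x + (\<Sum>i\<in>A. f i x)) \<le> l1 (f i) + l1 (\<lambda>x. \<Sum>i\<in>A. f i x)"
    by (intro l1_triangle) auto
  with insert show ?case by simp
qed (simp add: l1_def)

lemma l1_atom: assumes "i < 2 ^ k" shows "l1 (atom s (cell k i)) = len k powr s"
proof -
  have "l1 (atom s (cell k i)) = (LINT x|M. len k powr (s - 1) * indicator (cell k i) x)"
    unfolding l1_def atom_cell by (intro Bochner_Integration.integral_cong) (auto simp: norm_mult indicator_def)
  also have "\<dots> = len k powr (s - 1) * len k" using integral_cell[OF assms] by simp
  also have "\<dots> = len k powr s" by (simp add: powr_diff)
  finally show ?thesis .
qed

lemma cint_linear:
  assumes "integrable M \<psi>" "integrable M \<phi>" "i < 2 ^ k"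
  shows "cint k i (\<lambda>x. c * \<psi> x + \<phi> x) = c * cint k i \<psi> + cint k i \<phi>"
proof -
  have "cint k i (\<lambda>x. c * \<psi> x + \<phi> x) = (LINT x|M. c * (indicator (cell k i) x *\<^sub>R \<psi> x) + indicator (cell k i) x *\<^sub>R \<phi> x)"
    unfolding cint_def by (intro Bochner_Integration.integral_cong) (auto simp: algebra_simps)
  also have "\<dots> = (LINT x|M. c * (indicator (cell k i) x *\<^sub>R \<psi> x)) + cint k i \<phi>"
    unfolding cint_def using assms
    by (intro Bochner_Integration.integral_add integrable_mult_right integrable_cell)
  also have "\<dots> = c * cint k i \<psi> + cint k i \<phi>"
    unfolding cint_def by (simp only: integral_mult_right_zero)
  finally show ?thesis .
qed

lemma parent_less: fixes i :: nat shows "i < 2 ^ k \<Longrightarrow> k \<noteq> 0 \<Longrightarrow> i div 2 < 2 ^ (k - 1)"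
  by (cases k) auto

lemma mcoef_linear:
  assumes "integrable M \<psi>" "integrable M \<phi>" "i < 2 ^ k"
  shows "mcoef k i (\<lambda>x. c * \<psi> x + \<phi> x) = c * mcoef k i \<psi> + mcoef k i \<phi>"
  using cint_linear[OF assms] cint_linear[OF assms(1,2), of "i div 2" "k - 1"] parent_less[OF assms(3)]
  by (cases "k = 0") (simp_all add: mcoef_def incr_def avg_def add_divide_distrib algebra_simps)

lemma lev_nonneg [simp]: "0 \<le> lev \<psi> k" by (simp add: lev_def sum_nonneg)

lemma lev_linear:
  assumes "integrable M \<psi>" "integrable M \<phi>"
  shows "lev (\<lambda>x. c * \<psi> x + \<phi> x) k \<le> cmod c * lev \<psi> k + lev \<phi> k"
proof -
  have "lev (\<lambda>x. c * \<psi> x + \<phi> x) k = (\<Sum>i<2^k. cmod (c * mcoef k i \<psi> + mcoef k i \<phi>))"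
    unfolding lev_def using mcoef_linear[OF assms] by simp
  also have "\<dots> \<le> (\<Sum>i<2^k. cmod c * cmod (mcoef k i \<psi>) + cmod (mcoef k i \<phi>))"
    by (intro sum_mono) (metis norm_mult norm_triangle_ineq)
  finally show ?thesis by (simp add: lev_def sum.distrib sum_distrib_left)
qed

lemma lev_zero [simp]: "lev (\<lambda>x. 0) k = 0"
proof -
  have "avg k i (\<lambda>x. 0) = 0" for k i by (simp add: avg_def cint_def)
  then show ?thesis by (cases "k = 0") (simp_all add: lev_def mcoef_def incr_def)
qed

lemma lev_sum:
  assumes "finite A" "\<And>i. i \<in> A \<Longrightarrow> integrable M (f i)"
  shows "lev (\<lambda>x. \<Sum>i\<in>A. c i * f i x) k \<le> (\<Sum>i\<in>A. cmod (c i) * lev (f i) k)"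
  using assms
proof (induction A rule: finite_induct)
  case (insert i A)
  then have "lev (\<lambda>x. c i * f i x + (\<Sum>i\<in>A. c i * f i x)) k \<le> cmod (c i) * lev (f i) k + lev (\<lambda>x. \<Sum>i\<in>A. c i * f i x) k"
    by (intro lev_linear) auto
  with insert show ?case by simp
qed simp

lemma sum_indicator_le: "(\<Sum>i<2^k. indicator (cell k i) x :: real) \<le> 1"
proof (cases "\<exists>i<2^k. x \<in> cell k i")
  case True
  then obtain i where i: "i < 2 ^ k" "x \<in> cell k i" by auto
  have "(\<Sum>j<2^k. indicator (cell k j) x :: real) = (\<Sum>j<2^k. if j = i then 1 else 0)"
  proof (intro sum.cong refl)
    fix j
    show "indicator (cell k j) x = (if j = i then 1 else 0 :: real)"
      using cell_unique[of x k j i] i(2) by (cases "x \<in> cell k j") auto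
  qed
  then show ?thesis by simp
next
  case False
  then have "(\<Sum>i<2^k. indicator (cell k i) x :: real) = 0" by (intro sum.neutral) auto
  then show ?thesis by simp
qed

lemma sum_cint_le:
  assumes "integrable M \<psi>"
  shows "(\<Sum>i<2^k. cmod (cint k i \<psi>)) \<le> l1 \<psi>"
proof -
  have int: "integrable M (\<lambda>x. indicator (cell k i) x * cmod (\<psi> x))" if "i < 2 ^ k" for i
    using integrable_mult_indicator[OF cell_sets[OF that] integrable_norm[OF assms]] by simp
  have "(\<Sum>i<2^k. cmod (cint k i \<psi>)) \<le> (\<Sum>i<2^k. LINT x|M. indicator (cell k i) x * cmod (\<psi> x))"
  proof (intro sum_mono)
    fix i :: nat assume "i \<in> {..<2^k}"
    have "cmod (cint k i \<psi>) \<le> (LINT x|M. cmod (indicator (cell k i) x *\<^sub>R \<psi> x))"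
      unfolding cint_def by (rule integral_norm_bound)
    then show "cmod (cint k i \<psi>) \<le> (LINT x|M. indicator (cell k i) x * cmod (\<psi> x))" by simp
  qed
  also have "\<dots> = (LINT x|M. (\<Sum>i<2^k. indicator (cell k i) x * cmod (\<psi> x)))"
    using int by (intro Bochner_Integration.integral_sum[symmetric]) auto
  also have "\<dots> \<le> l1 \<psi>"
    unfolding l1_def
  proof (intro integral_mono)
    show "integrable M (\<lambda>x. \<Sum>i<2^k. indicator (cell k i) x * cmod (\<psi> x))"
      using int by (intro Bochner_Integration.integrable_sum) auto
    show "(\<Sum>i<2^k. indicator (cell k i) x * cmod (\<psi> x)) \<le> cmod (\<psi> x)" for x
      using mult_right_mono[OF sum_indicator_le, of "cmod (\<psi> x)" k x] by (simp add: sum_distrib_right)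
  qed (use assms in auto)
  finally show ?thesis .
qed

lemma cint_le: assumes "integrable M \<psi>" "i < 2 ^ k" shows "cmod (cint k i \<psi>) \<le> l1 \<psi>"
proof -
  have "cmod (cint k i \<psi>) \<le> (\<Sum>i<2^k. cmod (cint k i \<psi>))"
    using assms by (intro member_le_sum) auto
  then show ?thesis using sum_cint_le[OF assms(1), of k] by simp
qed

lemma sum_parent: "(\<Sum>i<2^Suc k. g (i div 2)) = (\<Sum>i<2^k. 2 * g i)" for g :: "nat \<Rightarrow> real"
proof -
  have "(\<Sum>i<2*n. g (i div 2)) = (\<Sum>i<n. 2 * g i)" for n
    by (induction n) auto
  from this[of "2 ^ k"] show ?thesis by simp
qed

text \<open>The bound that uses no regularity. The averages over the cells of a level sum to at most
  the L1 norm divided by the cell length. The parent averages obey the same bound: each occurs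
  twice, but parent cells are twice as long.\<close>

lemma lev_le_l1:
  assumes "integrable M \<psi>"
  shows "lev \<psi> k \<le> 2 * len k powr (- s) * l1 \<psi>"
proof -
  let ?p = "\<lambda>i. if k = 0 then 0 else avg (k - 1) (i div 2) \<psi>"
  have 1: "(\<Sum>i<2^k. cmod (avg k i \<psi>)) \<le> l1 \<psi> / len k" for k
    using divide_right_mono[OF sum_cint_le[OF assms, of k], of "len k"]
    by (simp add: avg_def norm_divide sum_divide_distrib)
  have 2: "(\<Sum>i<2^k. cmod (?p i)) \<le> l1 \<psi> / len k"
  proof (cases k)
    case (Suc m)
    have "(\<Sum>i<2^k. cmod (?p i)) = (\<Sum>i<2^m. 2 * cmod (avg m i \<psi>))"
      unfolding Suc by (subst sum_parent[symmetric]) simp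
    also have "\<dots> = 2 * (\<Sum>i<2^m. cmod (avg m i \<psi>))" by (simp add: sum_distrib_left)
    also have "\<dots> \<le> l1 \<psi> / len k" using mult_left_mono[OF 1[of m], of 2] unfolding Suc len_Suc by (simp add: mult.commute)
    finally show ?thesis .
  qed simp
  have "lev \<psi> k = (\<Sum>i<2^k. cmod (incr k i \<psi>)) * len k powr (1 - s)"
    by (simp add: lev_def mcoef_def norm_mult sum_distrib_right)
  also have "\<dots> \<le> (\<Sum>i<2^k. cmod (avg k i \<psi>) + cmod (?p i)) * len k powr (1 - s)"
    unfolding incr_def by (intro mult_right_mono sum_mono norm_triangle_ineq4) auto
  also have "\<dots> \<le> (l1 \<psi> / len k + l1 \<psi> / len k) * len k powr (1 - s)"
    unfolding sum.distrib using 1 2 by (intro mult_right_mono add_mono) auto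
  also have "\<dots> = 2 * len k powr (- s) * l1 \<psi>"
    by (simp add: powr_diff powr_minus field_simps)
  finally show ?thesis .
qed

lemma lev_tendsto:
  assumes "\<And>n. integrable M (f n)" "integrable M \<psi>" "(\<lambda>n. l1 (\<lambda>x. \<psi> x - f n x)) \<longlonglongrightarrow> 0"
  shows "(\<lambda>n. lev (f n) k) \<longlonglongrightarrow> lev \<psi> k"
proof -
  have 1: "lev u k \<le> lev v k + 2 * len k powr (- s) * l1 (\<lambda>x. u x - v x)" if "integrable M u" "integrable M v" for u v
    using lev_linear[of "\<lambda>x. u x - v x" v 1 k] lev_le_l1[of "\<lambda>x. u x - v x" k] that by simp
  have 2: "norm (lev (f n) k - lev \<psi> k) \<le> 2 * len k powr (- s) * l1 (\<lambda>x. \<psi> x - f n x)" for n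
    using 1[OF assms(1)[of n] assms(2)] 1[OF assms(2) assms(1)[of n]] l1_minus_commute[of \<psi> "f n"] by simp
  have "(\<lambda>n. lev (f n) k - lev \<psi> k) \<longlonglongrightarrow> 0"
    by (rule Lim_null_comparison[OF always_eventually tendsto_mult_right_zero[OF assms(3)]]) (rule allI, rule 2)
  then show ?thesis by (simp add: LIM_zero_iff)
qed

text \<open>The reduction to single building blocks: a bound on each \<open>g k i\<close> that
  depends only on the difference of levels becomes a bound on the whole series by Young's
  inequality, and \<open>lev\<close> is continuous in L1 at each level. Asking for the bound only
  where \<open>c k i \<noteq> 0\<close> permits discarding coarse levels, as in
  \<open>T_pow_tail\<close>.\<close>

lemma lq_le_lev_series:
  fixes K :: "int \<Rightarrow> real" and g :: "nat \<Rightarrow> nat \<Rightarrow> cfun" and c :: "nat \<Rightarrow> nat \<Rightarrow> complex"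
  assumes g: "\<And>k i. i < 2 ^ k \<Longrightarrow> integrable M (g k i)" and \<psi>: "integrable M \<psi>"
    and lim: "(\<lambda>n. l1 (\<lambda>x. \<psi> x - (\<Sum>k<n. \<Sum>i<2^k. c k i * g k i x))) \<longlonglongrightarrow> 0"
    and K: "\<And>i. 0 \<le> K i" "\<And>F. finite F \<Longrightarrow> sum K F \<le> \<kappa>"
    and gK: "\<And>k i j. i < 2 ^ k \<Longrightarrow> c k i \<noteq> 0 \<Longrightarrow> lev (g k i) j \<le> K (int k - int j)"
    and c: "lq_le q (\<lambda>k. \<Sum>i<2^k. cmod (c k i)) t"
  shows "lq_le q (lev \<psi>) (\<kappa> * t)"
proof (rule lq_le_lim[OF q])
  let ?f = "\<lambda>n x. \<Sum>k<n. \<Sum>i<2^k. c k i * g k i x"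
  have gi: "integrable M (\<lambda>x. \<Sum>i<2^k. c k i * g k i x)" for k
    using g by (intro Bochner_Integration.integrable_sum integrable_mult_right) auto
  show "(\<lambda>n. lev (?f n) j) \<longlonglongrightarrow> lev \<psi> j" for j
    using gi by (intro lev_tendsto \<psi> lim) auto
  show "lq_le q (lev (?f n)) (\<kappa> * t)" for n
  proof (rule lq_le_mono[OF q lq_le_convolution[OF q c K]])
    fix j
    have "lev (?f n) j \<le> (\<Sum>k<n. lev (\<lambda>x. \<Sum>i<2^k. c k i * g k i x) j)"
      using lev_sum[of "{..<n}" "\<lambda>k x. \<Sum>i<2^k. c k i * g k i x" "\<lambda>_. 1" j] gi by simp
    also have "\<dots> \<le> (\<Sum>k<n. K (int k - int j) * (\<Sum>i<2^k. cmod (c k i)))"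
    proof (intro sum_mono)
      fix k
      have "lev (\<lambda>x. \<Sum>i<2^k. c k i * g k i x) j \<le> (\<Sum>i<2^k. cmod (c k i) * lev (g k i) j)"
        using g by (intro lev_sum) auto
      also have "\<dots> \<le> (\<Sum>i<2^k. cmod (c k i) * K (int k - int j))"
      proof (intro sum_mono)
        fix i :: nat assume "i \<in> {..<2^k}"
        then show "cmod (c k i) * lev (g k i) j \<le> cmod (c k i) * K (int k - int j)"
          using gK[of i k j] by (cases "c k i = 0") (auto intro!: mult_left_mono)
      qed
      finally show "lev (\<lambda>x. \<Sum>i<2^k. c k i * g k i x) j \<le> K (int k - int j) * (\<Sum>i<2^k. cmod (c k i))"
        by (simp add: sum_distrib_left mult.commute)
    qed
    finally show "lev (?f n) j \<le> (\<Sum>k<n. K (int k - int j) * (\<Sum>i<2^k. cmod (c k i)))" .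
  qed auto
qed auto

end

lemma sum_geometric_int_le:
  fixes r :: real
  assumes "0 \<le> r" "r < 1" "finite F"
  shows "(\<Sum>z\<in>F. if 0 \<le> z then r ^ nat z else 0) \<le> 1 / (1 - r)"
proof -
  define N where "N = Suc (nat (Max (insert 0 F)))"
  have "(\<Sum>z\<in>F. if 0 \<le> z then r ^ nat z else 0) = (\<Sum>z\<in>{z\<in>F. 0 \<le> z}. r ^ nat z)"
    using assms by (intro sum.mono_neutral_cong_right) auto
  also have "\<dots> = (\<Sum>n\<in>nat ` {z\<in>F. 0 \<le> z}. r ^ n)"
    by (subst sum.reindex) (auto simp: inj_on_def)
  also have "\<dots> \<le> (\<Sum>n<N. r ^ n)"
  proof (intro sum_mono2)
    show "nat ` {z\<in>F. 0 \<le> z} \<subseteq> {..<N}"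
      using assms by (auto simp: N_def less_Suc_eq_le intro!: nat_mono)
  qed (use assms in auto)
  also have "\<dots> \<le> (\<Sum>n. r ^ n)"
    using assms by (intro sum_le_suminf summable_geometric) auto
  also have "\<dots> = 1 / (1 - r)" using assms by (intro suminf_geometric) auto
  finally show ?thesis .
qed

section \<open>Levels of atoms and partial sums of the martingale\<close>

context besov_scale
begin

lemma avg_const:
  assumes "i < 2 ^ k" "\<And>x. x \<in> cell k i \<Longrightarrow> f x = v"
  shows "avg k i f = v"
proof -
  have "cint k i f = (LINT x|M. indicator (cell k i) x *\<^sub>R v)"
    unfolding cint_def using assms(2) by (intro Bochner_Integration.integral_cong) (auto simp: indicator_def)
  also have "\<dots> = len k *\<^sub>R v"
    using integral_cell[OF assms(1)] by (subst integral_scaleR_left) auto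
  finally show ?thesis by (simp add: avg_def scaleR_conv_of_real)
qed

lemma cell_ancestor: "x \<in> cell (m + d) i \<Longrightarrow> x \<in> cell m (i div 2 ^ d)"
proof (induction d arbitrary: i)
  case (Suc d)
  then have "x \<in> cell m (i div 2 div 2 ^ d)" by (intro Suc.IH cell_parent) simp
  then show ?case by (simp add: div_mult2_eq)
qed simp

lemma incr_const:
  assumes "i < 2 ^ Suc k" "\<And>x. x \<in> cell k (i div 2) \<Longrightarrow> f x = v"
  shows "incr (Suc k) i f = 0"
proof -
  have "avg (Suc k) i f = v" using assms cell_parent by (intro avg_const) auto
  moreover have "avg k (i div 2) f = v" using assms by (intro avg_const) auto
  ultimately show ?thesis by (simp add: incr_def)
qed

text \<open>At levels up to that of the atom this is the L1 bound, with geometric decay towards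
  coarse levels. At finer levels the atom is constant on every parent cell and the increments
  vanish.\<close>

lemma lev_atom:
  assumes "i < 2 ^ m"
  shows "lev (atom s (cell m i)) k \<le> (if 0 \<le> int m - int k then 2 * (2 powr (- s)) ^ nat (int m - int k) else 0)"
proof (cases "k \<le> m")
  case True
  then obtain d where d: "m = k + d" using le_Suc_ex by blast
  have "lev (atom s (cell m i)) k \<le> 2 * len k powr (- s) * len m powr s"
    using lev_le_l1[OF integrable_atom[OF assms], of k] l1_atom[OF assms] by simp
  also have "\<dots> = 2 * (2 powr (- s)) ^ d"
    unfolding d len_add
    by (simp add: powr_divide powr_minus powr_powr powr_realpow[symmetric] field_simps powr_power)
  finally show ?thesis using True d by simp
next
  case False
  then obtain d where d: "k = Suc (m + d)" using less_imp_Suc_add by (metis not_le)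
  have "incr k j (atom s (cell m i)) = 0" if "j < 2 ^ k" for j
    unfolding d
  proof (rule incr_const)
    show "j < 2 ^ Suc (m + d)" using that d by simp
    fix x assume "x \<in> cell (m + d) (j div 2)"
    then have x: "x \<in> cell m (j div 2 div 2 ^ d)" by (rule cell_ancestor)
    then have "x \<in> cell m i \<longleftrightarrow> i = j div 2 div 2 ^ d" using cell_unique[OF x] by blast
    then show "atom s (cell m i) x = (if i = j div 2 div 2 ^ d then complex_of_real (len m powr (s - 1)) else 0)"
      by (simp add: atom_cell indicator_def)
  qed
  then have "lev (atom s (cell m i)) k = 0" by (simp add: lev_def mcoef_def)
  then show ?thesis using False by simp
qed

text \<open>The sum of the geometric kernel in \<open>lev_atom\<close>; it becomes the constant in
  the comparison of the Besov norm with the martingale levels.\<close>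

definition \<kappa>0 :: real where "\<kappa>0 = 2 / (1 - 2 powr (- s))"

lemma two_powr_s: "0 < 2 powr (- s)" "2 powr (- s) < (1::real)"
  using s by (auto simp: powr_less_one)

lemma \<kappa>0_pos: "0 < \<kappa>0" using two_powr_s by (simp add: \<kappa>0_def)

text \<open>The martingale decomposition costs at most \<open>\<kappa>0\<close> times as much as any
  other representation of the same function.\<close>

lemma lq_le_lev_rep:
  assumes \<psi>: "integrable M \<psi>"
    and lim: "(\<lambda>n. l1 (\<lambda>x. \<psi> x - (\<Sum>k<n. \<Sum>i<2^k. c k i * atom s (cell k i) x))) \<longlonglongrightarrow> 0"
    and c: "lq_le q (\<lambda>k. \<Sum>i<2^k. cmod (c k i)) t"
  shows "lq_le q (lev \<psi>) (\<kappa>0 * t)"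
proof (rule lq_le_lev_series[OF _ \<psi> lim])
  fix F :: "int set" assume F: "finite F"
  show "(\<Sum>z\<in>F. if 0 \<le> z then 2 * (2 powr (- s)) ^ nat z else 0) \<le> \<kappa>0"
    using mult_left_mono[OF sum_geometric_int_le[OF _ _ F, of "2 powr (- s)"], of 2] two_powr_s
    by (simp add: sum_distrib_left \<kappa>0_def if_distrib cong: if_cong)
qed (use lev_atom integrable_atom c in auto)

lemma cint_split: assumes "integrable M f" "i < 2 ^ k"
  shows "cint k i f = cint (Suc k) (2 * i) f + cint (Suc k) (2 * i + 1) f"
proof -
  have "indicator (cell k i) x = (indicator (cell (Suc k) (2 * i)) x + indicator (cell (Suc k) (2 * i + 1)) x :: real)" for x
    using cell_split[of k i] cell_unique[of x "Suc k" "2 * i" "2 * i + 1"] by (auto simp: indicator_def)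
  then have "cint k i f = (LINT x|M. indicator (cell (Suc k) (2 * i)) x *\<^sub>R f x + indicator (cell (Suc k) (2 * i + 1)) x *\<^sub>R f x)"
    unfolding cint_def by (simp add: scaleR_left_distrib)
  also have "\<dots> = cint (Suc k) (2 * i) f + cint (Suc k) (2 * i + 1) f"
    unfolding cint_def using assms by (intro Bochner_Integration.integral_add integrable_cell) auto
  finally show ?thesis .
qed

definition mpart :: "nat \<Rightarrow> cfun \<Rightarrow> cfun" where
  "mpart n \<psi> x = (\<Sum>k<n. \<Sum>i<2^k. mcoef k i \<psi> * atom s (cell k i) x)"

lemma block_eval:
  assumes "i < 2 ^ k" "x \<in> cell k i"
  shows "(\<Sum>j<2^k. c j * atom s (cell k j) x) = c i * complex_of_real (len k powr (s - 1))"
proof -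
  have "(\<Sum>j<2^k. c j * atom s (cell k j) x) = (\<Sum>j<2^k. if j = i then c i * complex_of_real (len k powr (s - 1)) else 0)"
  proof (intro sum.cong refl)
    fix j
    show "c j * atom s (cell k j) x = (if j = i then c i * complex_of_real (len k powr (s - 1)) else 0)"
      using cell_unique[of x k j i] assms(2) by (cases "x \<in> cell k j") (auto simp: atom_cell)
  qed
  then show ?thesis using assms(1) by simp
qed

lemma mcoef_atom: "mcoef k i \<psi> * complex_of_real (len k powr (s - 1)) = incr k i \<psi>"
  by (simp add: mcoef_def mult.assoc powr_add[symmetric] flip: of_real_mult)

text \<open>The increments telescope along the ancestors of a cell, starting from the average itself
  at level 0. As \<open>mpart n\<close> uses the levels below n, it is \<open>mpart (Suc n)\<close>
  that is the conditional expectation at level n.\<close>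

lemma mpart_Suc_eval: "i < 2 ^ n \<Longrightarrow> x \<in> cell n i \<Longrightarrow> mpart (Suc n) \<psi> x = avg n i \<psi>"
proof (induction n arbitrary: i)
  case 0
  then show ?case using block_eval[of i 0 x "\<lambda>j. mcoef 0 j \<psi>"]
    by (simp add: mpart_def mcoef_atom incr_def)
next
  case (Suc n)
  have p: "i div 2 < 2 ^ n" using Suc.prems by auto
  have "mpart (Suc (Suc n)) \<psi> x = mpart (Suc n) \<psi> x + (\<Sum>j<2^Suc n. mcoef (Suc n) j \<psi> * atom s (cell (Suc n) j) x)"
    by (simp add: mpart_def)
  also have "\<dots> = avg n (i div 2) \<psi> + mcoef (Suc n) i \<psi> * complex_of_real (len (Suc n) powr (s - 1))"
    using Suc.IH[OF p cell_parent[OF Suc.prems(2)]] block_eval[OF Suc.prems, of "\<lambda>j. mcoef (Suc n) j \<psi>"] by simp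
  also have "mcoef (Suc n) i \<psi> * complex_of_real (len (Suc n) powr (s - 1)) = incr (Suc n) i \<psi>"
    by (rule mcoef_atom)
  finally show ?case by (simp add: incr_def)
qed

lemma integrable_block: "integrable M (\<lambda>x. \<Sum>i<2^k. c i * atom s (cell k i) x)"
  by (intro Bochner_Integration.integrable_sum integrable_mult_right integrable_atom) auto

lemma integrable_mpart: "integrable M (mpart n \<psi>)"
  unfolding mpart_def[abs_def] by (intro Bochner_Integration.integrable_sum integrable_block)

text \<open>The martingale property: a conditional expectation at a finer level keeps the integrals
  over coarser cells. The induction descends to the two children of the cell.\<close>

lemma cint_mpart:
  assumes "integrable M \<psi>"
  shows "i < 2 ^ m \<Longrightarrow> cint m i (mpart (Suc (m + d)) \<psi>) = cint m i \<psi>"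
proof (induction d arbitrary: m i)
  case 0
  have "cint m i (mpart (Suc m) \<psi>) = len m *\<^sub>R avg m i (mpart (Suc m) \<psi>)"
    by (simp add: avg_def scaleR_conv_of_real)
  also have "avg m i (mpart (Suc m) \<psi>) = avg m i \<psi>"
    using 0 mpart_Suc_eval by (intro avg_const) auto
  finally show ?case by (simp add: avg_def scaleR_conv_of_real)
next
  case (Suc d)
  have "2 * i < 2 ^ Suc m" "2 * i + 1 < 2 ^ Suc m" using Suc.prems by auto
  then show ?case
    using Suc.IH[of "2 * i" "Suc m"] Suc.IH[of "2 * i + 1" "Suc m"]
      cint_split[OF integrable_mpart Suc.prems, of "Suc (m + Suc d)" \<psi>] cint_split[OF assms Suc.prems] by simp
qed

lemma indicator_lessThan_cells:
  assumes "a \<le> y"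
  shows "(indicator {..<a + real n * len k} y :: real) = (\<Sum>i<n. indicator (cell k i) y)"
proof (induction n)
  case 0
  then show ?case using assms by simp
next
  case (Suc n)
  have "(\<Sum>i<Suc n. indicator (cell k i) y :: real) = indicator {..<a + real n * len k} y + indicator (cell k n) y"
    using Suc by simp
  also have "\<dots> = indicator {..<a + real (Suc n) * len k} y"
    using len_pos[of k] by (auto simp: indicator_def cell_alt algebra_simps simp del: len_pos)
  finally show ?case by simp
qed

text \<open>Vanishing integrals extend from cells to half-lines with dyadic end points, by dominated
  convergence to all half-lines, by Dynkin's theorem to Borel sets, and up to null sets to Lebesgue
  sets.\<close>

lemma cint_zero_AE:
  assumes \<delta>: "integrable M \<delta>" and z: "\<And>k i. i < 2 ^ k \<Longrightarrow> cint k i \<delta> = 0"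
  shows "AE x in M. \<delta> x = 0"
proof -
  define J where "J A = (LINT y|M. indicator A y *\<^sub>R \<delta> y)" for A :: "real set"
  have bm: "A \<inter> {a..b} \<in> sets M" if "A \<in> sets borel" for A
    using that by (auto simp: sets_restrict_space_iff)
  have J_Int: "J A = J (A \<inter> {a..b})" for A
    unfolding J_def by (intro Bochner_Integration.integral_cong) (auto simp: indicator_def)
  have int: "integrable M (\<lambda>y. indicator A y *\<^sub>R \<delta> y)" if "A \<in> sets borel" for A
  proof -
    have "integrable M (\<lambda>y. indicator (A \<inter> {a..b}) y *\<^sub>R \<delta> y)"
      using integrable_mult_indicator[OF bm[OF that] \<delta>] .
    then show ?thesis
      by (subst Bochner_Integration.integrable_cong[of M M _ "\<lambda>y. indicator (A \<inter> {a..b}) y *\<^sub>R \<delta> y"])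
        (auto simp: indicator_def)
  qed
  have meas: "(\<lambda>y. indicator A y *\<^sub>R \<delta> y) \<in> borel_measurable M" if "A \<in> sets borel" for A
    using int[OF that] by (rule borel_measurable_integrable)
  have bound: "AE y in M. norm (indicator A y *\<^sub>R \<delta> y) \<le> norm (\<delta> y)" for A :: "real set"
    by (rule AE_I2) (simp add: indicator_def)
  have cells: "J {..<a + real n * len k} = 0" if "n \<le> 2 ^ k" for n k
  proof -
    have "J {..<a + real n * len k} = (LINT y|M. (\<Sum>i<n. indicator (cell k i) y *\<^sub>R \<delta> y))"
      unfolding J_def
      by (intro Bochner_Integration.integral_cong) (auto simp: indicator_lessThan_cells scaleR_sum_left)
    also have "\<dots> = (\<Sum>i<n. cint k i \<delta>)"
      unfolding cint_def using that \<delta> by (intro Bochner_Integration.integral_sum integrable_cell) auto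
    also have "\<dots> = 0" using that z by (intro sum.neutral) auto
    finally show ?thesis .
  qed
  have Jb: "J {..<b} = 0" using cells[of 1 0] by (simp add: len_def)
  \<comment> \<open>Cells are half-open, so the right end point of the interval lies in none of
    them.\<close>
  have null_b: "AE y in M. y \<noteq> b"
  proof -
    have "AE y in lebesgue. y \<noteq> b"
      by (rule AE_I[of _ _ "{b}"]) auto
    then show ?thesis by (auto simp: AE_restrict_space_iff)
  qed
  have Jx: "J {..<x} = 0" for x
  proof -
    consider "x \<le> a" | "a < x" "x < b" | "b \<le> x" by linarith
    then show ?thesis
    proof cases
      case 1
      then have "J {..<x} = (LINT y|M. 0)"
        unfolding J_def by (intro Bochner_Integration.integral_cong) auto
      then show ?thesis by simp
    next
      case 3
      have "J {..<x} = J {..<b}"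
        unfolding J_def
      proof (rule integral_cong_AE)
        show "AE y in M. indicator {..<x} y *\<^sub>R \<delta> y = indicator {..<b} y *\<^sub>R \<delta> y"
          using null_b AE_space by eventually_elim (use 3 in \<open>auto simp: indicator_def\<close>)
      qed (auto intro: meas)
      then show ?thesis using Jb by simp
    next
      case 2
      then have "\<forall>k. \<exists>i<2^k. x \<in> cell k i" using cell_exists[of x] by auto
      then obtain i where i: "\<And>k. i k < 2 ^ k" "\<And>k. x \<in> cell k (i k)" by metis
      \<comment> \<open>Left end points of the cells containing \<open>x\<close>: they tend to
        \<open>x\<close> from the left, so the half-lines below them converge pointwise to the open
        half-line below \<open>x\<close>.\<close>
      define d where "d k = a + real (i k) * len k" for k
      have d: "d k \<le> x" "x < d k + len k" for k
        using i(2)[of k] by (auto simp: d_def cell_alt algebra_simps)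
      have "(\<lambda>k. J {..<d k}) \<longlonglongrightarrow> J {..<x}"
        unfolding J_def
      proof (rule integral_dominated_convergence[where w="\<lambda>y. norm (\<delta> y)"])
        show "AE y in M. (\<lambda>k. indicator {..<d k} y *\<^sub>R \<delta> y) \<longlonglongrightarrow> indicator {..<x} y *\<^sub>R \<delta> y"
        proof (rule AE_I2, rule tendsto_eventually)
          fix y
          show "\<forall>\<^sub>F k in sequentially. indicator {..<d k} y *\<^sub>R \<delta> y = indicator {..<x} y *\<^sub>R \<delta> y"
          proof (cases "y < x")
            case True
            then have "\<forall>\<^sub>F k in sequentially. len k < x - y"
              using order_tendstoD(2)[OF len_tendsto] by simp
            then show ?thesis
            proof eventually_elim
              case (elim k)
              then have "y < d k" using d(2)[of k] by simp
              then show ?case using True by simp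
            qed
          next
            case False
            then have "\<not> y < d k" for k using d(1)[of k] by simp
            then show ?thesis using False by simp
          qed
        qed
      qed (use \<delta> in \<open>auto intro: meas bound simp del: norm_scaleR\<close>)
      moreover have "J {..<d k} = 0" for k
        unfolding d_def using i(1)[of k] by (intro cells) simp
      ultimately have "(\<lambda>_::nat. 0) \<longlonglongrightarrow> J {..<x}" by (simp only:)
      then show ?thesis by (simp add: LIMSEQ_const_iff)
    qed
  qed
  have borel: "J A = 0" if "A \<in> sets borel" for A
  proof -
    have eq: "sets borel = sigma_sets UNIV (range (lessThan :: real \<Rightarrow> real set))"
      by (subst borel_Iio) simp
    have Ju: "J UNIV = 0"
    proof -
      have "J UNIV = J {..<b + 1}"
        unfolding J_def by (intro Bochner_Integration.integral_cong) (auto simp: indicator_def)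
      then show ?thesis using Jx by simp
    qed
    have st: "Int_stable (range (lessThan :: real \<Rightarrow> real set))"
    proof (rule Int_stableI)
      fix A B :: "real set" assume "A \<in> range lessThan" "B \<in> range lessThan"
      then obtain x y where "A = {..<x}" "B = {..<y}" by auto
      then have "A \<inter> B = {..<min x y}" by auto
      then show "A \<inter> B \<in> range lessThan" by blast
    qed
    have A: "A \<in> sigma_sets UNIV (range (lessThan :: real \<Rightarrow> real set))" using that eq by simp
    have "range (lessThan :: real \<Rightarrow> real set) \<subseteq> Pow UNIV" by simp
    with st show ?thesis using A
    proof (induction rule: sigma_sets_induct_disjoint)
      case (basic A)
      then show ?case using Jx by auto
    next
      case empty
      then show ?case by (simp add: J_def)
    next
      case (compl A)
      then have "A \<in> sets borel" by (simp only: eq)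
      then have "J UNIV - J A = (LINT y|M. indicator UNIV y *\<^sub>R \<delta> y - indicator A y *\<^sub>R \<delta> y)"
        unfolding J_def by (intro Bochner_Integration.integral_diff[symmetric] int) auto
      also have "\<dots> = J (UNIV - A)"
        unfolding J_def by (intro Bochner_Integration.integral_cong) (auto simp: indicator_def)
      finally have "J (UNIV - A) = J UNIV - J A" ..
      then show ?case using compl Ju by simp
    next
      case (union A)
      then have A: "A i \<in> sets borel" for i unfolding eq by auto
      have "(\<lambda>n. J (\<Union>i<n. A i)) \<longlonglongrightarrow> J (\<Union>i. A i)"
        unfolding J_def
      proof (rule integral_dominated_convergence[where w="\<lambda>y. norm (\<delta> y)"])
        show "AE y in M. (\<lambda>n. indicator (\<Union>i<n. A i) y *\<^sub>R \<delta> y) \<longlonglongrightarrow> indicator (\<Union>i. A i) y *\<^sub>R \<delta> y"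
          by (intro always_eventually allI tendsto_scaleR tendsto_const LIMSEQ_indicator_UN)
        show "(\<lambda>y. indicator (\<Union>i<n. A i) y *\<^sub>R \<delta> y) \<in> borel_measurable M"
          for n by (intro meas sets.finite_UN) (auto intro: A)
        show "(\<lambda>y. indicator (\<Union>i. A i) y *\<^sub>R \<delta> y) \<in> borel_measurable M"
          by (intro meas sets.countable_UN) (auto intro: A)
      qed (use \<delta> in \<open>auto intro: bound simp del: norm_scaleR\<close>)
      moreover have "J (\<Union>i<n. A i) = 0" for n
      proof (induction n)
        case (Suc n)
        have "A n \<inter> (\<Union>i<n. A i) = {}"
        proof -
          have "A n \<inter> A i = {}" if "i < n" for i
            using disjoint_family_onD[OF union(1), of n i] that by simp
          then show ?thesis by blast
        qed
        then have "indicator (\<Union>i<Suc n. A i) y = (indicator (A n) y + indicator (\<Union>i<n. A i) y :: real)" for y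
          by (auto simp: indicator_def lessThan_Suc)
        then have "J (\<Union>i<Suc n. A i) = (LINT y|M. indicator (A n) y *\<^sub>R \<delta> y + indicator (\<Union>i<n. A i) y *\<^sub>R \<delta> y)"
          unfolding J_def by (simp add: scaleR_left_distrib)
        also have "\<dots> = J (A n) + J (\<Union>i<n. A i)"
          unfolding J_def using A by (intro Bochner_Integration.integral_add int sets.finite_UN) auto
        finally show ?case using Suc union by simp
      qed (simp add: J_def)
      ultimately have "(\<lambda>_::nat. 0) \<longlonglongrightarrow> J (\<Union>i. A i)" by (simp only:)
      then show ?case by (simp add: LIMSEQ_const_iff)
    qed
  qed
  interpret finite_measure M by (rule finite_measure_lebesgue_on) simp
  show ?thesis
  proof (rule density_zero[OF \<delta>])
    fix A assume "A \<in> sets M"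
    then have "A \<in> sets lebesgue" by (auto simp: sets_restrict_space_iff)
    then obtain S N N' where S: "A = S \<union> N" "N \<subseteq> N'" "N' \<in> null_sets lborel" "S \<in> sets lborel"
      by (auto elim: sets_completionE)
    have "N' \<in> null_sets lebesgue" using S(3) by (rule null_sets_completionI)
    then have "AE y in lebesgue. y \<notin> N'" by (rule AE_not_in)
    then have ae: "AE y in M. y \<notin> N'" by (auto simp: AE_restrict_space_iff)
    have "set_lebesgue_integral M A \<delta> = J S"
      unfolding set_lebesgue_integral_def J_def
    proof (rule integral_cong_AE)
      show "(\<lambda>y. indicator A y *\<^sub>R \<delta> y) \<in> borel_measurable M"
        using integrable_mult_indicator[OF \<open>A \<in> sets M\<close> \<delta>] by auto
      show "(\<lambda>y. indicator S y *\<^sub>R \<delta> y) \<in> borel_measurable M" using int S by auto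
      show "AE y in M. indicator A y *\<^sub>R \<delta> y = indicator S y *\<^sub>R \<delta> y"
        using ae by eventually_elim (use S in \<open>auto simp: indicator_def\<close>)
    qed
    then show "set_lebesgue_integral M A \<delta> = 0" using borel S by simp
  qed
qed

end

section \<open>The Besov space as a complete space\<close>

context besov_scale
begin

lemma l1_block_le: "l1 (\<lambda>x. \<Sum>i<2^k. c i * atom s (cell k i) x) \<le> (\<Sum>i<2^k. cmod (c i)) * len k powr s"
proof -
  have "l1 (\<lambda>x. \<Sum>i<2^k. c i * atom s (cell k i) x) \<le> (\<Sum>i<2^k. l1 (\<lambda>x. c i * atom s (cell k i) x))"
    by (intro l1_sum integrable_mult_right integrable_atom) auto
  also have "\<dots> = (\<Sum>i<2^k. cmod (c i) * len k powr s)"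
    by (intro sum.cong) (auto simp: l1_scale l1_atom)
  finally show ?thesis by (simp add: sum_distrib_right)
qed

lemma len_powr: "len k powr s = (b - a) powr s * (2 powr (- s)) ^ k"
  using ab by (simp add: len_def powr_divide powr_minus powr_powr powr_realpow[symmetric] field_simps powr_power)

text \<open>The sum of \<open>len k powr s\<close> over all levels, that is of the L1 norms of one
  atom per level.\<close>

definition C1 :: real where "C1 = (b - a) powr s / (1 - 2 powr (- s))"

lemma sum_len_powr_le: "(\<Sum>k<n. len k powr s) \<le> C1"
proof -
  have "(\<Sum>k<n. (2 powr (- s)) ^ k) \<le> (\<Sum>k. (2 powr (- s)) ^ k)"
    using two_powr_s by (intro sum_le_suminf summable_geometric) auto
  also have "\<dots> = 1 / (1 - 2 powr (- s))" using two_powr_s by (intro suminf_geometric) auto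
  finally have "(b - a) powr s * (\<Sum>k<n. (2 powr (- s)) ^ k) \<le> (b - a) powr s * (1 / (1 - 2 powr (- s)))"
    by (intro mult_left_mono) auto
  then show ?thesis by (simp add: len_powr C1_def sum_distrib_left)
qed

lemma l1_rep_le:
  assumes \<psi>: "integrable M \<psi>"
    and lim: "(\<lambda>n. l1 (\<lambda>x. \<psi> x - (\<Sum>k<n. \<Sum>i<2^k. c k i * atom s (cell k i) x))) \<longlonglongrightarrow> 0"
    and c: "lq_le q (\<lambda>k. \<Sum>i<2^k. cmod (c k i)) t"
  shows "l1 \<psi> \<le> C1 * t"
proof -
  let ?f = "\<lambda>n x. \<Sum>k<n. \<Sum>i<2^k. c k i * atom s (cell k i) x"
  have int: "integrable M (?f n)" for n
    by (intro Bochner_Integration.integrable_sum integrable_block)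
  have 1: "l1 (?f n) \<le> C1 * t" for n
  proof -
    have "l1 (?f n) \<le> (\<Sum>k<n. l1 (\<lambda>x. \<Sum>i<2^k. c k i * atom s (cell k i) x))"
      by (intro l1_sum integrable_block) auto
    also have "\<dots> \<le> (\<Sum>k<n. t * len k powr s)"
      using lq_le_component[OF q c]
      by (intro sum_mono order_trans[OF l1_block_le] mult_right_mono) auto
    also have "\<dots> \<le> t * C1"
      using sum_len_powr_le[of n] lq_leD(1)[OF c] by (simp add: sum_distrib_left[symmetric] mult_left_mono)
    finally show ?thesis by (simp add: mult.commute)
  qed
  have 2: "l1 \<psi> \<le> l1 (\<lambda>x. \<psi> x - ?f n x) + l1 (?f n)" for n
    using l1_triangle[OF Bochner_Integration.integrable_diff[OF \<psi> int[of n]] int[of n]] by simp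
  have "l1 \<psi> \<le> C1 * t + l1 (\<lambda>x. \<psi> x - ?f n x)" for n
    using 1[of n] 2[of n] by linarith
  moreover have "(\<lambda>n. C1 * t + l1 (\<lambda>x. \<psi> x - ?f n x)) \<longlonglongrightarrow> C1 * t + 0"
    by (intro tendsto_add tendsto_const lim)
  ultimately show ?thesis using LIMSEQ_le_const[of _ "C1 * t" "l1 \<psi>"] by auto
qed

text \<open>The bound on \<open>lev\<close> makes the series of blocks converge absolutely in L1, at
  first to some \<open>F\<close>. Its integrals over cells are those of \<open>\<psi>\<close>,
  because those of \<open>mpart n\<close> are eventually constant; hence \<open>F\<close> equals
  \<open>\<psi>\<close> almost everywhere.\<close>

lemma mpart_tendsto:
  assumes \<psi>: "integrable M \<psi>" and lq: "lq_le q (lev \<psi>) t"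
  shows "(\<lambda>n. l1 (\<lambda>x. \<psi> x - mpart n \<psi> x)) \<longlonglongrightarrow> 0"
proof -
  let ?f = "\<lambda>k x. \<Sum>i<2^k. mcoef k i \<psi> * atom s (cell k i) x"
  have "summable (\<lambda>k. l1 (?f k))"
  proof (rule summable_comparison_test'[where N=0])
    show "summable (\<lambda>k. t * ((b - a) powr s * (2 powr (- s)) ^ k))"
      using two_powr_s by (intro summable_mult summable_geometric) auto
    fix k
    have "l1 (?f k) \<le> lev \<psi> k * len k powr s"
      using l1_block_le by (simp add: lev_def)
    also have "\<dots> \<le> t * len k powr s" using lq_le_component[OF q lq] by (intro mult_right_mono) auto
    finally show "norm (l1 (?f k)) \<le> t * ((b - a) powr s * (2 powr (- s)) ^ k)" by (simp add: len_powr)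
  qed
  then have "\<exists>F. integrable M F \<and> (\<lambda>n. LINT x|M. norm (F x - (\<Sum>k<n. ?f k x))) \<longlonglongrightarrow> 0"
    unfolding l1_def by (intro integrable_series_complete integrable_block)
  then obtain F where F: "integrable M F" and lim: "(\<lambda>n. l1 (\<lambda>x. F x - mpart n \<psi> x)) \<longlonglongrightarrow> 0"
    unfolding l1_def mpart_def by auto
  have "cint m i (\<lambda>x. \<psi> x - F x) = 0" if i: "i < 2 ^ m" for m i
  proof -
    have diff: "cint m i (\<lambda>x. u x - v x) = cint m i u - cint m i v" if "integrable M u" "integrable M v" for u v
      using cint_linear[OF that(2,1) i, of "-1"] by simp
    have "(\<lambda>n. cint m i F - cint m i (mpart n \<psi>)) \<longlonglongrightarrow> 0"
    proof (rule Lim_null_comparison[OF always_eventually lim], rule allI)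
      fix n
      show "norm (cint m i F - cint m i (mpart n \<psi>)) \<le> l1 (\<lambda>x. F x - mpart n \<psi> x)"
        using cint_le[OF Bochner_Integration.integrable_diff[OF F integrable_mpart] i] diff[OF F integrable_mpart] by simp
    qed
    moreover have "(\<lambda>n. cint m i F - cint m i (mpart n \<psi>)) \<longlonglongrightarrow> cint m i F - cint m i \<psi>"
    proof (rule tendsto_eventually, rule eventually_sequentiallyI)
      fix n assume "Suc m \<le> n"
      then obtain d where "n = Suc (m + d)" by (metis add_Suc le_Suc_ex)
      then show "cint m i F - cint m i (mpart n \<psi>) = cint m i F - cint m i \<psi>"
        using cint_mpart[OF \<psi> i] by simp
    qed
    ultimately have "cint m i F - cint m i \<psi> = 0" using LIMSEQ_unique by blast
    then show ?thesis using diff[OF \<psi> F] by simp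
  qed
  then have "AE x in M. \<psi> x - F x = 0"
    using \<psi> F by (intro cint_zero_AE) auto
  then have "l1 (\<lambda>x. \<psi> x - mpart n \<psi> x) = l1 (\<lambda>x. F x - mpart n \<psi> x)" for n
    unfolding l1_def using \<psi> F integrable_mpart
    by (intro integral_cong_AE) (auto intro!: borel_measurable_integrable)
  then show ?thesis using lim by simp
qed

section \<open>The Besov norm and its comparison with the martingale levels\<close>

lemma besov_rep_iff:
  "besov_rep a b s \<psi> c \<longleftrightarrow> (\<lambda>n. l1 (\<lambda>x. \<psi> x - (\<Sum>k<n. \<Sum>i<2^k. c (cell k i) * atom s (cell k i) x))) \<longlonglongrightarrow> 0"
  unfolding besov_rep_def l1_def dyadic_cell by (simp add: sum.reindex[OF inj_cell])

lemma level_sum_cell: "level_sum a b c = (\<lambda>k. \<Sum>i<2^k. cmod (c (cell k i)))"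
  unfolding level_sum_def dyadic_cell by (simp add: sum.reindex[OF inj_cell])

text \<open>Turns coefficients indexed by level and position into coefficients on cells, the format
  of \<open>besov_rep\<close>; by \<open>cell_inj\<close> a cell determines its indices.\<close>

definition on_cells :: "(nat \<Rightarrow> nat \<Rightarrow> complex) \<Rightarrow> real set \<Rightarrow> complex" where
  "on_cells d Q = (let p = SOME p. Q = cell (fst p) (snd p) in d (fst p) (snd p))"

lemma on_cells [simp]: "on_cells d (cell k i) = d k i"
proof -
  let ?p = "SOME p. cell k i = cell (fst p) (snd p)"
  have "cell k i = cell (fst ?p) (snd ?p)" by (rule someI[of _ "(k, i)"]) simp
  then have "k = fst ?p \<and> i = snd ?p" by (rule cell_inj)
  then show ?thesis by (simp add: on_cells_def Let_def)
qed

abbreviation "V \<equiv> besov a b s q"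
abbreviation "N \<equiv> besov_norm a b s q"

lemma besov_integrable: "\<psi> \<in> V \<Longrightarrow> integrable M \<psi>"
  by (simp add: besov_def)

lemma besov_normI:
  assumes \<psi>: "integrable M \<psi>"
    and lim: "(\<lambda>n. l1 (\<lambda>x. \<psi> x - (\<Sum>k<n. \<Sum>i<2^k. c k i * atom s (cell k i) x))) \<longlonglongrightarrow> 0"
    and c: "lq_le q (\<lambda>k. \<Sum>i<2^k. cmod (c k i)) t"
  shows "\<psi> \<in> V" "N \<psi> \<le> t"
proof -
  have rep: "besov_rep a b s \<psi> (on_cells c)" using lim by (simp add: besov_rep_iff)
  have ls: "lq_le q (level_sum a b (on_cells c)) t" using c by (simp add: level_sum_cell)
  then have fc: "finite_cost a b q (on_cells c)" using finite_cost_iff[OF q] by blast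
  show "\<psi> \<in> V" using \<psi> rep fc by (auto simp: besov_def)
  have "N \<psi> \<le> cost a b q (on_cells c)"
    unfolding besov_norm_def
  proof (rule cInf_lower)
    show "bdd_below {cost a b q c |c. besov_rep a b s \<psi> c \<and> finite_cost a b q c}"
    proof (rule bdd_belowI[of _ 0], safe)
      fix c assume "finite_cost a b q c"
      then have "lq_le q (level_sum a b c) (cost a b q c)" using cost_le_iff[OF q] by blast
      then show "0 \<le> cost a b q c" by (rule lq_leD)
    qed
  qed (use rep fc in blast)
  also have "\<dots> \<le> t" using cost_le_iff[OF q fc] ls by simp
  finally show "N \<psi> \<le> t" .
qed

lemma besov_norm_rep:
  assumes "\<psi> \<in> V" "N \<psi> < t"
  shows "\<exists>c. (\<lambda>n. l1 (\<lambda>x. \<psi> x - (\<Sum>k<n. \<Sum>i<2^k. c k i * atom s (cell k i) x))) \<longlonglongrightarrow> 0 \<and>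
    lq_le q (\<lambda>k. \<Sum>i<2^k. cmod (c k i)) t"
proof -
  let ?X = "{cost a b q c |c. besov_rep a b s \<psi> c \<and> finite_cost a b q c}"
  have "?X \<noteq> {}" using assms(1) by (auto simp: besov_def)
  then obtain y where "y \<in> ?X" "y < t"
    using cInf_lessD[of ?X t] assms(2) unfolding besov_norm_def by blast
  then obtain c where c: "besov_rep a b s \<psi> c" "finite_cost a b q c" "cost a b q c < t" by auto
  then have "lq_le q (level_sum a b c) t" using cost_le_iff[OF q c(2), of t] by simp
  then show ?thesis using c(1) unfolding besov_rep_iff level_sum_cell
    by (intro exI[of _ "\<lambda>k i. c (cell k i)"]) simp
qed

lemma besov_norm_nonneg: assumes "\<psi> \<in> V" shows "0 \<le> N \<psi>"
proof (rule field_le_epsilon)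
  fix e :: real assume "0 < e"
  then obtain c :: "nat \<Rightarrow> nat \<Rightarrow> complex" where "lq_le q (\<lambda>k. \<Sum>i<2^k. cmod (c k i)) (N \<psi> + e)"
    using besov_norm_rep[OF assms, of "N \<psi> + e"] by auto
  then show "0 \<le> N \<psi> + e" by (rule lq_leD)
qed

text \<open>The infimum in the norm need not be attained, so the comparison is made for
  representations of cost below \<open>N \<psi> + 1 / (n + 1)\<close> and passes to the
  limit.\<close>

lemma lev_besov_norm: assumes "\<psi> \<in> V" shows "lq_le q (lev \<psi>) (\<kappa>0 * N \<psi>)"
proof (rule lq_le_lim[OF q])
  show "lq_le q (lev \<psi>) (\<kappa>0 * (N \<psi> + 1 / real (Suc n)))" for n
  proof -
    obtain c where "(\<lambda>n. l1 (\<lambda>x. \<psi> x - (\<Sum>k<n. \<Sum>i<2^k. c k i * atom s (cell k i) x))) \<longlonglongrightarrow> 0"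
      "lq_le q (\<lambda>k. \<Sum>i<2^k. cmod (c k i)) (N \<psi> + 1 / real (Suc n))"
      using besov_norm_rep[OF assms, of "N \<psi> + 1 / real (Suc n)"] by auto
    then show ?thesis using besov_integrable[OF assms] by (intro lq_le_lev_rep)
  qed
  show "(\<lambda>n. \<kappa>0 * (N \<psi> + 1 / real (Suc n))) \<longlonglongrightarrow> \<kappa>0 * N \<psi>"
    using tendsto_mult_left[OF tendsto_add[OF tendsto_const LIMSEQ_Suc[OF lim_1_over_n]], of "\<kappa>0" "N \<psi>"] by simp
qed auto

text \<open>The martingale decomposition is itself an admissible representation, so its cost bounds
  the infimum.\<close>

lemma besov_lev:
  assumes "integrable M \<psi>" "lq_le q (lev \<psi>) t"
  shows "\<psi> \<in> V" "N \<psi> \<le> t"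
  using besov_normI[OF assms(1), of "\<lambda>k i. mcoef k i \<psi>" t] mpart_tendsto[OF assms] assms(2)
  unfolding mpart_def lev_def[abs_def] by auto

lemma l1_besov_norm: assumes "\<psi> \<in> V" shows "l1 \<psi> \<le> C1 * \<kappa>0 * N \<psi>"
  using l1_rep_le[OF besov_integrable[OF assms], of "\<lambda>k i. mcoef k i \<psi>" "\<kappa>0 * N \<psi>"]
    mpart_tendsto[OF besov_integrable[OF assms] lev_besov_norm[OF assms]] lev_besov_norm[OF assms]
  unfolding mpart_def lev_def[abs_def] by (simp add: mult.assoc)

text \<open>Near-optimal representations of both functions are combined. The route through
  \<open>lev\<close> would cost a factor \<open>\<kappa>0\<close>, whereas a seminorm has to satisfy
  the triangle inequality with constant 1.\<close>

lemma besov_linear: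
  assumes "\<psi> \<in> V" "\<phi> \<in> V"
  shows "(\<lambda>x. c * \<psi> x + \<phi> x) \<in> V" "N (\<lambda>x. c * \<psi> x + \<phi> x) \<le> cmod c * N \<psi> + N \<phi>"
proof -
  have int: "integrable M (\<lambda>x. c * \<psi> x + \<phi> x)"
    using besov_integrable assms by auto
  have *: "(\<lambda>x. c * \<psi> x + \<phi> x) \<in> V \<and> N (\<lambda>x. c * \<psi> x + \<phi> x) \<le> cmod c * (N \<psi> + e) + (N \<phi> + e)" if e: "0 < e" for e
  proof -
    obtain u where u: "(\<lambda>n. l1 (\<lambda>x. \<psi> x - (\<Sum>k<n. \<Sum>i<2^k. u k i * atom s (cell k i) x))) \<longlonglongrightarrow> 0"
      "lq_le q (\<lambda>k. \<Sum>i<2^k. cmod (u k i)) (N \<psi> + e)"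
      using besov_norm_rep[OF assms(1), of "N \<psi> + e"] e by auto
    obtain v where v: "(\<lambda>n. l1 (\<lambda>x. \<phi> x - (\<Sum>k<n. \<Sum>i<2^k. v k i * atom s (cell k i) x))) \<longlonglongrightarrow> 0"
      "lq_le q (\<lambda>k. \<Sum>i<2^k. cmod (v k i)) (N \<phi> + e)"
      using besov_norm_rep[OF assms(2), of "N \<phi> + e"] e by auto
    let ?f = "\<lambda>w n x. \<Sum>k<n. \<Sum>i<2^k. w k i * atom s (cell k i) x"
    let ?w = "\<lambda>k i. c * u k i + v k i"
    have fint: "integrable M (?f w n)" for w n
      by (intro Bochner_Integration.integrable_sum integrable_block)
    have lin: "?f ?w n x = c * ?f u n x + ?f v n x" for n x
      by (simp add: sum.distrib sum_distrib_left algebra_simps)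
    have "(\<lambda>n. l1 (\<lambda>x. (c * \<psi> x + \<phi> x) - ?f ?w n x)) \<longlonglongrightarrow> 0"
    proof (rule Lim_null_comparison[OF always_eventually], rule allI)
      fix n
      have "l1 (\<lambda>x. (c * \<psi> x + \<phi> x) - ?f ?w n x) = l1 (\<lambda>x. c * (\<psi> x - ?f u n x) + (\<phi> x - ?f v n x))"
        unfolding lin by (simp add: algebra_simps)
      also have "\<dots> \<le> l1 (\<lambda>x. c * (\<psi> x - ?f u n x)) + l1 (\<lambda>x. \<phi> x - ?f v n x)"
        using fint besov_integrable assms
        by (intro l1_triangle Bochner_Integration.integrable_diff integrable_mult_right) auto
      finally show "norm (l1 (\<lambda>x. (c * \<psi> x + \<phi> x) - ?f ?w n x))
          \<le> cmod c * l1 (\<lambda>x. \<psi> x - ?f u n x) + l1 (\<lambda>x. \<phi> x - ?f v n x)"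
        by (simp add: l1_scale)
      show "(\<lambda>n. cmod c * l1 (\<lambda>x. \<psi> x - ?f u n x) + l1 (\<lambda>x. \<phi> x - ?f v n x)) \<longlonglongrightarrow> 0"
        using tendsto_add[OF tendsto_mult_right_zero[OF u(1)] v(1)] by simp
    qed
    moreover have "lq_le q (\<lambda>k. \<Sum>i<2^k. cmod (?w k i)) (cmod c * (N \<psi> + e) + (N \<phi> + e))"
    proof (rule lq_le_mono[OF q lq_le_add[OF q lq_le_scale[OF q u(2), of "cmod c"] v(2)]])
      fix k
      have "(\<Sum>i<2^k. cmod (?w k i)) \<le> (\<Sum>i<2^k. cmod c * cmod (u k i) + cmod (v k i))"
        by (intro sum_mono) (metis norm_mult norm_triangle_ineq)
      then show "(\<Sum>i<2^k. cmod (?w k i)) \<le> cmod c * (\<Sum>i<2^k. cmod (u k i)) + (\<Sum>i<2^k. cmod (v k i))"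
        by (simp add: sum.distrib sum_distrib_left)
    qed (auto simp: sum_nonneg)
    ultimately show ?thesis using besov_normI[OF int, of ?w] by blast
  qed
  show "(\<lambda>x. c * \<psi> x + \<phi> x) \<in> V" using *[of 1] by simp
  show "N (\<lambda>x. c * \<psi> x + \<phi> x) \<le> cmod c * N \<psi> + N \<phi>"
  proof (rule field_le_epsilon)
    fix e :: real assume e: "0 < e"
    \<comment> \<open>The slack is chosen so that the total error \<open>cmod c * d + d\<close> is
      exactly \<open>e\<close>.\<close>
    define d where "d = e / (cmod c + 1)"
    have "cmod c + 1 \<noteq> 0" using norm_ge_zero[of c] by linarith
    then have d: "cmod c * d + d = e" unfolding d_def by (metis distrib_right mult_1 nonzero_mult_div_cancel_left times_divide_eq_right)
    have "0 < d" using e unfolding d_def by (simp add: add_nonneg_pos)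
    from *[OF this] have "N (\<lambda>x. c * \<psi> x + \<phi> x) \<le> cmod c * (N \<psi> + d) + (N \<phi> + d)" by simp
    then show "N (\<lambda>x. c * \<psi> x + \<phi> x) \<le> cmod c * N \<psi> + N \<phi> + e"
      unfolding d[symmetric] by (simp add: algebra_simps)
  qed
qed

lemma besov_zero: "(\<lambda>x. 0) \<in> V" "N (\<lambda>x. 0) = 0"
proof -
  have "lq_le q (lev (\<lambda>x. 0)) 0" using lq_le_zero[OF q, of 0] by (simp add: lev_zero[abs_def])
  then show z: "(\<lambda>x. 0) \<in> V" and "N (\<lambda>x. 0) = 0"
    using besov_lev[of "\<lambda>x. 0" 0] besov_norm_nonneg[of "\<lambda>x. 0"] by auto
qed

text \<open>The sum is found in L1, where the series converges absolutely by
  \<open>l1_besov_norm\<close>. Each remainder is an L1 limit of finite sums, whose levels are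
  bounded by the tail \<open>tl n\<close> of the norms; that bound survives the limit and
  \<open>besov_lev\<close> turns it into a bound in \<open>N\<close>.\<close>

lemma besov_complete:
  assumes f: "\<And>n. f n \<in> V" and sm: "summable (\<lambda>n. N (f n))"
  shows "\<exists>F\<in>V. (\<lambda>n. N (\<lambda>x. F x - (\<Sum>i<n. f i x))) \<longlonglongrightarrow> 0"
proof -
  have int: "integrable M (f n)" for n using f besov_integrable by blast
  have nn: "0 \<le> N (f n)" for n using f besov_norm_nonneg by blast
  have "summable (\<lambda>n. l1 (f n))"
    by (rule summable_comparison_test'[OF summable_mult[OF sm, of "C1 * \<kappa>0"], of 0])
      (use l1_besov_norm[OF f] in simp)
  then have "\<exists>F. integrable M F \<and> (\<lambda>n. LINT x|M. norm (F x - (\<Sum>i<n. f i x))) \<longlonglongrightarrow> 0"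
    unfolding l1_def by (intro integrable_series_complete int)
  then obtain F where F: "integrable M F" and lim: "(\<lambda>n. l1 (\<lambda>x. F x - (\<Sum>i<n. f i x))) \<longlonglongrightarrow> 0"
    unfolding l1_def by auto
  define tl where "tl n = (\<Sum>i. N (f i)) - (\<Sum>i<n. N (f i))" for n
  have tail: "lq_le q (lev (\<lambda>x. F x - (\<Sum>i<n. f i x))) (\<kappa>0 * tl n)" for n
  proof (rule lq_le_lim[OF q])
    let ?g = "\<lambda>m x. \<Sum>i\<in>{n..<n+m}. f i x"
    have split: "(\<Sum>i<n+m. f i x) = (\<Sum>i<n. f i x) + ?g m x" for m x
      by (simp add: lessThan_atLeast0 sum.atLeastLessThan_concat)
    show "(\<lambda>m. lev (?g m) k) \<longlonglongrightarrow> lev (\<lambda>x. F x - (\<Sum>i<n. f i x)) k" for k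
    proof (rule lev_tendsto)
      show "integrable M (?g m)" for m using int by auto
      show "integrable M (\<lambda>x. F x - (\<Sum>i<n. f i x))" using int F by auto
      have "(\<lambda>m. l1 (\<lambda>x. F x - (\<Sum>i<m+n. f i x))) \<longlonglongrightarrow> 0"
        using LIMSEQ_ignore_initial_segment[OF lim, of n] .
      then show "(\<lambda>m. l1 (\<lambda>x. F x - (\<Sum>i<n. f i x) - ?g m x)) \<longlonglongrightarrow> 0"
        by (simp add: split add.commute[of _ n] diff_diff_eq)
    qed
    show "lq_le q (lev (?g m)) (\<kappa>0 * tl n)" for m
    proof (rule lq_le_mono[OF q lq_le_sum[OF q, of "{n..<n+m}"]])
      show "lq_le q (lev (f i)) (\<kappa>0 * N (f i))" for i using lev_besov_norm[OF f] .
      show "lev (?g m) k \<le> (\<Sum>i\<in>{n..<n+m}. lev (f i) k)" for k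
        using lev_sum[of "{n..<n+m}" f "\<lambda>_. 1" k] int by simp
      have "(\<Sum>i<n. N (f i)) + (\<Sum>i\<in>{n..<n+m}. N (f i)) = (\<Sum>i<n+m. N (f i))"
        by (simp add: lessThan_atLeast0 sum.atLeastLessThan_concat)
      also have "\<dots> \<le> (\<Sum>i. N (f i))" using nn by (intro sum_le_suminf[OF sm]) auto
      finally have "(\<Sum>i\<in>{n..<n+m}. N (f i)) \<le> tl n" by (simp add: tl_def)
      then show "(\<Sum>i\<in>{n..<n+m}. \<kappa>0 * N (f i)) \<le> \<kappa>0 * tl n"
        using \<kappa>0_pos by (simp add: sum_distrib_left[symmetric] mult_left_mono)
    qed auto
  qed auto
  have tlV: "(\<lambda>x. F x - (\<Sum>i<n. f i x)) \<in> V" "N (\<lambda>x. F x - (\<Sum>i<n. f i x)) \<le> \<kappa>0 * tl n" for n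
    using besov_lev[OF _ tail[of n]] F int by auto
  have "tl \<longlonglongrightarrow> (\<Sum>i. N (f i)) - (\<Sum>i. N (f i))"
    unfolding tl_def by (intro tendsto_diff tendsto_const summable_LIMSEQ sm)
  then have "(\<lambda>n. \<kappa>0 * tl n) \<longlonglongrightarrow> 0" by (intro tendsto_mult_right_zero) simp
  then have "(\<lambda>n. N (\<lambda>x. F x - (\<Sum>i<n. f i x))) \<longlonglongrightarrow> 0"
    by (rule Lim_null_comparison[OF always_eventually, rotated])
      (use tlV besov_norm_nonneg[OF tlV(1)] in simp)
  then show ?thesis using tlV(1)[of 0] by (intro bexI[of _ F]) auto
qed

definition cscale :: "complex \<Rightarrow> cfun \<Rightarrow> cfun" where "cscale c \<psi> = (\<lambda>x. c * \<psi> x)"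

sublocale besov: complete_seminorm cscale V N
proof (unfold_locales)
  show "cscale c (x + y) = cscale c x + cscale c y" "cscale (c + d) x = cscale c x + cscale d x"
    "cscale c (cscale d x) = cscale (c * d) x" "cscale 1 x = x" for c d x y
    by (auto simp: cscale_def fun_eq_iff algebra_simps)
  then interpret vector_space cscale by unfold_locales
  note lin = besov_linear
  show "subspace V"
    unfolding subspace_def
    using besov_zero(1) lin(1)[of _ _ 1] lin(1)[OF _ besov_zero(1)]
    by (auto simp: cscale_def zero_fun_def plus_fun_def)
  show "0 \<le> N x" if "x \<in> V" for x using besov_norm_nonneg[OF that] .
  show "N (x + y) \<le> N x + N y" if "x \<in> V" "y \<in> V" for x y
    using lin(2)[OF that, of 1] by (simp add: plus_fun_def)
  show "N (cscale c x) \<le> cmod c * N x" if "x \<in> V" for c x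
    using lin(2)[OF that besov_zero(1), of c] besov_zero(2) by (simp add: cscale_def)
  show "\<exists>x\<in>V. (\<lambda>n. N (x - (\<Sum>i<n. f i))) \<longlonglongrightarrow> 0" if "\<And>n. f n \<in> V" "summable (\<lambda>n. N (f n))" for f
  proof -
    have "x - (\<Sum>i<n. f i) = (\<lambda>y. x y - (\<Sum>i<n. f i y))" for x n
      by (induction n) (auto simp: fun_eq_iff)
    then show ?thesis using besov_complete[OF that] by simp
  qed
qed

end

section \<open>Inverse branches of bounded relative distortion\<close>

lemma injective_between:
  fixes g :: "real \<Rightarrow> real"
  assumes "continuous_on {c..d} g" "inj_on g {c..d}" "c < x" "x < d"
  shows "min (g c) (g d) < g x" "g x < max (g c) (g d)"
  using continuous_inj_imp_mono[OF assms(3,4,1,2)] by auto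

lemma injective_image_interval:
  fixes g :: "real \<Rightarrow> real"
  assumes g: "continuous_on {c..d} g" "inj_on g {c..d}" and "c < d"
  shows "g ` {c<..<d} = {min (g c) (g d)<..<max (g c) (g d)}"
    and "g ` {c..d} = {min (g c) (g d)..max (g c) (g d)}"
    and "min (g c) (g d) < max (g c) (g d)"
proof -
  have ends: "c \<in> {c..d}" "d \<in> {c..d}" using assms by auto
  have ne: "g c \<noteq> g d" using inj_onD[OF g(2) _ ends] assms(3) by auto
  then show "min (g c) (g d) < max (g c) (g d)" by (auto simp: min_def max_def)
  have sub: "g ` {c<..<d} \<subseteq> {min (g c) (g d)<..<max (g c) (g d)}"
    using injective_between[OF g] by auto
  have conn: "y \<in> g ` {c..d}" if "min (g c) (g d) \<le> y" "y \<le> max (g c) (g d)" for y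
  proof (cases "g c \<le> g d")
    case True
    then show ?thesis using IVT'[of g c y d] that g assms(3) by fastforce
  next
    case False
    then show ?thesis using IVT2'[of g d y c] that g assms(3) by fastforce
  qed
  have "y \<in> g ` {c<..<d}" if y: "min (g c) (g d) < y" "y < max (g c) (g d)" for y
  proof -
    have "y \<in> g ` {c..d}" using conn[of y] y by auto
    then obtain x where x: "x \<in> {c..d}" "y = g x" by blast
    moreover have "x \<noteq> c" "x \<noteq> d" using x y ne by (auto simp: min_def max_def split: if_splits)
    ultimately show ?thesis by auto
  qed
  with sub show "g ` {c<..<d} = {min (g c) (g d)<..<max (g c) (g d)}" by auto
  have "g ` {c..d} \<subseteq> {min (g c) (g d)..max (g c) (g d)}"
  proof
    fix y assume "y \<in> g ` {c..d}"
    then obtain x where "y = g x" "x = c \<or> x = d \<or> x \<in> {c<..<d}" by force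
    then show "y \<in> {min (g c) (g d)..max (g c) (g d)}" using sub by (auto simp: subset_iff intro: less_imp_le)
  qed
  then show "g ` {c..d} = {min (g c) (g d)..max (g c) (g d)}" using conn by auto
qed

text \<open>Distortion is measured against the mean \<open>\<bar>h v - h u\<bar> / (v - u)\<close> of \<open>\<bar>h'\<bar>\<close> on each subinterval.
  This allows \<open>h'\<close> to vanish at the boundary, and is stable under composition because means multiply.\<close>

definition branch :: "real \<Rightarrow> real \<Rightarrow> real set \<Rightarrow> (real \<Rightarrow> real) \<Rightarrow> bool" where
  "branch \<beta> C K h \<longleftrightarrow> open K \<and> is_interval K \<and> inj_on h K \<and> 0 \<le> C \<and>
     (\<forall>x\<in>K. (h has_real_derivative deriv h x) (at x)) \<and>
     (\<forall>u\<in>K. \<forall>v\<in>K. u < v \<longrightarrow> (\<forall>x\<in>{u..v}. \<forall>y\<in>{u..v}.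
        \<bar>\<bar>deriv h x\<bar> - \<bar>deriv h y\<bar>\<bar> \<le> C * (\<bar>h v - h u\<bar> / (v - u)) * (\<bar>x - y\<bar> / (v - u)) powr \<beta>))"

lemma branchD:
  assumes "branch \<beta> C K h"
  shows "open K" "is_interval K" "inj_on h K" "0 \<le> C"
    and "x \<in> K \<Longrightarrow> (h has_real_derivative deriv h x) (at x)"
    and "u \<in> K \<Longrightarrow> v \<in> K \<Longrightarrow> u < v \<Longrightarrow> x \<in> {u..v} \<Longrightarrow> y \<in> {u..v} \<Longrightarrow>
      \<bar>\<bar>deriv h x\<bar> - \<bar>deriv h y\<bar>\<bar> \<le> C * (\<bar>h v - h u\<bar> / (v - u)) * (\<bar>x - y\<bar> / (v - u)) powr \<beta>"
  using assms by (auto simp: branch_def)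

lemma branch_interval: "branch \<beta> C K h \<Longrightarrow> u \<in> K \<Longrightarrow> v \<in> K \<Longrightarrow> {u..v} \<subseteq> K"
  using branchD(2)[of \<beta> C K h] unfolding is_interval_1 by (meson atLeastAtMost_iff subsetI)

lemma branch_continuous: "branch \<beta> C K h \<Longrightarrow> continuous_on K h"
  using branchD(5) by (meson DERIV_isCont continuous_at_imp_continuous_on)

lemma branch_preimage_interval:
  assumes b: "branch \<beta> C K h" and Q: "is_interval Q"
  shows "is_interval {x \<in> K. h x \<in> Q}"
  unfolding is_interval_1
proof (intro ballI allI impI)
  fix x y z assume x: "x \<in> {x \<in> K. h x \<in> Q}" and y: "y \<in> {x \<in> K. h x \<in> Q}" and z: "x \<le> z \<and> z \<le> y"
  have sub: "{x..y} \<subseteq> K" using branch_interval[OF b] x y by blast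
  then have zK: "z \<in> K" using z by auto
  show "z \<in> {x \<in> K. h x \<in> Q}"
  proof (cases "z = x \<or> z = y")
    case True
    then show ?thesis using x y by auto
  next
    case False
    then have "min (h x) (h y) < h z" "h z < max (h x) (h y)"
      using injective_between[of x y h z] z sub branch_continuous[OF b] branchD(3)[OF b]
      by (auto intro: continuous_on_subset inj_on_subset)
    moreover have "min (h x) (h y) \<in> Q" "max (h x) (h y) \<in> Q" using x y by (auto simp: min_def max_def)
    ultimately have "h z \<in> Q" using Q unfolding is_interval_1 by (meson less_imp_le)
    then show ?thesis using zK by simp
  qed
qed

lemma branch_mvt:
  assumes b: "branch \<beta> C K h" and uv: "u \<in> K" "v \<in> K" "u < v"
  shows "\<exists>z\<in>{u<..<v}. \<bar>deriv h z\<bar> = \<bar>h v - h u\<bar> / (v - u)"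
proof -
  have "\<exists>z>u. z < v \<and> h v - h u = (v - u) * deriv h z"
    using branchD(5)[OF b] branch_interval[OF b uv(1,2)] uv(3) by (intro MVT2) auto
  then obtain z where "u < z" "z < v" "h v - h u = (v - u) * deriv h z" by blast
  then show ?thesis using uv by (intro bexI[of _ z]) (auto simp: abs_mult)
qed

text \<open>Some point of the interval realises the mean of \<open>|h'|\<close>, and the distortion
  bound compares all other points with it.\<close>

lemma branch_deriv_le:
  assumes b: "branch \<beta> C K h" and uv: "u \<in> K" "v \<in> K" "u < v" and x: "x \<in> {u..v}" and \<beta>: "0 \<le> \<beta>"
  shows "\<bar>deriv h x\<bar> \<le> (1 + C) * (\<bar>h v - h u\<bar> / (v - u))"
proof -
  obtain z where z: "z \<in> {u<..<v}" "\<bar>deriv h z\<bar> = \<bar>h v - h u\<bar> / (v - u)" using branch_mvt[OF b uv] by blast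
  have "(\<bar>x - z\<bar> / (v - u)) powr \<beta> \<le> 1" using x z uv \<beta> by (intro powr_le1) (auto simp: divide_le_eq_1)
  then have "C * (\<bar>h v - h u\<bar> / (v - u)) * (\<bar>x - z\<bar> / (v - u)) powr \<beta> \<le> C * (\<bar>h v - h u\<bar> / (v - u)) * 1"
    using branchD(4)[OF b] uv by (intro mult_left_mono) auto
  moreover have "\<bar>\<bar>deriv h x\<bar> - \<bar>deriv h z\<bar>\<bar> \<le> C * (\<bar>h v - h u\<bar> / (v - u)) * (\<bar>x - z\<bar> / (v - u)) powr \<beta>"
    using x z by (intro branchD(6)[OF b uv]) auto
  ultimately have "\<bar>deriv h x\<bar> \<le> \<bar>deriv h z\<bar> + C * (\<bar>h v - h u\<bar> / (v - u))" by linarith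
  also have "\<dots> = (1 + C) * (\<bar>h v - h u\<bar> / (v - u))" unfolding z(2) by (simp only: distrib_right mult_1)
  finally show ?thesis .
qed

lemma branch_cong:
  assumes b: "branch \<beta> C K h" and eq: "\<And>x. x \<in> K \<Longrightarrow> g x = h x"
  shows "branch \<beta> C K g"
proof -
  have d: "(g has_real_derivative deriv h x) (at x)" if "x \<in> K" for x
    using branchD(5)[OF b that]
    by (rule has_field_derivative_transform_within_open[OF _ branchD(1)[OF b] that]) (simp add: eq)
  have dg: "deriv g x = deriv h x" if "x \<in> K" for x using DERIV_imp_deriv[OF d[OF that]] .
  show ?thesis
    unfolding branch_def
  proof (intro conjI ballI impI)
    show "open K" "is_interval K" "0 \<le> C" using branchD[OF b] by auto
    show "inj_on g K" using branchD(3)[OF b] eq by (simp cong: inj_on_cong)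
    show "(g has_real_derivative deriv g x) (at x)" if "x \<in> K" for x using d[OF that] dg[OF that] by simp
    fix u v x y assume uv: "u \<in> K" "v \<in> K" "u < v" "x \<in> {u..v}" "y \<in> {u..v}"
    then have "x \<in> K" "y \<in> K" using branch_interval[OF b uv(1,2)] by auto
    then show "\<bar>\<bar>deriv g x\<bar> - \<bar>deriv g y\<bar>\<bar> \<le> C * (\<bar>g v - g u\<bar> / (v - u)) * (\<bar>x - y\<bar> / (v - u)) powr \<beta>"
      using branchD(6)[OF b uv] dg eq uv(1,2) by simp
  qed
qed

text \<open>The image of \<open>{u..v}\<close> under \<open>h2\<close> spans \<open>{p..r}\<close>,
  so the product of the two means is the mean for the composition. In the constant,
  \<open>(1 + C1) * C2\<close> comes from the oscillation of \<open>h2'\<close>, and the other term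
  from that of \<open>h1'\<close>: one factor \<open>1 + C2\<close> bounds \<open>|h2'|\<close> by
  its mean, the other bounds how much \<open>h2\<close> stretches relative distances.\<close>

lemma branch_comp:
  assumes b1: "branch \<beta> C1 K1 h1" and b2: "branch \<beta> C2 K2 h2" and \<beta>: "0 < \<beta>" "\<beta> \<le> 1"
  shows "branch \<beta> ((1 + C1) * C2 + C1 * (1 + C2) * (1 + C2)) {x \<in> K2. h2 x \<in> K1} (h1 \<circ> h2)"
    and "\<And>x. x \<in> K2 \<Longrightarrow> h2 x \<in> K1 \<Longrightarrow> deriv (h1 \<circ> h2) x = deriv h1 (h2 x) * deriv h2 x"
proof -
  let ?K = "{x \<in> K2. h2 x \<in> K1}"
  note C = branchD(4)[OF b1] branchD(4)[OF b2]
  have d: "(h1 \<circ> h2 has_real_derivative deriv h1 (h2 x) * deriv h2 x) (at x)" if "x \<in> ?K" for x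
    using that branchD(5)[OF b1] branchD(5)[OF b2] by (intro DERIV_chain) auto
  have dd: "deriv (h1 \<circ> h2) x = deriv h1 (h2 x) * deriv h2 x" if "x \<in> ?K" for x
    using DERIV_imp_deriv[OF d[OF that]] .
  then show "\<And>x. x \<in> K2 \<Longrightarrow> h2 x \<in> K1 \<Longrightarrow> deriv (h1 \<circ> h2) x = deriv h1 (h2 x) * deriv h2 x" by blast
  show "branch \<beta> ((1 + C1) * C2 + C1 * (1 + C2) * (1 + C2)) ?K (h1 \<circ> h2)"
    unfolding branch_def
  proof (intro conjI ballI impI)
    show "open ?K"
    proof -
      have "?K = K2 \<inter> h2 -` K1" by auto
      then show ?thesis
        using continuous_on_open_vimage[OF branchD(1)[OF b2]] branch_continuous[OF b2] branchD(1)[OF b1]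
        by (metis Int_commute)
    qed
    show "is_interval ?K" by (rule branch_preimage_interval[OF b2 branchD(2)[OF b1]])
    show "inj_on (h1 \<circ> h2) ?K"
      using branchD(3)[OF b1] branchD(3)[OF b2] by (auto simp: inj_on_def)
    show "0 \<le> (1 + C1) * C2 + C1 * (1 + C2) * (1 + C2)" using C by auto
    show "(h1 \<circ> h2 has_real_derivative deriv (h1 \<circ> h2) x) (at x)" if "x \<in> ?K" for x
      using d[OF that] dd[OF that] by simp
    fix u v x y assume u: "u \<in> ?K" and v: "v \<in> ?K" and uv: "u < v" and x: "x \<in> {u..v}" and y: "y \<in> {u..v}"
    have sub: "{u..v} \<subseteq> ?K" using \<open>is_interval ?K\<close> u v unfolding is_interval_1 by (meson atLeastAtMost_iff subsetI)
    have uK: "u \<in> K2" "v \<in> K2" "h2 u \<in> K1" "h2 v \<in> K1" using u v by auto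
    define p where "p = min (h2 u) (h2 v)"
    define r where "r = max (h2 u) (h2 v)"
    have ne: "h2 u \<noteq> h2 v" using inj_onD[OF branchD(3)[OF b2] _ uK(1,2)] uv by auto
    have pr: "p \<in> K1" "r \<in> K1" "p < r" using uK ne by (auto simp: p_def r_def min_def max_def)
    have img: "h2 z \<in> {p..r}" if "z \<in> {u..v}" for z
    proof (cases "z = u \<or> z = v")
      case True
      then show ?thesis by (auto simp: p_def r_def)
    next
      case False
      then show ?thesis
        using injective_between[of u v h2 z] that branch_interval[OF b2 uK(1,2)] branch_continuous[OF b2] branchD(3)[OF b2]
        by (auto simp: p_def r_def intro: continuous_on_subset inj_on_subset less_imp_le)
    qed
    define M1 where "M1 = \<bar>h1 r - h1 p\<bar> / (r - p)"
    define M2 where "M2 = \<bar>h2 v - h2 u\<bar> / (v - u)"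
    have M1n: "0 \<le> M1" using pr by (simp add: M1_def)
    have M2n: "0 < M2" using uv ne by (simp add: M2_def)
    have rp: "r - p = \<bar>h2 v - h2 u\<bar>" by (auto simp: r_def p_def)
    have "\<bar>h1 r - h1 p\<bar> = \<bar>h1 (h2 v) - h1 (h2 u)\<bar>" by (auto simp: r_def p_def min_def max_def)
    then have M12: "M1 * M2 = \<bar>(h1 \<circ> h2) v - (h1 \<circ> h2) u\<bar> / (v - u)"
      using ne uv unfolding M1_def M2_def rp by simp
    define t where "t = \<bar>x - y\<bar> / (v - u)"
    have t: "0 \<le> t" using uv by (simp add: t_def)
    have D1: "\<bar>deriv h1 (h2 z)\<bar> \<le> (1 + C1) * M1" if "z \<in> {u..v}" for z
      unfolding M1_def using branch_deriv_le[OF b1 pr img[OF that]] \<beta> by simp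
    have D2: "\<bar>deriv h2 z\<bar> \<le> (1 + C2) * M2" if "z \<in> {u..v}" for z
      unfolding M2_def using branch_deriv_le[OF b2 uK(1,2) uv that] \<beta> by simp
    have E2: "\<bar>\<bar>deriv h2 x\<bar> - \<bar>deriv h2 y\<bar>\<bar> \<le> C2 * M2 * t powr \<beta>"
      unfolding M2_def t_def using branchD(6)[OF b2 uK(1,2) uv x y] .
    have lip: "\<bar>h2 x - h2 y\<bar> \<le> (1 + C2) * M2 * \<bar>x - y\<bar>"
    proof -
      have le: "\<bar>h2 y - h2 x\<bar> \<le> (1 + C2) * M2 * (y - x)" if xy: "x < y" "x \<in> {u..v}" "y \<in> {u..v}" for x y
      proof -
        have "x \<in> K2" "y \<in> K2" using xy(2,3) sub by blast+
        then obtain z where "z \<in> {x<..<y}" "\<bar>deriv h2 z\<bar> = \<bar>h2 y - h2 x\<bar> / (y - x)"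
          using branch_mvt[OF b2 _ _ xy(1)] by blast
        then show ?thesis using D2[of z] xy by (simp add: divide_le_eq)
      qed
      show ?thesis using le[of x y] le[of y x] x y by (cases x y rule: linorder_cases) auto
    qed
    have E1: "\<bar>\<bar>deriv h1 (h2 x)\<bar> - \<bar>deriv h1 (h2 y)\<bar>\<bar> \<le> C1 * M1 * ((1 + C2) * t powr \<beta>)"
    proof -
      have "\<bar>\<bar>deriv h1 (h2 x)\<bar> - \<bar>deriv h1 (h2 y)\<bar>\<bar> \<le> C1 * M1 * (\<bar>h2 x - h2 y\<bar> / (r - p)) powr \<beta>"
        unfolding M1_def using branchD(6)[OF b1 pr img[OF x] img[OF y]] .
      also have "\<dots> \<le> C1 * M1 * ((1 + C2) * t) powr \<beta>"
      proof (intro mult_left_mono powr_mono2)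
        have "r - p = M2 * (v - u)" using uv by (simp add: M2_def rp)
        then have "\<bar>h2 x - h2 y\<bar> / (r - p) \<le> (1 + C2) * M2 * \<bar>x - y\<bar> / (M2 * (v - u))"
          using divide_right_mono[OF lip, of "r - p"] pr by (simp only:)
        also have "\<dots> = (1 + C2) * t" using M2n by (simp add: t_def)
        finally show "\<bar>h2 x - h2 y\<bar> / (r - p) \<le> (1 + C2) * t" .
      qed (use \<beta> C M1n pr in auto)
      also have "\<dots> \<le> C1 * M1 * ((1 + C2) * t powr \<beta>)"
      proof (intro mult_left_mono)
        have "(1 + C2) powr \<beta> \<le> (1 + C2) powr 1" using C \<beta> by (intro powr_mono) auto
        then have "(1 + C2) powr \<beta> * t powr \<beta> \<le> (1 + C2) * t powr \<beta>" using C by (intro mult_right_mono) auto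
        then show "((1 + C2) * t) powr \<beta> \<le> (1 + C2) * t powr \<beta>" using C t by (simp add: powr_mult)
      qed (use C M1n in auto)
      finally show ?thesis .
    qed
    have "\<bar>\<bar>deriv (h1 \<circ> h2) x\<bar> - \<bar>deriv (h1 \<circ> h2) y\<bar>\<bar> =
      \<bar>\<bar>deriv h1 (h2 x)\<bar> * (\<bar>deriv h2 x\<bar> - \<bar>deriv h2 y\<bar>) + (\<bar>deriv h1 (h2 x)\<bar> - \<bar>deriv h1 (h2 y)\<bar>) * \<bar>deriv h2 y\<bar>\<bar>"
      unfolding dd[OF subsetD[OF sub x]] dd[OF subsetD[OF sub y]] by (simp add: abs_mult algebra_simps)
    also have "\<dots> \<le> \<bar>deriv h1 (h2 x)\<bar> * \<bar>\<bar>deriv h2 x\<bar> - \<bar>deriv h2 y\<bar>\<bar> + \<bar>\<bar>deriv h1 (h2 x)\<bar> - \<bar>deriv h1 (h2 y)\<bar>\<bar> * \<bar>deriv h2 y\<bar>"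
      by (rule order_trans[OF abs_triangle_ineq]) (simp add: abs_mult)
    also have "\<dots> \<le> ((1 + C1) * M1) * (C2 * M2 * t powr \<beta>) + (C1 * M1 * ((1 + C2) * t powr \<beta>)) * ((1 + C2) * M2)"
      using D1[OF x] E2 E1 D2[OF y] C M1n M2n by (intro add_mono mult_mono) auto
    also have "\<dots> = ((1 + C1) * C2 + C1 * (1 + C2) * (1 + C2)) * (M1 * M2) * t powr \<beta>"
      by (simp add: algebra_simps)
    finally show "\<bar>\<bar>deriv (h1 \<circ> h2) x\<bar> - \<bar>deriv (h1 \<circ> h2) y\<bar>\<bar> \<le>
        ((1 + C1) * C2 + C1 * (1 + C2) * (1 + C2)) * (\<bar>(h1 \<circ> h2) v - (h1 \<circ> h2) u\<bar> / (v - u)) * (\<bar>x - y\<bar> / (v - u)) powr \<beta>"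
      unfolding M12 t_def .
  qed
qed

text \<open>Where \<open>|h'|\<close> is at least \<open>c\<close>, so is its mean on every
  subinterval, and the ordinary Hoelder bound is one relative to that mean. The factor
  \<open>L powr \<beta>\<close> passes from distances to relative distances.\<close>

lemma branch_of_holder:
  assumes K: "open K" "is_interval K" and L: "\<And>x y. x \<in> K \<Longrightarrow> y \<in> K \<Longrightarrow> \<bar>x - y\<bar> \<le> L"
    and h: "\<And>x. x \<in> K \<Longrightarrow> (h has_real_derivative h' x) (at x)"
    and H: "\<And>x y. x \<in> K \<Longrightarrow> y \<in> K \<Longrightarrow> \<bar>h' x - h' y\<bar> \<le> H * \<bar>x - y\<bar> powr \<beta>" "0 \<le> H"
    and c: "\<And>x. x \<in> K \<Longrightarrow> c \<le> \<bar>h' x\<bar>" "0 < c" and \<beta>: "0 < \<beta>"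
  shows "branch \<beta> (H * L powr \<beta> / c) K h"
proof -
  have sub: "{u..v} \<subseteq> K" if "u \<in> K" "v \<in> K" for u v
    using K(2) that unfolding is_interval_1 by (meson atLeastAtMost_iff subsetI)
  have dh: "deriv h x = h' x" if "x \<in> K" for x using DERIV_imp_deriv[OF h[OF that]] .
  have mv: "c * (v - u) \<le> \<bar>h v - h u\<bar>" if "u \<in> K" "v \<in> K" "u < v" for u v
  proof -
    have "\<exists>z>u. z < v \<and> h v - h u = (v - u) * h' z" using h sub[OF that(1,2)] that(3) by (intro MVT2) auto
    then obtain z where z: "u < z" "z < v" "h v - h u = (v - u) * h' z" by blast
    then have "z \<in> K" using sub[OF that(1,2)] by (auto simp: subset_iff)
    then have "c \<le> \<bar>h' z\<bar>" by (rule c(1))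
    then show ?thesis using z that by (simp add: abs_mult mult.commute mult_left_mono)
  qed
  show ?thesis
    unfolding branch_def
  proof (intro conjI ballI impI)
    show "open K" "is_interval K" by fact+
    show "inj_on h K"
    proof (rule linorder_inj_onI)
      fix u v assume "u < v" "u \<in> K" "v \<in> K"
      then have "0 < \<bar>h v - h u\<bar>" using mv[of u v] c(2) by (smt (verit) mult_pos_pos)
      then show "h u \<noteq> h v" by auto
    qed auto
    show "0 \<le> H * L powr \<beta> / c" using H c by simp
    show "(h has_real_derivative deriv h x) (at x)" if "x \<in> K" for x using h[OF that] dh[OF that] by simp
    fix u v x y assume u: "u \<in> K" and v: "v \<in> K" and uv: "u < v" and x: "x \<in> {u..v}" and y: "y \<in> {u..v}"
    have xK: "x \<in> K" "y \<in> K" using sub[OF u v] x y by auto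
    define t where "t = \<bar>x - y\<bar> / (v - u)"
    have "\<bar>\<bar>deriv h x\<bar> - \<bar>deriv h y\<bar>\<bar> \<le> H * \<bar>x - y\<bar> powr \<beta>"
      using H(1)[OF xK] dh xK by simp
    also have "\<bar>x - y\<bar> = (v - u) * t" using uv by (simp add: t_def)
    also have "((v - u) * t) powr \<beta> = (v - u) powr \<beta> * t powr \<beta>"
      by (rule powr_mult)
    also have "H * ((v - u) powr \<beta> * t powr \<beta>) \<le> H * (L powr \<beta> * t powr \<beta>)"
      using uv L[OF v u] \<beta> H(2) by (intro mult_left_mono mult_right_mono powr_mono2) auto
    also have "\<dots> = (H * L powr \<beta> / c) * c * t powr \<beta>" using c by simp
    also have "\<dots> \<le> (H * L powr \<beta> / c) * (\<bar>h v - h u\<bar> / (v - u)) * t powr \<beta>"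
      using mv[OF u v uv] uv H c by (intro mult_right_mono mult_left_mono) (auto simp: le_divide_eq)
    finally show "\<bar>\<bar>deriv h x\<bar> - \<bar>deriv h y\<bar>\<bar> \<le> H * L powr \<beta> / c * (\<bar>h v - h u\<bar> / (v - u)) * (\<bar>x - y\<bar> / (v - u)) powr \<beta>"
      by (simp add: t_def)
  qed
qed

section \<open>Affine maps, powers and the inverse branches of both types\<close>

lemma branch_affine:
  assumes "m \<noteq> 0" "0 < \<beta>"
  shows "branch \<beta> 0 UNIV (\<lambda>x. m * x + n)"
proof -
  have d: "((\<lambda>x. m * x + n) has_real_derivative m) (at x)" for x by (auto intro!: derivative_eq_intros)
  have dd: "deriv (\<lambda>x. m * x + n) x = m" for x using DERIV_imp_deriv[OF d] .
  then show ?thesis using assms d by (auto simp: branch_def inj_on_def dd is_interval_univ)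
qed

text \<open>Apply \<open>w \<le> w powr \<gamma>\<close>, valid on the unit interval, to the
  fractions \<open>x / (x + y)\<close> and \<open>y / (x + y)\<close>, which sum to 1.\<close>

lemma powr_add_le:
  fixes x y \<gamma> :: real
  assumes "0 \<le> x" "0 \<le> y" "0 < \<gamma>" "\<gamma> \<le> 1"
  shows "(x + y) powr \<gamma> \<le> x powr \<gamma> + y powr \<gamma>"
proof (cases "x = 0 \<or> y = 0")
  case True
  then show ?thesis by auto
next
  case False
  then have pos: "0 < x" "0 < y" using assms by auto
  have le: "w / (x + y) \<le> (w / (x + y)) powr \<gamma>" if "0 < w" "w \<le> x + y" for w
    using powr_mono'[of \<gamma> 1 "w / (x + y)"] that assms pos by (simp add: divide_le_eq_1)
  have "1 = x / (x + y) + y / (x + y)" using pos by (simp flip: add_divide_distrib)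
  also have "\<dots> \<le> (x / (x + y)) powr \<gamma> + (y / (x + y)) powr \<gamma>"
    using pos by (intro add_mono le) auto
  also have "\<dots> = (x powr \<gamma> + y powr \<gamma>) / (x + y) powr \<gamma>"
    using pos by (simp add: powr_divide add_divide_distrib)
  finally show ?thesis using pos by (simp add: le_divide_eq)
qed

text \<open>For \<open>\<gamma> \<le> 1\<close> this is subadditivity; for larger
  \<open>\<gamma>\<close> the power is Lipschitz on the unit interval by the mean value theorem. In
  both cases the exponent of a difference at most 1 is then lowered to
  \<open>\<beta>\<close>.\<close>

lemma powr_diff_le:
  fixes x y \<gamma> \<beta> :: real
  assumes xy: "0 \<le> x" "0 \<le> y" "x \<le> 1" "y \<le> 1" and g: "0 < \<beta>" "\<beta> \<le> \<gamma>" "\<beta> \<le> 1"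
  shows "\<bar>x powr \<gamma> - y powr \<gamma>\<bar> \<le> (1 + \<gamma>) * \<bar>x - y\<bar> powr \<beta>"
proof -
  have gen: "y powr \<gamma> - x powr \<gamma> \<le> (1 + \<gamma>) * (y - x) powr \<beta>" if "0 \<le> x" "x < y" "y \<le> 1" for x y
  proof (cases "\<gamma> \<le> 1")
    case True
    have "(x + (y - x)) powr \<gamma> \<le> x powr \<gamma> + (y - x) powr \<gamma>"
      using that True g by (intro powr_add_le) auto
    then have "y powr \<gamma> - x powr \<gamma> \<le> 1 * (y - x) powr \<gamma>" by simp
    also have "\<dots> \<le> (1 + \<gamma>) * (y - x) powr \<beta>"
      using that g by (intro mult_mono powr_mono') auto
    finally show ?thesis .
  next
    case False
    have "\<exists>z>x. z < y \<and> y powr \<gamma> - x powr \<gamma> = (y - x) * (\<gamma> * z powr (\<gamma> - 1))"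
    proof -
      have "\<exists>l z. x < z \<and> z < y \<and> ((\<lambda>t. t powr \<gamma>) has_real_derivative l) (at z) \<and> y powr \<gamma> - x powr \<gamma> = (y - x) * l"
      proof (rule MVT)
        show "continuous_on {x..y} (\<lambda>t. t powr \<gamma>)"
          using that g by (intro continuous_on_powr') (auto intro: continuous_intros)
        show "(\<lambda>t. t powr \<gamma>) differentiable at t" if "x < t" "t < y" for t
          using that \<open>0 \<le> x\<close> by (auto simp: real_differentiable_def intro!: exI has_real_derivative_powr)
      qed (use that in auto)
      then obtain l z where z: "x < z" "z < y" "((\<lambda>t. t powr \<gamma>) has_real_derivative l) (at z)"
        "y powr \<gamma> - x powr \<gamma> = (y - x) * l" by blast
      moreover have "l = \<gamma> * z powr (\<gamma> - 1)"
        using z that by (intro DERIV_unique[OF z(3) has_real_derivative_powr]) auto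
      ultimately show ?thesis by blast
    qed
    then obtain z where z: "x < z" "z < y" "y powr \<gamma> - x powr \<gamma> = (y - x) * (\<gamma> * z powr (\<gamma> - 1))" by blast
    have "z powr (\<gamma> - 1) \<le> 1" using z that False by (intro powr_le1) auto
    then have "(y - x) * (\<gamma> * z powr (\<gamma> - 1)) \<le> (y - x) * (\<gamma> * 1)"
      using that g by (intro mult_left_mono) auto
    also have "\<dots> \<le> (y - x) powr \<beta> * (1 + \<gamma>)"
    proof (intro mult_mono)
      have "(y - x) powr 1 \<le> (y - x) powr \<beta>" using that g by (intro powr_mono') auto
      then show "y - x \<le> (y - x) powr \<beta>" using that by simp
    qed (use g in auto)
    finally show ?thesis using z by (simp add: mult.commute)
  qed
  show ?thesis
  proof (cases x y rule: linorder_cases)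
    case less
    have "x powr \<gamma> \<le> y powr \<gamma>" using less xy g by (intro powr_mono2) auto
    then show ?thesis using gen[of x y] less xy by simp
  next
    case greater
    have "y powr \<gamma> \<le> x powr \<gamma>" using greater xy g by (intro powr_mono2) auto
    then show ?thesis using gen[of y x] greater xy by simp
  qed simp
qed

text \<open>The derivative tends to 0 at the boundary point 0, so \<open>branch_of_holder\<close>
  does not apply. Instead the mean of the derivative on \<open>{u..v}\<close> is at least
  \<open>v powr \<gamma>\<close>, and by homogeneity division by \<open>v\<close> reduces the
  oscillation of \<open>t powr \<gamma>\<close> to the unit interval. This is where the condition
  between \<open>\<beta>\<close> and \<open>\<gamma>\<close> enters.\<close>

lemma branch_powr:
  fixes \<gamma> \<beta> :: real
  assumes g: "0 < \<beta>" "\<beta> \<le> \<gamma>" "\<beta> \<le> 1"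
  shows "branch \<beta> ((1 + \<gamma>) * (1 + \<gamma>)) {0<..} (\<lambda>t. t powr (1 + \<gamma>))"
proof -
  have d: "((\<lambda>t. t powr (1 + \<gamma>)) has_real_derivative (1 + \<gamma>) * t powr \<gamma>) (at t)" if "0 < t" for t
    using has_real_derivative_powr[OF that, of "1 + \<gamma>"] by simp
  have dd: "deriv (\<lambda>t. t powr (1 + \<gamma>)) t = (1 + \<gamma>) * t powr \<gamma>" if "0 < t" for t
    using DERIV_imp_deriv[OF d[OF that]] .
  show ?thesis
    unfolding branch_def
  proof (intro conjI ballI impI)
    show "inj_on (\<lambda>t. t powr (1 + \<gamma>)) {0<..}"
    proof (rule linorder_inj_onI)
      fix x y :: real assume "x < y" "x \<in> {0<..}"
      then show "x powr (1 + \<gamma>) \<noteq> y powr (1 + \<gamma>)"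
        using powr_less_mono2[of "1 + \<gamma>" x y] g by simp
    qed auto
    show "((\<lambda>t. t powr (1 + \<gamma>)) has_real_derivative deriv (\<lambda>t. t powr (1 + \<gamma>)) x) (at x)" if "x \<in> {0<..}" for x
      using that d dd by auto
    fix u v x y :: real assume u: "u \<in> {0<..}" and v: "v \<in> {0<..}" and uv: "u < v" and x: "x \<in> {u..v}" and y: "y \<in> {u..v}"
    let ?t = "\<bar>x - y\<bar> / (v - u)"
    have pos: "0 < u" "0 < v" "0 < x" "0 < y" using u v x y by auto
    have "v powr \<gamma> * (v - u) \<le> v powr (1 + \<gamma>) - u powr (1 + \<gamma>)"
    proof -
      have "u powr \<gamma> \<le> v powr \<gamma>" using uv pos g by (intro powr_mono2) auto
      then have "u * u powr \<gamma> \<le> u * v powr \<gamma>" using pos by (intro mult_left_mono) auto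
      then show ?thesis using pos by (simp add: powr_add algebra_simps)
    qed
    then have mean: "v powr \<gamma> \<le> \<bar>v powr (1 + \<gamma>) - u powr (1 + \<gamma>)\<bar> / (v - u)"
      using uv by (simp add: le_divide_eq)
    have "\<bar>x powr \<gamma> - y powr \<gamma>\<bar> = v powr \<gamma> * \<bar>(x / v) powr \<gamma> - (y / v) powr \<gamma>\<bar>"
    proof -
      have "x powr \<gamma> = v powr \<gamma> * (x / v) powr \<gamma>" "y powr \<gamma> = v powr \<gamma> * (y / v) powr \<gamma>"
        using pos by (simp_all add: powr_divide)
      then show ?thesis by (simp add: abs_mult flip: right_diff_distrib)
    qed
    also have "\<dots> \<le> v powr \<gamma> * ((1 + \<gamma>) * \<bar>x / v - y / v\<bar> powr \<beta>)"
      using x y pos g by (intro mult_left_mono powr_diff_le) auto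
    also have "\<dots> \<le> v powr \<gamma> * ((1 + \<gamma>) * ?t powr \<beta>)"
    proof (intro mult_left_mono powr_mono2)
      have "\<bar>x / v - y / v\<bar> = \<bar>x - y\<bar> / v" using pos by (simp flip: diff_divide_distrib)
      also have "\<dots> \<le> ?t" using pos uv by (intro divide_left_mono) auto
      finally show "\<bar>x / v - y / v\<bar> \<le> ?t" .
    qed (use g in auto)
    also have "\<dots> \<le> (\<bar>v powr (1 + \<gamma>) - u powr (1 + \<gamma>)\<bar> / (v - u)) * ((1 + \<gamma>) * ?t powr \<beta>)"
      using mean g by (intro mult_right_mono) auto
    finally have "(1 + \<gamma>) * \<bar>x powr \<gamma> - y powr \<gamma>\<bar> \<le> (1 + \<gamma>) * ((\<bar>v powr (1 + \<gamma>) - u powr (1 + \<gamma>)\<bar> / (v - u)) * ((1 + \<gamma>) * ?t powr \<beta>))"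
      using g by (intro mult_left_mono) auto
    moreover have "\<bar>\<bar>(1 + \<gamma>) * x powr \<gamma>\<bar> - \<bar>(1 + \<gamma>) * y powr \<gamma>\<bar>\<bar> = (1 + \<gamma>) * \<bar>x powr \<gamma> - y powr \<gamma>\<bar>"
      using g by (simp add: abs_mult flip: right_diff_distrib)
    ultimately show "\<bar>\<bar>deriv (\<lambda>t. t powr (1 + \<gamma>)) x\<bar> - \<bar>deriv (\<lambda>t. t powr (1 + \<gamma>)) y\<bar>\<bar>
        \<le> (1 + \<gamma>) * (1 + \<gamma>) * (\<bar>v powr (1 + \<gamma>) - u powr (1 + \<gamma>)\<bar> / (v - u)) * ?t powr \<beta>"
      unfolding dd[OF pos(3)] dd[OF pos(4)] by (simp add: mult_ac)
  qed (use g in \<open>auto simp: is_interval_1\<close>)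
qed

text \<open>The derivative of the inverse is Hoelder by the definition of a diffeomorphism. It is
  bounded below because its product with \<open>g'\<close> is 1 and \<open>g'\<close> is bounded on
  the compact interval. On the bounded image the exponent \<open>\<eta>\<close> may be lowered to
  \<open>\<beta>\<close> at the price of \<open>L powr (\<eta> - \<beta>)\<close>.\<close>

lemma diffeo_branch:
  assumes g: "C1_holder_diffeo \<eta> {c..d} g" and cd: "c < d" and \<beta>: "0 < \<beta>" "\<beta> \<le> \<eta>"
  shows "\<exists>C. branch \<beta> C (g ` {c<..<d}) (inv_into {c..d} g)"
    and "continuous_on {c..d} g" and "inj_on g {c..d}"
    and "\<And>x. x \<in> {c<..<d} \<Longrightarrow> \<exists>D. (g has_real_derivative D) (at x)"
proof -
  let ?k = "inv_into {c..d} g" and ?K = "g ` {c<..<d}"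
  show inj: "inj_on g {c..d}" using g unfolding C1_holder_diffeo_def by blast
  have hg: "C1_holder \<eta> {c..d} g" and hk: "C1_holder \<eta> (g ` {c..d}) ?k"
    using g unfolding C1_holder_diffeo_def by blast+
  from hg obtain g' where g': "\<And>x. x \<in> {c..d} \<Longrightarrow> (g has_real_derivative g' x) (at x within {c..d})" "continuous_on {c..d} g'"
    unfolding C1_holder_def by blast
  from hk obtain k' C where k': "\<And>y. y \<in> g ` {c..d} \<Longrightarrow> (?k has_real_derivative k' y) (at y within g ` {c..d})"
    and C: "\<And>x y. x \<in> g ` {c..d} \<Longrightarrow> y \<in> g ` {c..d} \<Longrightarrow> \<bar>k' x - k' y\<bar> \<le> C * \<bar>x - y\<bar> powr \<eta>"
    unfolding C1_holder_def by metis
  show cont: "continuous_on {c..d} g" by (rule DERIV_continuous_on[OF g'(1)])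
  have gat: "(g has_real_derivative g' x) (at x)" if "x \<in> {c<..<d}" for x
    using g'(1)[of x] that by (auto simp: at_within_Icc_at)
  then show "\<And>x. x \<in> {c<..<d} \<Longrightarrow> \<exists>D. (g has_real_derivative D) (at x)" by blast
  define L where "L = max (g c) (g d) - min (g c) (g d)"
  note img = injective_image_interval[OF cont inj cd]
  have K: "open ?K" "is_interval ?K" unfolding img(1) by (rule open_greaterThanLessThan, rule is_interval_oo)
  have sub: "?K \<subseteq> g ` {c..d}" by auto
  have L: "\<bar>x - y\<bar> \<le> L" if "x \<in> ?K" "y \<in> ?K" for x y proof -
    have "x \<in> {u<..<v} \<Longrightarrow> y \<in> {u<..<v} \<Longrightarrow> \<bar>x - y\<bar> \<le> v - u" for u v by auto
    then show ?thesis using that unfolding img(1) L_def by blast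
  qed
  have L0: "0 < L" using img(3) by (simp add: L_def)
  have kat: "(?k has_real_derivative k' y) (at y)" if "y \<in> ?K" for y
    using DERIV_subset[OF k'[OF subsetD[OF sub that]] sub] unfolding at_within_open[OF that K(1)] .
  have "bounded (g' ` {c..d})" using g'(2) by (intro compact_imp_bounded compact_continuous_image) auto
  then obtain G where G: "0 < G" "\<And>x. x \<in> {c..d} \<Longrightarrow> \<bar>g' x\<bar> \<le> G" by (auto simp: bounded_pos)
  have below: "1 / G \<le> \<bar>k' y\<bar>" if "y \<in> ?K" for y
  proof -
    obtain x where x: "x \<in> {c<..<d}" "y = g x" using \<open>y \<in> ?K\<close> by auto
    have "((\<lambda>z. ?k (g z)) has_real_derivative k' (g x) * g' x) (at x)"
      using DERIV_chain2[OF kat gat[OF x(1)]] \<open>y \<in> ?K\<close> x by simp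
    moreover have "((\<lambda>z. ?k (g z)) has_real_derivative 1) (at x)"
    proof (rule has_field_derivative_transform_within_open[OF DERIV_ident _ x(1)])
      show "z = ?k (g z)" if "z \<in> {c<..<d}" for z using inv_into_f_f[OF inj, of z] that by simp
    qed simp
    ultimately have "k' y * g' x = 1" using DERIV_unique x(2) by blast
    then have 1: "\<bar>k' y\<bar> * \<bar>g' x\<bar> = 1" by (metis abs_mult abs_one)
    have "\<bar>k' y\<bar> * \<bar>g' x\<bar> \<le> \<bar>k' y\<bar> * G" using G(2)[of x] x by (intro mult_left_mono) auto
    then show ?thesis using 1 G(1) by (simp add: divide_le_eq)
  qed
  have "branch \<beta> (\<bar>C\<bar> * L powr (\<eta> - \<beta>) * L powr \<beta> / (1 / G)) ?K ?k"
  proof (rule branch_of_holder[OF K L kat])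
    show "\<bar>k' x - k' y\<bar> \<le> \<bar>C\<bar> * L powr (\<eta> - \<beta>) * \<bar>x - y\<bar> powr \<beta>" if xy: "x \<in> ?K" "y \<in> ?K" for x y
    proof -
      have "\<bar>k' x - k' y\<bar> \<le> C * \<bar>x - y\<bar> powr \<eta>" using xy sub by (intro C) auto
      also have "\<dots> \<le> \<bar>C\<bar> * (\<bar>x - y\<bar> powr (\<eta> - \<beta>) * \<bar>x - y\<bar> powr \<beta>)"
        by (simp add: powr_add[symmetric] mult_right_mono)
      also have "\<dots> \<le> \<bar>C\<bar> * (L powr (\<eta> - \<beta>) * \<bar>x - y\<bar> powr \<beta>)"
        using L[OF xy] \<beta> by (intro mult_left_mono mult_right_mono powr_mono2) auto
      finally show ?thesis by (simp add: mult.assoc)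
    qed
  qed (use below G \<beta> in auto)
  then show "\<exists>C. branch \<beta> C ?K ?k" by blast
qed

lemma type_I_branch_inverse:
  assumes f: "type_I_branch \<eta> {c..d} f" and cd: "c < d" and \<beta>: "0 < \<beta>" "\<beta> \<le> \<eta>"
  shows "(\<exists>C. branch \<beta> C (f ` {c<..<d}) (inv_into {c<..<d} f)) \<and> inj_on f {c<..<d} \<and>
    (\<forall>x\<in>{c<..<d}. \<exists>D. (f has_real_derivative D) (at x))"
proof -
  obtain g where g: "C1_holder_diffeo \<eta> {c..d} g" and fg: "\<And>x. x \<in> {c<..<d} \<Longrightarrow> f x = g x"
    using f by (auto simp: type_I_branch_def interior_atLeastAtMost_real)
  note D = diffeo_branch[OF g cd \<beta>]
  have inj: "inj_on f {c<..<d}"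
  proof -
    have "inj_on g {c<..<d}" by (rule inj_on_subset[OF D(3)]) auto
    then show ?thesis using inj_on_cong[of "{c<..<d}" f g] fg by blast
  qed
  obtain C where C: "branch \<beta> C (g ` {c<..<d}) (inv_into {c..d} g)" using D(1) by blast
  have "branch \<beta> C (g ` {c<..<d}) (inv_into {c<..<d} f)"
  proof (rule branch_cong[OF C])
    fix y assume "y \<in> g ` {c<..<d}"
    then obtain x where x: "x \<in> {c<..<d}" "y = g x" by auto
    have "inv_into {c<..<d} f (f x) = x" by (rule inv_into_f_f[OF inj x(1)])
    moreover have "inv_into {c..d} g (g x) = x" using x by (intro inv_into_f_f[OF D(3)]) auto
    ultimately show "inv_into {c<..<d} f y = inv_into {c..d} g y" using fg x by simp
  qed
  moreover have "f ` {c<..<d} = g ` {c<..<d}" using fg by auto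
  moreover have "\<exists>D. (f has_real_derivative D) (at x)" if x: "x \<in> {c<..<d}" for x
  proof -
    obtain D where "(g has_real_derivative D) (at x)" using D(4)[OF x] by blast
    then have "(f has_real_derivative D) (at x)"
      by (rule has_field_derivative_transform_within_open[OF _ open_greaterThanLessThan x]) (simp add: fg)
    then show ?thesis by blast
  qed
  ultimately show ?thesis using inj by auto
qed

text \<open>The inverse is a composition of four branches: the inverse of \<open>\<psi>\<close>, the
  power \<open>1 + \<gamma>\<close> that undoes the root, an affine map, and the inverse of
  \<open>\<phi>\<close>. The root of f becomes a power, with a derivative that may tend to 0 but
  stays bounded.\<close>

lemma type_II_branch_inverse:
  assumes f: "type_II_branch \<beta> \<eta> {c..d} f" and cd: "c < d" and \<beta>: "0 < \<beta>" "\<beta> \<le> \<eta>"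
  shows "(\<exists>C. branch \<beta> C (f ` {c<..<d}) (inv_into {c<..<d} f)) \<and> inj_on f {c<..<d} \<and>
    (\<forall>x\<in>{c<..<d}. \<exists>D. (f has_real_derivative D) (at x))"
proof -
  obtain D \<gamma> \<phi> \<psi> where D: "0 < D" and g: "0 < \<gamma>" "\<beta> < min 1 \<gamma>"
    and \<phi>: "C1_holder_diffeo \<eta> {c..d} \<phi>" and pos: "\<And>x. x \<in> {c..d} \<Longrightarrow> 0 \<le> D * \<phi> x - c"
    and \<psi>: "C1_holder_diffeo \<eta> ((\<lambda>x. (D * \<phi> x - c) powr (1 / (1 + \<gamma>))) ` {c..d}) \<psi>"
    and f: "\<And>x. x \<in> {c<..<d} \<Longrightarrow> f x = \<psi> ((D * \<phi> x - c) powr (1 / (1 + \<gamma>)))"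
    using f cd by (auto simp: type_II_branch_def interior_atLeastAtMost_real)
  define p where "p x = D * \<phi> x - c" for x
  define r where "r x = p x powr (1 / (1 + \<gamma>))" for x
  note P = diffeo_branch[OF \<phi> cd \<beta>]
  have p0: "0 \<le> p x" if "x \<in> {c..d}" for x using pos[OF that] by (simp add: p_def)
  have pr: "r x powr (1 + \<gamma>) = p x" if "x \<in> {c..d}" for x
    using p0[OF that] g by (simp add: r_def powr_powr)
  have rc: "continuous_on {c..d} r"
    unfolding r_def p_def using P(2) pos g
    by (intro continuous_on_powr' continuous_intros) auto
  have ri: "inj_on r {c..d}"
  proof (rule inj_onI)
    fix x y assume xy: "x \<in> {c..d}" "y \<in> {c..d}" "r x = r y"
    then have "p x = p y" using pr by metis
    then have "\<phi> x = \<phi> y" using D by (simp add: p_def)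
    then show "x = y" using inj_onD[OF P(3)] xy by blast
  qed
  define m where "m = min (r c) (r d)"
  define M where "M = max (r c) (r d)"
  note R = injective_image_interval[OF rc ri cd, folded m_def M_def]
  have "C1_holder_diffeo \<eta> (r ` {c..d}) \<psi>" using \<psi> by (simp add: r_def[abs_def] p_def)
  then have \<psi>': "C1_holder_diffeo \<eta> {m..M} \<psi>" unfolding R(2) .
  note Q = diffeo_branch[OF \<psi>' R(3) \<beta>]
  have m0: "0 \<le> m" by (simp add: m_def r_def)
  have fr: "f x = \<psi> (r x)" if "x \<in> {c<..<d}" for x using f[OF that] by (simp add: r_def p_def)
  have rx: "r x \<in> {m<..<M}" if "x \<in> {c<..<d}" for x using that R(1) by blast
  let ?hin = "inv_into {m..M} \<psi>" and ?pw = "\<lambda>t. t powr (1 + \<gamma>)" and ?af = "\<lambda>t. (1 / D) * t + c / D"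
  let ?k = "inv_into {c..d} \<phi>"
  let ?h = "?k \<circ> (?af \<circ> (?pw \<circ> ?hin))"
  let ?Kin = "\<psi> ` {m<..<M}"
  \<comment> \<open>The domain produced by three applications of \<open>branch_comp\<close>; it is
    identified with the image of f below.\<close>
  let ?K = "{y \<in> {y \<in> {y \<in> ?Kin. ?hin y \<in> {0<..}}. (?pw \<circ> ?hin) y \<in> UNIV}. (?af \<circ> (?pw \<circ> ?hin)) y \<in> \<phi> ` {c<..<d}}"
  obtain C0 C3 where C0: "branch \<beta> C0 ?Kin ?hin" and C3: "branch \<beta> C3 (\<phi> ` {c<..<d}) ?k"
    using Q(1) P(1) by blast
  have \<beta>1: "\<beta> \<le> 1" "\<beta> \<le> \<gamma>" using g by auto
  have "branch \<beta> ((1 + \<gamma>) * (1 + \<gamma>)) {0<..} ?pw" using \<beta> \<beta>1 by (intro branch_powr) auto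
  note b1 = branch_comp(1)[OF this C0 \<beta>(1) \<beta>1(1)]
  have "branch \<beta> 0 UNIV ?af" using D \<beta> by (intro branch_affine) auto
  note b2 = branch_comp(1)[OF this b1 \<beta>(1) \<beta>1(1)]
  obtain C where b3: "branch \<beta> C ?K ?h" using branch_comp(1)[OF C3 b2 \<beta>(1) \<beta>1(1)] by blast
  have h0: "?hin (f x) = r x" if "x \<in> {c<..<d}" for x
    using rx[OF that] fr[OF that] Q(3) by (simp add: inv_into_f_f)
  have af: "?af (?pw (r x)) = \<phi> x" if "x \<in> {c..d}" for x
    using pr[OF that] D by (simp add: p_def field_simps)
  have h: "?h (f x) = x" if "x \<in> {c<..<d}" for x
    using h0[OF that] af[of x] that P(3) by (simp add: inv_into_f_f)
  have inj: "inj_on f {c<..<d}" by (rule inj_on_inverseI[of _ ?h]) (rule h)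
  have "f ` {c<..<d} = ?K"
  proof (intro equalityI subsetI)
    fix y assume "y \<in> f ` {c<..<d}"
    then obtain x where x: "x \<in> {c<..<d}" "y = f x" by auto
    have "0 < r x" using rx[OF x(1)] m0 by simp
    moreover have "y \<in> ?Kin" using x fr rx by auto
    moreover have "(?af \<circ> (?pw \<circ> ?hin)) y \<in> \<phi> ` {c<..<d}"
      using h0[OF x(1)] af[of x] x by auto
    ultimately show "y \<in> ?K" using h0[OF x(1)] x by simp
  next
    fix y assume y: "y \<in> ?K"
    then obtain t where t: "t \<in> {m<..<M}" "y = \<psi> t" by auto
    have ht: "?hin y = t" using t Q(3) by (simp add: inv_into_f_f)
    obtain x where x: "x \<in> {c<..<d}" "?af (?pw t) = \<phi> x" using y ht by auto
    have "p x = t powr (1 + \<gamma>)" using x D by (simp add: p_def field_simps)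
    then have "r x = t" using t m0 g by (simp add: r_def powr_powr)
    then have "f x = y" using fr[OF x(1)] t by simp
    then show "y \<in> f ` {c<..<d}" using imageI[OF x(1), of f] by simp
  qed
  moreover have "branch \<beta> C ?K (inv_into {c<..<d} f)"
  proof (rule branch_cong[OF b3])
    fix y assume "y \<in> ?K"
    then obtain x where x: "x \<in> {c<..<d}" "y = f x" using \<open>f ` {c<..<d} = ?K\<close> by blast
    then show "inv_into {c<..<d} f y = ?h y" using inv_into_f_f[OF inj x(1)] h[OF x(1)] by simp
  qed
  moreover have "\<exists>D. (f has_real_derivative D) (at x)" if x: "x \<in> {c<..<d}" for x
  proof -
    obtain A where A: "(\<phi> has_real_derivative A) (at x)" using P(4)[OF x] by blast
    obtain B where B: "(\<psi> has_real_derivative B) (at (r x))" using Q(4)[OF rx[OF x]] by blast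
    have px: "0 < p x"
    proof -
      have "0 < r x" using rx[OF x] m0 by simp
      then have "p x \<noteq> 0" by (auto simp: r_def)
      then show ?thesis using p0[of x] x by simp
    qed
    have "(p has_real_derivative D * A) (at x)"
      unfolding p_def[abs_def] using A by (auto intro!: derivative_eq_intros)
    then have "(r has_real_derivative (1 / (1 + \<gamma>)) * p x powr (1 / (1 + \<gamma>) - 1) * (D * A)) (at x)"
      unfolding r_def[abs_def] by (rule DERIV_chain2[where f="\<lambda>z. z powr (1 / (1 + \<gamma>))" and g=p, OF has_real_derivative_powr[OF px]])
    then have "((\<lambda>x. \<psi> (r x)) has_real_derivative B * ((1 / (1 + \<gamma>)) * p x powr (1 / (1 + \<gamma>) - 1) * (D * A))) (at x)"
      by (rule DERIV_chain2[where f=\<psi> and g=r, OF B])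
    then have "(f has_real_derivative B * ((1 / (1 + \<gamma>)) * p x powr (1 / (1 + \<gamma>) - 1) * (D * A))) (at x)"
      by (rule has_field_derivative_transform_within_open[OF _ open_greaterThanLessThan x]) (simp add: fr)
    then show ?thesis by blast
  qed
  ultimately show ?thesis using inj by metis
qed

section \<open>Weights supported on intervals\<close>

text \<open>A member that meets \<open>Q\<close> without lying inside it contains
  \<open>Inf Q\<close> or \<open>Sup Q\<close>, and disjointness allows one member for each. It
  serves both for cells against the support of a weight and for images of branches against a fine
  cell.\<close>

lemma card_boundary_le_2:
  fixes S :: "'i \<Rightarrow> real set"
  assumes S: "\<And>i. i \<in> A \<Longrightarrow> is_interval (S i)" and disj: "\<And>i j x. i \<in> A \<Longrightarrow> j \<in> A \<Longrightarrow> x \<in> S i \<Longrightarrow> x \<in> S j \<Longrightarrow> i = j"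
    and Q: "is_interval Q" "bounded Q"
  shows "card {i \<in> A. S i \<inter> Q \<noteq> {} \<and> \<not> S i \<subseteq> Q} \<le> 2"
proof -
  let ?B = "{i \<in> A. S i \<inter> Q \<noteq> {} \<and> \<not> S i \<subseteq> Q}"
  let ?L = "{i \<in> A. Inf Q \<in> S i}" and ?U = "{i \<in> A. Sup Q \<in> S i}"
  have bd: "bdd_below Q" "bdd_above Q" using Q(2) by (auto simp: bounded_imp_bdd_below bounded_imp_bdd_above)
  have sub: "?B \<subseteq> ?L \<union> ?U"
  proof
    fix i assume "i \<in> ?B"
    then obtain x y where i: "i \<in> A" and x: "x \<in> S i" "x \<in> Q" and y: "y \<in> S i" "y \<notin> Q" by blast
    have "Inf Q \<le> x" "x \<le> Sup Q" using x bd by (auto intro: cInf_lower cSup_upper)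
    show "i \<in> ?L \<union> ?U"
    proof (cases "y < x")
      case True
      have "y \<le> z" if "z \<in> Q" for z
        using Q(1) x y True that unfolding is_interval_1 by (meson less_imp_le linear not_le)
      then have "y \<le> Inf Q" using x by (intro cInf_greatest) auto
      then have "Inf Q \<in> S i" using S[OF i] x y \<open>Inf Q \<le> x\<close> unfolding is_interval_1 by blast
      then show ?thesis using i by blast
    next
      case False
      then have "x < y" using x y by (metis linorder_neqE)
      have "z \<le> y" if "z \<in> Q" for z
        using Q(1) x y \<open>x < y\<close> that unfolding is_interval_1 by (meson less_imp_le linear not_le)
      then have "Sup Q \<le> y" using x by (intro cSup_least) auto
      then have "Sup Q \<in> S i" using S[OF i] x y \<open>x \<le> Sup Q\<close> unfolding is_interval_1 by blast
      then show ?thesis using i by blast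
    qed
  qed
  have one: "finite {i \<in> A. z \<in> S i} \<and> card {i \<in> A. z \<in> S i} \<le> 1" for z
  proof (cases "\<exists>i\<in>A. z \<in> S i")
    case True
    then obtain i where "i \<in> A" "z \<in> S i" by blast
    then have "{i \<in> A. z \<in> S i} \<subseteq> {i}" using disj by blast
    then show ?thesis using card_mono[of "{i}" "{i \<in> A. z \<in> S i}"] finite_subset[of _ "{i}"] by auto
  next
    case False
    then have e: "{i \<in> A. z \<in> S i} = {}" by blast
    show ?thesis unfolding e by simp
  qed
  have "card ?B \<le> card (?L \<union> ?U)" using sub one by (intro card_mono) auto
  also have "\<dots> \<le> card ?L + card ?U" by (rule card_Un_le)
  finally show ?thesis using one[of "Inf Q"] one[of "Sup Q"] by linarith
qed

lemma interval_measurable: 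
  fixes P :: "real set"
  assumes "is_interval P" shows "P \<in> sets borel" "P \<in> sets lebesgue"
proof -
  show "P \<in> sets borel" using assms by (rule real_interval_borel_measurable)
  then show "P \<in> sets lebesgue" by simp
qed

lemma interval_length_le_measure:
  assumes P: "is_interval P" "bounded P" and xy: "x \<in> P" "y \<in> P"
  shows "\<bar>x - y\<bar> \<le> measure lebesgue P"
proof -
  have "P \<in> lmeasurable" using P interval_measurable(2)[OF P(1)] by (intro bounded_set_imp_lmeasurable)
  moreover have "{min x y..max x y} \<subseteq> P"
  proof
    fix z assume z: "z \<in> {min x y..max x y}"
    have "z \<in> P" if "u \<in> P" "v \<in> P" "u \<le> z" "z \<le> v" for u v
      using P(1) that unfolding is_interval_1 by blast
    then show "z \<in> P" using xy z by (cases "x \<le> y") auto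
  qed
  ultimately have "measure lebesgue {min x y..max x y} \<le> measure lebesgue P"
    by (intro measure_mono_fmeasurable) auto
  moreover have "measure lebesgue {min x y..max x y} = max x y - min x y" by simp
  ultimately show ?thesis by linarith
qed

lemma interval_measure_le:
  assumes P: "is_interval P" "P \<noteq> {}" "bounded P"
  shows "measure lebesgue P \<le> Sup P - Inf P"
proof -
  have bd: "bdd_below P" "bdd_above P" using P(3) by (auto simp: bounded_imp_bdd_below bounded_imp_bdd_above)
  have "P \<subseteq> {Inf P..Sup P}" using bd by (auto intro: cInf_lower cSup_upper)
  moreover have "Inf P \<le> Sup P" using P(2) bd by (intro cInf_le_cSup)
  ultimately show ?thesis using measure_mono_fmeasurable[of P "{Inf P..Sup P}" lebesgue] interval_measurable(2)[OF P(1)] by auto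
qed

text \<open>\<open>P\<close> may lack its end points, while the distortion bound of a branch is
  stated for end points in its domain. Moving in by a quarter of the length at each side, and out
  again to include x and y, keeps at least half the length.\<close>

lemma interval_exhaust:
  assumes P: "is_interval P" "bounded P" and p: "0 < measure lebesgue P" and xy: "x \<in> P" "y \<in> P"
  shows "\<exists>u\<in>P. \<exists>v\<in>P. measure lebesgue P / 2 \<le> v - u \<and> x \<in> {u..v} \<and> y \<in> {u..v}"
proof -
  let ?p = "measure lebesgue P"
  have ne: "P \<noteq> {}" using xy by auto
  have bd: "bdd_below P" "bdd_above P" using P(2) by (auto simp: bounded_imp_bdd_below bounded_imp_bdd_above)
  obtain u where u: "u \<in> P" "u < Inf P + ?p / 4" using cInf_lessD[OF ne, of "Inf P + ?p / 4"] p by auto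
  obtain v where v: "v \<in> P" "Sup P - ?p / 4 < v" using less_cSupD[OF ne, of "Sup P - ?p / 4"] p by auto
  let ?u = "min u (min x y)" and ?v = "max v (max x y)"
  have "?u \<in> P" "?v \<in> P" using u v xy by (auto simp: min_def max_def)
  moreover have "?p / 2 \<le> ?v - ?u" using u v interval_measure_le[OF P(1) ne P(2)] by linarith
  moreover have "x \<in> {?u..?v}" "y \<in> {?u..?v}" by auto
  ultimately show ?thesis by blast
qed

context besov_scale
begin

lemma avg_close:
  assumes i: "i < 2 ^ k" and g: "integrable M g" and d: "\<And>x. x \<in> cell k i \<Longrightarrow> cmod (g x - z) \<le> \<delta>"
  shows "cmod (avg k i g - z) \<le> \<delta>"
proof -
  have const: "integrable M (\<lambda>x. z)"
    by (rule finite_measure.integrable_const[OF finite_measure_lebesgue_on]) simp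
  then have "cint k i (\<lambda>x. g x - z) = cint k i g - cint k i (\<lambda>x. z)"
    using cint_linear[OF _ g i, of "\<lambda>x. z" "-1"] by simp
  moreover have "cint k i (\<lambda>x. z) = len k * z"
    using avg_const[OF i, of "\<lambda>x. z" z] by (simp add: avg_def field_simps)
  ultimately have "avg k i g - z = cint k i (\<lambda>x. g x - z) / len k" by (simp add: avg_def diff_divide_distrib)
  moreover have "cmod (cint k i (\<lambda>x. g x - z)) \<le> len k * \<delta>"
  proof -
    have "cmod (cint k i (\<lambda>x. g x - z)) \<le> (LINT x|M. norm (indicator (cell k i) x *\<^sub>R (g x - z)))"
      unfolding cint_def by (rule integral_norm_bound)
    also have "\<dots> \<le> (LINT x|M. indicator (cell k i) x * \<delta>)"
    proof (rule integral_mono)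
      show "integrable M (\<lambda>x. norm (indicator (cell k i) x *\<^sub>R (g x - z)))"
        using g const by (intro integrable_norm integrable_cell i) auto
      show "integrable M (\<lambda>x. indicator (cell k i) x * \<delta>)" using integral_cell(2)[OF i] by simp
      show "norm (indicator (cell k i) x *\<^sub>R (g x - z)) \<le> indicator (cell k i) x * \<delta>" for x
        using d[of x] by (auto simp: indicator_def)
    qed
    finally have "cmod (cint k i (\<lambda>x. g x - z)) \<le> (LINT x|M. indicator (cell k i) x * \<delta>)" .
    then show ?thesis using integral_cell[OF i] by simp
  qed
  ultimately show ?thesis by (simp add: norm_divide divide_le_eq mult.commute)
qed

lemma incr_le:
  assumes i: "i < 2 ^ Suc k" and g: "integrable M g"
    and d: "\<And>x y. x \<in> cell k (i div 2) \<Longrightarrow> y \<in> cell k (i div 2) \<Longrightarrow> cmod (g x - g y) \<le> \<delta>"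
  shows "cmod (incr (Suc k) i g) \<le> 2 * \<delta>"
proof -
  let ?x = "a + real i * len (Suc k)"
  have x: "?x \<in> cell (Suc k) i" by (simp add: cell_alt distrib_right)
  note x' = cell_parent[OF x]
  have "cmod (avg (Suc k) i g - g ?x) \<le> \<delta>" using cell_parent x' d by (intro avg_close i g) blast
  moreover have "cmod (avg k (i div 2) g - g ?x) \<le> \<delta>" using x' d i by (intro avg_close g) auto
  ultimately have "cmod ((avg (Suc k) i g - g ?x) - (avg k (i div 2) g - g ?x)) \<le> \<delta> + \<delta>"
    using norm_triangle_ineq4[of "avg (Suc k) i g - g ?x" "avg k (i div 2) g - g ?x"] by linarith
  then show ?thesis by (simp add: incr_def)
qed

text \<open>An increment compares two averages over parts of the parent cell, each within the
  oscillation of any value there, and each parent has two children; hence the factor 4.\<close>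

lemma lev_le_osc:
  assumes g: "integrable M g"
    and d: "\<And>v x y. v < 2 ^ k \<Longrightarrow> x \<in> cell k v \<Longrightarrow> y \<in> cell k v \<Longrightarrow> cmod (g x - g y) \<le> \<delta> v"
  shows "lev g (Suc k) \<le> 4 * (\<Sum>v<2^k. \<delta> v) * len (Suc k) powr (1 - s)"
proof -
  have "lev g (Suc k) = (\<Sum>i<2^Suc k. cmod (incr (Suc k) i g)) * len (Suc k) powr (1 - s)"
    by (simp add: lev_def mcoef_def norm_mult sum_distrib_right)
  also have "\<dots> \<le> (\<Sum>i<2^Suc k. 2 * \<delta> (i div 2)) * len (Suc k) powr (1 - s)"
  proof (intro mult_right_mono sum_mono)
    fix i :: nat assume i: "i \<in> {..<2 ^ Suc k}"
    then have "i div 2 < 2 ^ k" by auto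
    then show "cmod (incr (Suc k) i g) \<le> 2 * \<delta> (i div 2)" using i d by (intro incr_le g) auto
  qed auto
  also have "(\<Sum>i<2^Suc k. 2 * \<delta> (i div 2)) = 4 * (\<Sum>v<2^k. \<delta> v)"
    using sum_parent[of "\<lambda>v. 2 * \<delta> v" k] by (simp add: sum_distrib_left)
  finally show ?thesis .
qed

lemma sum_cells_inside_le:
  assumes P: "is_interval P" "P \<subseteq> {a..b}"
  shows "real (card {v. v < 2 ^ k \<and> cell k v \<subseteq> P}) * len k \<le> measure lebesgue P"
proof -
  let ?A = "{v. v < 2 ^ k \<and> cell k v \<subseteq> P}"
  have Pm: "P \<in> lmeasurable"
    using P bounded_subset[OF bounded_closed_interval P(2)] interval_measurable(2)[OF P(1)]
    by (intro bounded_set_imp_lmeasurable) auto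
  have "real (card ?A) * len k = (\<Sum>v\<in>?A. measure lebesgue (cell k v))" by (simp add: cell_measure)
  also have "\<dots> = measure lebesgue (\<Union>v\<in>?A. cell k v)"
  proof (rule measure_UNION'[symmetric])
    show "pairwise (\<lambda>i j. disjnt (cell k i) (cell k j)) ?A"
      using cell_unique by (auto simp: pairwise_def disjnt_def)
  qed (auto simp: cell_def intro!: bounded_set_imp_lmeasurable)
  also have "\<dots> \<le> measure lebesgue P"
    using Pm by (intro measure_mono_fmeasurable) (auto simp: cell_def intro!: sets.finite_UN)
  finally show ?thesis .
qed

text \<open>The first bound is the L1 bound. It implies the second when \<open>P\<close> is no
  longer than a cell of level j. For longer \<open>P\<close>, the cells inside \<open>P\<close> are
  at most \<open>p\<close> over their length in number and have small oscillation, while at most two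
  cells straddle the boundary, where the oscillation is bounded by the size of the weight.\<close>

lemma weighted_interval_lev:
  fixes w :: "real \<Rightarrow> real"
  assumes P: "is_interval P" "P \<subseteq> {a..b}" and p: "0 < p" "p = measure lebesgue P"
    and w: "\<And>x. x \<in> P \<Longrightarrow> 0 \<le> w x" "integrable M (\<lambda>x. w x * indicator P x)"
    and m: "m = (LINT x|M. w x * indicator P x)"
    and osc: "\<And>x y. x \<in> P \<Longrightarrow> y \<in> P \<Longrightarrow> \<bar>w x - w y\<bar> \<le> C * (m / p) * (\<bar>x - y\<bar> / p) powr \<beta>"
    and C: "0 \<le> C" and A: "0 \<le> A" and \<beta>: "0 < \<beta>" "\<beta> < 1"
  defines "g \<equiv> \<lambda>x. complex_of_real (A * (w x * indicator P x))"
  shows "lev g j \<le> 2 * len j powr (- s) * A * m"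
    and "lev g j \<le> 12 * (1 + C) * A * m * p powr (- \<beta>) * len j powr (\<beta> - s)"
proof -
  have gi: "integrable M g" unfolding g_def by (intro integrable_of_real integrable_mult_right w(2))
  have wn: "0 \<le> w x * indicator P x" for x using w(1) by (simp add: indicator_def)
  have m0: "0 \<le> m" unfolding m using wn by (intro integral_nonneg_AE) auto
  have "cmod (g x) = A * (w x * indicator P x)" for x
    unfolding g_def norm_of_real using wn[of x] A by simp
  then have l1g: "l1 g = A * m"
    unfolding l1_def m by simp
  show B1: "lev g j \<le> 2 * len j powr (- s) * A * m"
    using lev_le_l1[OF gi, of j] by (simp add: l1g mult.assoc)
  have bdP: "bounded P" using bounded_subset[OF bounded_closed_interval P(2)] .
  have xy: "\<bar>x - y\<bar> \<le> p" if "x \<in> P" "y \<in> P" for x y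
    using interval_length_le_measure[OF P(1) bdP that] p by simp
  have Pm: "P \<in> lmeasurable"
    using bdP interval_measurable(2)[OF P(1)] by (intro bounded_set_imp_lmeasurable) auto
  have PM: "P \<in> sets M" using P interval_measurable(2)[OF P(1)] by (auto simp: sets_restrict_space_iff)
  have "measure M P = p" using P(2) p(2) by (simp add: measure_restrict_space)
  moreover have "P \<inter> {a..b} = P" using P(2) by auto
  ultimately have intP: "(LINT x|M. indicator P x) = p" by simp
  have "emeasure M P < \<infinity>"
    using Pm P(2) by (subst emeasure_restrict_space) (auto simp: fmeasurable_def)
  then have intP': "integrable M (indicator P :: real \<Rightarrow> real)" using PM by (intro integrable_real_indicator)
  have osc': "\<bar>w x - w y\<bar> \<le> C * (m / p)" if "x \<in> P" "y \<in> P" for x y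
  proof -
    have "(\<bar>x - y\<bar> / p) powr \<beta> \<le> 1" using xy[OF that] p \<beta> by (intro powr_le1) (auto simp: divide_le_eq_1)
    then have "C * (m / p) * (\<bar>x - y\<bar> / p) powr \<beta> \<le> C * (m / p) * 1"
      using C m0 p by (intro mult_left_mono) auto
    then show ?thesis using osc[OF that] by linarith
  qed
  \<comment> \<open>Integrating \<open>w x - C * (m / p) \<le> w y\<close> over y in
    \<open>P\<close> bounds the weight pointwise by its mean.\<close>
  have wle: "w x \<le> (1 + C) * (m / p)" if x: "x \<in> P" for x
  proof -
    have "(LINT y|M. (w x - C * (m / p)) * indicator P y) \<le> (LINT y|M. w y * indicator P y)"
    proof (rule integral_mono)
      show "integrable M (\<lambda>y. (w x - C * (m / p)) * indicator P y)" using intP' by simp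
      show "(w x - C * (m / p)) * indicator P y \<le> w y * indicator P y" for y
        using osc'[OF x, of y] by (auto simp: indicator_def)
    qed (rule w(2))
    then have "(w x - C * (m / p)) * p \<le> m" using intP m by simp
    then have "w x - C * (m / p) \<le> m / p" using p(1) by (simp add: le_divide_eq)
    moreover have "(1 + C) * (m / p) = m / p + C * (m / p)" by (simp only: distrib_right mult_1)
    ultimately show ?thesis by linarith
  qed
  show "lev g j \<le> 12 * (1 + C) * A * m * p powr (- \<beta>) * len j powr (\<beta> - s)"
  proof (cases "p \<le> len j")
    case True
    have "1 \<le> (len j / p) powr \<beta>" using True p \<beta> by (intro ge_one_powr_ge_zero) auto
    then have "2 * len j powr (- s) * A * m * 1 \<le> 2 * len j powr (- s) * A * m * (len j / p) powr \<beta>"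
      using A m0 by (intro mult_left_mono) auto
    also have "(len j / p) powr \<beta> = len j powr \<beta> * p powr (- \<beta>)"
      using p(1) by (simp add: powr_divide powr_minus_divide)
    also have "2 * len j powr (- s) * A * m * (len j powr \<beta> * p powr (- \<beta>)) = 2 * (A * m * p powr (- \<beta>) * len j powr (\<beta> - s))"
      using powr_add[of "len j" "- s" \<beta>] by simp
    also have "\<dots> \<le> (12 * (1 + C)) * (A * m * p powr (- \<beta>) * len j powr (\<beta> - s))"
      using C A m0 by (intro mult_right_mono) auto
    finally show ?thesis using B1 by (simp add: mult_ac)
  next
    case False
    have "p \<le> len 0"
    proof -
      have "measure lebesgue P \<le> measure lebesgue {a..b}" using P(2) Pm by (intro measure_mono_fmeasurable) auto
      then show ?thesis using ab p by (simp add: len_def)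
    qed
    then obtain k where j: "j = Suc k" using False by (cases j) auto
    \<comment> \<open>With \<open>c < 1\<close> and \<open>\<beta> < 1\<close>, the factor
      \<open>c powr \<beta> / c\<close> is at least 1 and absorbs the two boundary cells. Interior
      cells contribute once this factor and boundary cells twice, which with the 4 of
      \<open>lev_le_osc\<close> makes 12. Parent cells have length \<open>2 * c * p\<close>.\<close>
    define c where "c = len j / p"
    have c: "0 < c" "c < 1" using False p by (auto simp: c_def)
    have lk: "len k = 2 * len j" by (simp add: j len_Suc)
    let ?I = "{v. v < 2 ^ k \<and> cell k v \<subseteq> P}"
    let ?B = "{v \<in> {..<2 ^ k}. cell k v \<inter> P \<noteq> {} \<and> \<not> cell k v \<subseteq> P}"
    define W where "W = A * (1 + C) * (m / p)"
    have W0: "0 \<le> W" using A C m0 p by (simp add: W_def)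
    define \<delta> where "\<delta> v = (if v \<in> ?I then W * (2 * c powr \<beta>) else if v \<in> ?B then W else 0)" for v
    have two: "(2 * c) powr \<beta> \<le> 2 * c powr \<beta>"
    proof -
      have "2 powr \<beta> \<le> 2 powr (1::real)" using \<beta> by (intro powr_mono) auto
      then show ?thesis using c by (simp add: powr_mult mult_right_mono)
    qed
    have "lev g (Suc k) \<le> 4 * (\<Sum>v<2^k. \<delta> v) * len (Suc k) powr (1 - s)"
    proof (rule lev_le_osc[OF gi])
      fix v x y assume v: "v < 2 ^ k" and x: "x \<in> cell k v" and y: "y \<in> cell k v"
      have gxy: "cmod (g x - g y) = A * \<bar>w x * indicator P x - w y * indicator P y\<bar>"
        unfolding g_def of_real_diff[symmetric] norm_of_real using A by (simp add: abs_mult flip: right_diff_distrib)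
      consider "v \<in> ?I" | "v \<notin> ?I" "v \<in> ?B" | "cell k v \<inter> P = {}" using v by blast
      then show "cmod (g x - g y) \<le> \<delta> v"
      proof cases
        case 1
        then have xyP: "x \<in> P" "y \<in> P" using x y by auto
        have "\<bar>x - y\<bar> \<le> len k" using x y by (auto simp: cell_alt distrib_right)
        then have "(\<bar>x - y\<bar> / p) powr \<beta> \<le> (2 * c) powr \<beta>"
          using p \<beta> by (intro powr_mono2) (auto simp: lk c_def divide_right_mono)
        also note two
        finally have "C * (m / p) * (\<bar>x - y\<bar> / p) powr \<beta> \<le> (1 + C) * (m / p) * (2 * c powr \<beta>)"
          using C m0 p by (intro mult_mono) auto
        then have "\<bar>w x - w y\<bar> \<le> (1 + C) * (m / p) * (2 * c powr \<beta>)" using osc[OF xyP] by linarith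
        then have "A * \<bar>w x - w y\<bar> \<le> A * ((1 + C) * (m / p) * (2 * c powr \<beta>))" using A by (intro mult_left_mono)
        then show ?thesis using 1 xyP unfolding gxy \<delta>_def W_def by (simp add: mult.assoc)
      next
        case 2
        have b: "0 \<le> w z * indicator P z \<and> w z * indicator P z \<le> (1 + C) * (m / p)" for z
          using w(1)[of z] wle[of z] C m0 p by (auto simp: indicator_def)
        have "\<bar>w x * indicator P x - w y * indicator P y\<bar> \<le> (1 + C) * (m / p)"
          using b[of x] b[of y] by linarith
        then have "A * \<bar>w x * indicator P x - w y * indicator P y\<bar> \<le> A * ((1 + C) * (m / p))" using A by (intro mult_left_mono)
        then show ?thesis using 2 unfolding gxy \<delta>_def W_def by (simp add: mult.assoc)
      next
        case 3
        then have "x \<notin> P" "y \<notin> P" using x y by auto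
        moreover have "0 \<le> \<delta> v" using W0 by (simp add: \<delta>_def)
        ultimately show ?thesis unfolding gxy by simp
      qed
    qed
    also have "(\<Sum>v<2^k. \<delta> v) \<le> W * c powr \<beta> / c + 2 * (W * c powr \<beta> / c)"
    proof -
      have "(\<Sum>v<2^k. \<delta> v) \<le> (\<Sum>v<2^k. (if v \<in> ?I then W * (2 * c powr \<beta>) else 0) + (if v \<in> ?B then W else 0))"
        using W0 by (intro sum_mono) (auto simp: \<delta>_def)
      also have "\<dots> = real (card ?I) * (W * (2 * c powr \<beta>)) + real (card ?B) * W"
      proof -
        have "{..<2 ^ k} \<inter> ?I = ?I" "{..<2 ^ k} \<inter> ?B = ?B" by auto
        then show ?thesis by (simp only: sum.distrib sum.If_cases[OF finite_lessThan] Collect_mem_eq) simp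
      qed
      also have "\<dots> \<le> W * c powr \<beta> / c + 2 * (W * c powr \<beta> / c)"
      proof (rule add_mono)
        have "real (card ?I) * (2 * c) \<le> 1"
          using sum_cells_inside_le[OF P, of k] p by (simp add: c_def lk divide_le_eq mult_ac)
        then have "real (card ?I) * (2 * c) * (W * c powr \<beta>) \<le> 1 * (W * c powr \<beta>)"
          using W0 by (intro mult_right_mono) auto
        then show "real (card ?I) * (W * (2 * c powr \<beta>)) \<le> W * c powr \<beta> / c"
          using c by (simp add: le_divide_eq mult_ac)
        have "card ?B \<le> 2"
        proof (rule card_boundary_le_2[OF _ _ P(1) bdP])
          show "is_interval (cell k i)" for i by (simp add: cell_def is_interval_1)
          show "i = j" if "x \<in> cell k i" "x \<in> cell k j" for i j x using cell_unique that by blast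
        qed
        then have "real (card ?B) \<le> 2" by simp
        moreover have "1 \<le> c powr \<beta> / c"
        proof -
          have "c powr 1 \<le> c powr \<beta>" using c \<beta> by (intro powr_mono') auto
          then show ?thesis using c by (simp add: le_divide_eq)
        qed
        then have "W * 1 \<le> W * (c powr \<beta> / c)" using W0 by (intro mult_left_mono)
        ultimately show "real (card ?B) * W \<le> 2 * (W * c powr \<beta> / c)"
          using mult_mono[of "real (card ?B)" 2 W "W * (c powr \<beta> / c)"] W0 by simp
      qed
      finally show ?thesis .
    qed
    finally have "lev g j \<le> 4 * (W * c powr \<beta> / c + 2 * (W * c powr \<beta> / c)) * len j powr (1 - s)"
      unfolding j by (simp add: mult_right_mono)
    also have "\<dots> = 12 * (W * c powr \<beta> / c * len j powr (1 - s))" by simp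
    also have "W * c powr \<beta> / c * len j powr (1 - s) = (1 + C) * A * m * p powr (- \<beta>) * len j powr (\<beta> - s)"
      using p(1) len_pos[of j] unfolding W_def c_def
      by (simp add: powr_divide powr_diff powr_minus field_simps)
    finally show ?thesis by (simp only: mult.assoc)
  qed
qed

end

section \<open>Transferred atoms\<close>

context besov_scale
begin

section \<open>Change of variables along a branch\<close>

lemma set_integrable_M:
  fixes F :: "real \<Rightarrow> 'e::{banach, second_countable_topology}"
  assumes K: "K \<subseteq> {a..b}"
  shows "integrable M (\<lambda>x. indicator K x *\<^sub>R F x) \<longleftrightarrow> set_integrable lebesgue K F"
    and "(LINT x|M. indicator K x *\<^sub>R F x) = (LINT x:K|lebesgue. F x)"
proof -
  have eq: "indicator {a..b} x *\<^sub>R (indicator K x *\<^sub>R F x) = indicator K x *\<^sub>R F x" for x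
    using K by (auto simp: indicator_def)
  show "integrable M (\<lambda>x. indicator K x *\<^sub>R F x) \<longleftrightarrow> set_integrable lebesgue K F"
    by (subst integrable_restrict_space) (simp_all add: eq set_integrable_def del: scaleR_scaleR)
  show "(LINT x|M. indicator K x *\<^sub>R F x) = (LINT x:K|lebesgue. F x)"
    by (subst integral_restrict_space) (simp_all add: eq set_lebesgue_integral_def del: scaleR_scaleR)
qed

lemma branch_change_of_variables:
  fixes F :: "real \<Rightarrow> 'e::euclidean_space"
  assumes b: "branch \<beta> C K h" and K: "K \<subseteq> {a..b}" "h ` K \<subseteq> {a..b}" and F: "integrable M F"
  shows "integrable M (\<lambda>x. indicator K x *\<^sub>R (\<bar>deriv h x\<bar> *\<^sub>R F (h x)))"
    and "(LINT x|M. indicator K x *\<^sub>R (\<bar>deriv h x\<bar> *\<^sub>R F (h x))) = (LINT x|M. indicator (h ` K) x *\<^sub>R F x)"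
    and "h ` K \<in> sets M"
proof -
  have "is_interval (h ` K)"
    using branchD(2)[OF b] branch_continuous[OF b]
    by (simp add: is_interval_connected_1 connected_continuous_image)
  then show hK: "h ` K \<in> sets M"
    using K(2) interval_measurable(2) by (auto simp: sets_restrict_space_iff)
  have fi: "set_integrable lebesgue (h ` K) F"
    using set_integrable_M(1)[OF K(2), of F] integrable_mult_indicator[OF hK F] by simp
  have der: "(h has_real_derivative deriv h x) (at x within K)" if "x \<in> K" for x
    using branchD(5)[OF b that] by (rule has_field_derivative_at_within)
  have Kl: "K \<in> sets lebesgue" using interval_measurable(2)[OF branchD(2)[OF b]] .
  have cv: "(\<lambda>x. \<bar>deriv h x\<bar> *\<^sub>R F (h x)) absolutely_integrable_on K \<and>
    integral K (\<lambda>x. \<bar>deriv h x\<bar> *\<^sub>R F (h x)) = integral (h ` K) F"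
    using fi by (subst has_absolute_integral_change_of_variables_real[OF Kl der branchD(3)[OF b]]) auto
  then show "integrable M (\<lambda>x. indicator K x *\<^sub>R (\<bar>deriv h x\<bar> *\<^sub>R F (h x)))"
    using set_integrable_M(1)[OF K(1), of "\<lambda>x. \<bar>deriv h x\<bar> *\<^sub>R F (h x)"] by simp
  have "(LINT x:K|lebesgue. \<bar>deriv h x\<bar> *\<^sub>R F (h x)) = (LINT x:h ` K|lebesgue. F x)"
    using cv fi by (simp add: set_lebesgue_integral_eq_integral)
  then show "(LINT x|M. indicator K x *\<^sub>R (\<bar>deriv h x\<bar> *\<^sub>R F (h x))) = (LINT x|M. indicator (h ` K) x *\<^sub>R F x)"
    using set_integrable_M(2)[OF K(1), of "\<lambda>x. \<bar>deriv h x\<bar> *\<^sub>R F (h x)"] set_integrable_M(2)[OF K(2), of F] by simp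
qed

lemma branch_integral_piece:
  assumes b: "branch \<beta> C K h" and K: "K \<subseteq> {a..b}" "h ` K \<subseteq> {a..b}" and Q: "is_interval Q" "Q \<subseteq> {a..b}"
  shows "integrable M (\<lambda>x. \<bar>deriv h x\<bar> * indicator {x \<in> K. h x \<in> Q} x)"
    and "(LINT x|M. \<bar>deriv h x\<bar> * indicator {x \<in> K. h x \<in> Q} x) = measure lebesgue (h ` K \<inter> Q)"
proof -
  have Qs: "Q \<in> sets M" using Q interval_measurable(2)[OF Q(1)] by (auto simp: sets_restrict_space_iff)
  interpret finite_measure M by (rule finite_measure_lebesgue_on) simp
  have FQ: "integrable M (indicator Q :: real \<Rightarrow> real)" using Qs by (intro integrable_real_indicator) (auto simp: less_top[symmetric])
  note cv = branch_change_of_variables[OF b K FQ]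
  have eq: "indicator K x *\<^sub>R (\<bar>deriv h x\<bar> *\<^sub>R indicator Q (h x)) = \<bar>deriv h x\<bar> * (indicator {x \<in> K. h x \<in> Q} x :: real)" for x
    by (simp add: indicator_def)
  show "integrable M (\<lambda>x. \<bar>deriv h x\<bar> * indicator {x \<in> K. h x \<in> Q} x)" using cv(1) unfolding eq .
  have "(LINT x|M. \<bar>deriv h x\<bar> * indicator {x \<in> K. h x \<in> Q} x) = (LINT x|M. indicator (h ` K \<inter> Q) x)"
    using cv(2) unfolding eq by (simp add: indicator_inter_arith)
  also have "\<dots> = measure M (h ` K \<inter> Q)" using K(2) by (simp add: Int_absorb2 inf.coboundedI1)
  also have "\<dots> = measure lebesgue (h ` K \<inter> Q)"
    using K(2) by (intro measure_restrict_space) auto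
  finally show "(LINT x|M. \<bar>deriv h x\<bar> * indicator {x \<in> K. h x \<in> Q} x) = measure lebesgue (h ` K \<inter> Q)" .
qed

text \<open>Here \<open>z\<close> is the level of the atom minus the level observed. The first bound
  comes from the L1 norm and decays for large \<open>z\<close>; the second comes from the
  oscillation of the derivative and decays for small \<open>z\<close>.\<close>

definition ker :: "real \<Rightarrow> real \<Rightarrow> int \<Rightarrow> real" where
  "ker \<beta> E z = min (2 * 2 powr (- s * real_of_int z)) (12 * E * 2 powr ((\<beta> - s) * real_of_int z))"

lemma ker_nonneg: "0 \<le> E \<Longrightarrow> 0 \<le> ker \<beta> E z" by (simp add: ker_def)

text \<open>Two geometric series, one for each side of the crossing of the bounds in
  \<open>ker\<close>. The extra \<open>2 powr s\<close> pays for rounding the crossing point down to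
  an integer.\<close>

definition C2 :: "real \<Rightarrow> real" where
  "C2 \<beta> = 2 * 2 powr s / (1 - 2 powr (- s)) + 12 / (1 - 2 powr (- (\<beta> - s)))"

text \<open>The two bounds in \<open>ker\<close> cross where \<open>2 powr z = E powr (- 1 / \<beta>)\<close>;
  both decay geometrically away from the crossing, where they are of size \<open>E powr (s / \<beta>)\<close>.\<close>

lemma sum_ker_le:
  assumes \<beta>: "s < \<beta>" and E: "0 < E" and F: "finite F"
  shows "(\<Sum>z\<in>F. ker \<beta> E z) \<le> C2 \<beta> * E powr (s / \<beta>)"
proof -
  define z0 where "z0 = - log 2 E / \<beta>"
  define n where "n = \<lfloor>z0\<rfloor>"
  have n: "real_of_int n \<le> z0" "z0 < real_of_int n + 1" by (auto simp: n_def)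
  have b0: "0 < \<beta>" using \<beta> s by simp
  have E': "E = 2 powr (- \<beta> * z0)" using E b0 by (simp add: z0_def)
  define e where "e = E powr (s / \<beta>)"
  have e: "e = 2 powr (- s * z0)" using b0 by (simp add: e_def E' powr_powr mult.commute)
  let ?r = "2 powr (- s) :: real" and ?t = "2 powr (- (\<beta> - s)) :: real"
  have r: "0 \<le> ?r" "?r < 1" "0 \<le> ?t" "?t < 1" using \<beta> s by (auto simp: powr_less_one)
  let ?u = "\<lambda>z. if 0 \<le> z - n then ?r ^ nat (z - n) else 0" and ?v = "\<lambda>z. if 0 \<le> n - z then ?t ^ nat (n - z) else 0"
  have pw: "x ^ nat z = x powr real_of_int z" if "0 \<le> z" "0 < x" for x :: real and z :: int
    using that by (simp add: powr_int)
  have pt: "ker \<beta> E z \<le> e * (2 * 2 powr s * ?u z + 12 * ?v z)" for z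
  proof (cases "z0 \<le> real_of_int z")
    case True
    then have zn: "0 \<le> z - n" using n by linarith
    have "ker \<beta> E z \<le> 2 * 2 powr (- s * real_of_int z)" by (simp add: ker_def)
    also have "2 powr (- s * real_of_int z) \<le> e * 2 powr s * ?r ^ nat (z - n)"
    proof -
      have "e * 2 powr s * ?r ^ nat (z - n) = 2 powr (- s * z0 + s + (- s) * real_of_int (z - n))"
        using zn by (simp add: pw e powr_powr powr_add[symmetric] algebra_simps)
      moreover have "- s * real_of_int z \<le> - s * z0 + s + (- s) * real_of_int (z - n)"
      proof -
        have "0 \<le> s * (1 + real_of_int n - z0)" using s n by (intro mult_nonneg_nonneg) auto
        then show ?thesis by (simp add: algebra_simps)
      qed
      ultimately show ?thesis by simp
    qed
    finally have "ker \<beta> E z \<le> e * (2 * 2 powr s * ?u z)" using zn by (simp add: mult_ac)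
    moreover have "0 \<le> e * (12 * ?v z)" using r by (simp add: e)
    ultimately show ?thesis by (simp add: distrib_left)
  next
    case False
    then have zn: "0 \<le> n - z" unfolding n_def by linarith
    have "ker \<beta> E z \<le> 12 * (E * 2 powr ((\<beta> - s) * real_of_int z))" by (simp add: ker_def)
    also have "E * 2 powr ((\<beta> - s) * real_of_int z) \<le> e * ?t ^ nat (n - z)"
    proof -
      have "E * 2 powr ((\<beta> - s) * real_of_int z) = 2 powr (- \<beta> * z0 + (\<beta> - s) * real_of_int z)"
        by (simp add: E' powr_add[symmetric])
      also have "\<dots> \<le> 2 powr (- s * z0 + (- (\<beta> - s)) * real_of_int (n - z))"
      proof -
        have "0 \<le> (\<beta> - s) * (z0 - real_of_int n)" using \<beta> n by (intro mult_nonneg_nonneg) auto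
        then show ?thesis by (simp add: algebra_simps)
      qed
      also have "\<dots> = e * ?t ^ nat (n - z)" using zn by (simp add: pw e powr_powr powr_add[symmetric])
      finally show ?thesis .
    qed
    finally have "ker \<beta> E z \<le> e * (12 * ?v z)" using zn by (simp add: mult_ac)
    moreover have "0 \<le> e * (2 * 2 powr s * ?u z)" using r by (simp add: e)
    ultimately show ?thesis by (simp add: distrib_left)
  qed
  have su: "(\<Sum>z\<in>F. ?u z) \<le> 1 / (1 - ?r)"
  proof -
    have "(\<Sum>z\<in>F. ?u z) = (\<Sum>w\<in>(\<lambda>z. z - n) ` F. if 0 \<le> w then ?r ^ nat w else 0)"
      by (subst sum.reindex) (auto simp: inj_on_def)
    also have "\<dots> \<le> 1 / (1 - ?r)" using r F by (intro sum_geometric_int_le) auto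
    finally show ?thesis .
  qed
  have sv: "(\<Sum>z\<in>F. ?v z) \<le> 1 / (1 - ?t)"
  proof -
    have "(\<Sum>z\<in>F. ?v z) = (\<Sum>w\<in>(\<lambda>z. n - z) ` F. if 0 \<le> w then ?t ^ nat w else 0)"
      by (subst sum.reindex) (auto simp: inj_on_def)
    also have "\<dots> \<le> 1 / (1 - ?t)" using r F by (intro sum_geometric_int_le) auto
    finally show ?thesis .
  qed
  have "(\<Sum>z\<in>F. ker \<beta> E z) \<le> (\<Sum>z\<in>F. e * (2 * 2 powr s * ?u z + 12 * ?v z))" by (intro sum_mono pt)
  also have "\<dots> = e * (2 * 2 powr s * (\<Sum>z\<in>F. ?u z) + 12 * (\<Sum>z\<in>F. ?v z))"
    by (simp only: sum_distrib_left sum.distrib distrib_left mult.assoc)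
  also have "\<dots> \<le> e * (2 * 2 powr s * (1 / (1 - ?r)) + 12 * (1 / (1 - ?t)))"
    using su sv by (intro mult_left_mono add_mono) (auto simp: e)
  also have "\<dots> = C2 \<beta> * e" by (simp add: C2_def)
  finally show ?thesis by (simp add: e_def)
qed

lemma len_ratio: "len k powr t * len j powr (- t) = 2 powr (- t * real_of_int (int k - int j))"
proof -
  have l: "len k = (b - a) * 2 powr (- real k)" for k
    by (simp add: len_def powr_minus powr_realpow divide_inverse)
  have "len k powr t * len j powr (- t) = ((b - a) powr t * (b - a) powr (- t)) * (2 powr (- real k * t) * 2 powr (- real j * (- t)))"
    using ab by (simp add: l powr_mult powr_powr)
  also have "(b - a) powr t * (b - a) powr (- t) = 1" using ab by (simp add: powr_minus)
  also have "2 powr (- real k * t) * 2 powr (- real j * (- t)) = (2::real) powr (- t * real_of_int (int k - int j))"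
    by (simp add: powr_add[symmetric] algebra_simps)
  finally show ?thesis by simp
qed

text \<open>The contribution of one inverse branch to the transferred atom of
  \<open>cell k i\<close>.\<close>

definition piece :: "real set \<Rightarrow> (real \<Rightarrow> real) \<Rightarrow> nat \<Rightarrow> nat \<Rightarrow> cfun" where
  "piece K h k i x = complex_of_real (len k powr (s - 1) * (\<bar>deriv h x\<bar> * indicator {x \<in> K. h x \<in> cell k i} x))"

lemma cell_interval: "is_interval (cell k i)" by (simp add: cell_def is_interval_1)

lemma integrable_piece:
  assumes b: "branch \<beta> C K h" and K: "K \<subseteq> {a..b}" "h ` K \<subseteq> {a..b}" and i: "i < 2 ^ k"
  shows "integrable M (piece K h k i)"
proof -
  have "cell k i \<subseteq> {a..b}" using cell_subset[OF i] by auto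
  then show ?thesis unfolding piece_def[abs_def]
    by (intro integrable_of_real integrable_mult_right branch_integral_piece(1)[OF b K cell_interval])
qed

text \<open>In \<open>dist\<close>, p stands for the length of the preimage of the cell and m for
  the mass of \<open>|h'|\<close> on it, so that m / p is the mean. The parameter \<open>E\<close>
  may be reached in two ways: by a mean small enough to pay for the distortion constant, or by
  relative distortion at most 1 on pieces of that length.\<close>

lemma piece_lev:
  assumes b: "branch \<beta> C K h" and K: "K \<subseteq> {a..b}" "h ` K \<subseteq> {a..b}" and i: "i < 2 ^ k"
    and \<mu>: "\<And>x. x \<in> K \<Longrightarrow> \<bar>deriv h x\<bar> \<le> \<mu>" "0 \<le> \<mu>" and \<beta>: "0 < \<beta>" "\<beta> < 1"
    and E: "0 < E"
    and dist: "\<And>p m. 0 < p \<Longrightarrow> 0 \<le> m \<Longrightarrow> m \<le> len k \<Longrightarrow> m / p \<le> \<mu> \<Longrightarrow>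
        (1 + 4 * C) * (m / p) powr \<beta> \<le> E \<or>
        2 * (m / p) powr \<beta> \<le> E \<and> (\<forall>x\<in>K. \<forall>y\<in>K. \<bar>x - y\<bar> \<le> p \<longrightarrow>
           \<bar>\<bar>deriv h x\<bar> - \<bar>deriv h y\<bar>\<bar> \<le> (m / p) * (\<bar>x - y\<bar> / p) powr \<beta>)"
  shows "lev (piece K h k i) j \<le> ker \<beta> E (int k - int j)"
proof -
  define P where "P = {x \<in> K. h x \<in> cell k i}"
  have cs: "cell k i \<subseteq> {a..b}" using cell_subset[OF i] by auto
  note C0 = branchD(4)[OF b]
  have PI: "is_interval P" unfolding P_def by (rule branch_preimage_interval[OF b cell_interval])
  have Pab: "P \<subseteq> {a..b}" using K by (auto simp: P_def)
  have bdP: "bounded P" using bounded_subset[OF bounded_closed_interval Pab] .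
  have Pm: "P \<in> lmeasurable" using bdP interval_measurable(2)[OF PI] by (intro bounded_set_imp_lmeasurable)
  define p where "p = measure lebesgue P"
  define m where "m = (LINT x|M. \<bar>deriv h x\<bar> * indicator P x)"
  note BI = branch_integral_piece[OF b K cell_interval cs, folded P_def]
  have m0: "0 \<le> m" unfolding m_def by (intro integral_nonneg_AE) auto
  have ml: "m \<le> len k"
  proof -
    have "measure lebesgue (h ` K \<inter> cell k i) \<le> measure lebesgue (cell k i)"
    proof (intro measure_mono_fmeasurable)
      have "h ` K \<in> sets lebesgue"
        using branch_change_of_variables(3)[OF b K, of "\<lambda>_. 0::real"] by (auto simp: sets_restrict_space_iff)
      then show "h ` K \<inter> cell k i \<in> sets lebesgue" using interval_measurable(2)[OF cell_interval] by auto
      show "cell k i \<in> lmeasurable" using interval_measurable(2)[OF cell_interval] bounded_subset[OF bounded_closed_interval cs]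
        by (intro bounded_set_imp_lmeasurable)
    qed auto
    then show ?thesis unfolding m_def BI(2) by (simp add: cell_measure)
  qed
  have mp: "m \<le> \<mu> * p"
  proof -
    have PM: "P \<in> sets M" using Pab interval_measurable(2)[OF PI] by (auto simp: sets_restrict_space_iff)
    interpret finite_measure M by (rule finite_measure_lebesgue_on) simp
    have int: "integrable M (\<lambda>x. \<mu> * indicator P x)"
      using PM by (intro integrable_mult_right integrable_real_indicator) (auto simp: less_top[symmetric])
    have "m \<le> (LINT x|M. \<mu> * indicator P x)"
      unfolding m_def using \<mu> by (intro integral_mono BI(1) int) (auto simp: indicator_def P_def)
    also have "\<dots> = \<mu> * measure M P" using Pab by (simp add: Int_absorb2)
    also have "measure M P = p" unfolding p_def using Pab by (intro measure_restrict_space) auto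
    finally show ?thesis .
  qed
  have g: "piece K h k i = (\<lambda>x. complex_of_real (len k powr (s - 1) * (\<bar>deriv h x\<bar> * indicator P x)))"
    by (auto simp: piece_def P_def)
  have l1g: "l1 (piece K h k i) = len k powr (s - 1) * m"
  proof -
    have "cmod (piece K h k i x) = len k powr (s - 1) * (\<bar>deriv h x\<bar> * indicator P x)" for x
      unfolding g norm_of_real by simp
    then show ?thesis unfolding l1_def m_def by simp
  qed
  have B1: "lev (piece K h k i) j \<le> 2 * 2 powr (- s * real_of_int (int k - int j))"
  proof -
    have "lev (piece K h k i) j \<le> 2 * len j powr (- s) * (len k powr (s - 1) * m)"
      using lev_le_l1[OF integrable_piece[OF b K i], of j] by (simp add: l1g)
    also have "\<dots> \<le> 2 * len j powr (- s) * (len k powr (s - 1) * len k)"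
      using ml by (intro mult_left_mono) auto
    also have "len k powr (s - 1) * len k = len k powr s" by (simp add: powr_diff)
    also have "2 * len j powr (- s) * len k powr s = 2 * 2 powr (- s * real_of_int (int k - int j))"
      using len_ratio[of k s j] by (simp add: mult.commute)
    finally show ?thesis .
  qed
  have B2: "lev (piece K h k i) j \<le> 12 * E * 2 powr ((\<beta> - s) * real_of_int (int k - int j))"
  proof (cases "m = 0")
    case True
    then have "lev (piece K h k i) j \<le> 0"
      using lev_le_l1[OF integrable_piece[OF b K i], of j] by (simp add: l1g)
    also have "0 \<le> 12 * E * 2 powr ((\<beta> - s) * real_of_int (int k - int j))" using E by simp
    finally show ?thesis .
  next
    case False
    then have mpos: "0 < m" using m0 by simp
    then have "0 < \<mu> * p" using mp by simp
    then have ppos: "0 < p" using \<mu>(2) by (simp add: zero_less_mult_iff p_def)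
    have mean: "m / p \<le> \<mu>" using mp ppos by (simp add: divide_le_eq)
    \<comment> \<open>Passing from \<open>P\<close> to a subinterval with end points in
      \<open>P\<close> and at least half its length costs a factor 2 in the mean and at most 2 in
      the power, hence \<open>4 * C\<close>.\<close>
    have osc4: "\<bar>\<bar>deriv h x\<bar> - \<bar>deriv h y\<bar>\<bar> \<le> (4 * C) * (m / p) * (\<bar>x - y\<bar> / p) powr \<beta>" if xy: "x \<in> P" "y \<in> P" for x y
    proof -
      obtain u v where uv: "u \<in> P" "v \<in> P" "p / 2 \<le> v - u" "x \<in> {u..v}" "y \<in> {u..v}"
        using interval_exhaust[OF PI bdP _ xy] ppos unfolding p_def by blast
      have vu: "u < v" using uv(3) ppos by linarith
      have uvK: "u \<in> K" "v \<in> K" using uv by (auto simp: P_def)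
      \<comment> \<open>The values between \<open>h u\<close> and \<open>h v\<close> all lie in the
        cell, so the mass over their preimage is part of \<open>m\<close>.\<close>
      have hm: "\<bar>h v - h u\<bar> \<le> m"
      proof -
        let ?Q = "{min (h u) (h v)..max (h u) (h v)}"
        have Q: "is_interval ?Q" by (simp add: is_interval_cc)
        have QI: "z \<in> {a..b}" "z \<in> cell k i" if "z \<in> ?Q" for z
        proof -
          have "h u \<in> cell k i" "h v \<in> cell k i" using uv by (auto simp: P_def)
          then show "z \<in> cell k i" using that by (auto simp: cell_def min_def max_def split: if_splits)
          then show "z \<in> {a..b}" using cs by blast
        qed
        then have QS: "?Q \<subseteq> {a..b}" by blast
        have img: "?Q = h ` {u..v}"
          using injective_image_interval(2)[OF _ _ vu, of h] branch_continuous[OF b] branchD(3)[OF b] branch_interval[OF b uvK]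
          by (auto intro: continuous_on_subset inj_on_subset)
        then have "h ` K \<inter> ?Q = ?Q" using branch_interval[OF b uvK] by blast
        moreover have "measure lebesgue ?Q = \<bar>h v - h u\<bar>" by auto
        ultimately have "\<bar>h v - h u\<bar> = (LINT x|M. \<bar>deriv h x\<bar> * indicator {x \<in> K. h x \<in> ?Q} x)"
          using branch_integral_piece(2)[OF b K Q QS] by simp
        also have "\<dots> \<le> m"
          unfolding m_def
        proof (intro integral_mono branch_integral_piece(1)[OF b K Q QS] BI(1))
          show "\<bar>deriv h x\<bar> * indicator {x \<in> K. h x \<in> ?Q} x \<le> \<bar>deriv h x\<bar> * indicator P x" for x
            using QI(2)[of "h x"] by (auto simp: indicator_def P_def)
        qed
        finally show ?thesis .
      qed
      have "\<bar>\<bar>deriv h x\<bar> - \<bar>deriv h y\<bar>\<bar> \<le> C * (\<bar>h v - h u\<bar> / (v - u)) * (\<bar>x - y\<bar> / (v - u)) powr \<beta>"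
        by (rule branchD(6)[OF b uvK vu uv(4,5)])
      also have "\<dots> \<le> C * (m / (p / 2)) * (\<bar>x - y\<bar> / (p / 2)) powr \<beta>"
      proof (intro mult_mono mult_left_mono powr_mono2)
        show "\<bar>h v - h u\<bar> / (v - u) \<le> m / (p / 2)" using hm uv(3) ppos by (intro frac_le) auto
        show "\<bar>x - y\<bar> / (v - u) \<le> \<bar>x - y\<bar> / (p / 2)" using uv(3) ppos by (intro frac_le) auto
      qed (use C0 m0 ppos vu \<beta> in auto)
      also have "(\<bar>x - y\<bar> / (p / 2)) powr \<beta> \<le> 2 * (\<bar>x - y\<bar> / p) powr \<beta>"
      proof -
        have "(\<bar>x - y\<bar> / (p / 2)) powr \<beta> = 2 powr \<beta> * (\<bar>x - y\<bar> / p) powr \<beta>"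
          using ppos by (simp add: powr_mult[symmetric] mult.commute)
        also have "\<dots> \<le> 2 powr 1 * (\<bar>x - y\<bar> / p) powr \<beta>"
          using \<beta> by (intro mult_right_mono powr_mono) auto
        finally show ?thesis by simp
      qed
      then have "C * (m / (p / 2)) * (\<bar>x - y\<bar> / (p / 2)) powr \<beta> \<le> C * (m / (p / 2)) * (2 * (\<bar>x - y\<bar> / p) powr \<beta>)"
        using C0 m0 ppos by (intro mult_left_mono) auto
      finally show ?thesis by (simp add: mult_ac)
    qed
    have fin: "lev (piece K h k i) j \<le> 12 * E * 2 powr ((\<beta> - s) * real_of_int (int k - int j))"
      if D: "0 \<le> D" "(1 + D) * (m / p) powr \<beta> \<le> E"
        and osc: "\<And>x y. x \<in> P \<Longrightarrow> y \<in> P \<Longrightarrow> \<bar>\<bar>deriv h x\<bar> - \<bar>deriv h y\<bar>\<bar> \<le> D * (m / p) * (\<bar>x - y\<bar> / p) powr \<beta>" for D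
    proof -
      have "lev (piece K h k i) j \<le> 12 * (1 + D) * len k powr (s - 1) * m * p powr (- \<beta>) * len j powr (\<beta> - s)"
        unfolding g
        by (rule weighted_interval_lev(2)[OF PI Pab ppos p_def _ BI(1) m_def osc D(1) _ \<beta>]) auto
      also have "\<dots> = 12 * (1 + D) * len k powr (s - 1) * (m * p powr (- \<beta>)) * len j powr (\<beta> - s)"
        by (simp only: mult.assoc)
      \<comment> \<open>The mass is split so that \<open>m powr (1 - \<beta>)\<close> is bounded by
        a power of the cell length, and the remaining power of the mean goes into
        \<open>E\<close>.\<close>
      also have "m * p powr (- \<beta>) = m powr (1 - \<beta>) * (m / p) powr \<beta>"
        using mpos ppos by (simp add: powr_divide powr_diff powr_minus field_simps)
      also have "12 * (1 + D) * len k powr (s - 1) * (m powr (1 - \<beta>) * (m / p) powr \<beta>) * len j powr (\<beta> - s)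
          = 12 * ((1 + D) * (m / p) powr \<beta>) * (len k powr (s - 1) * m powr (1 - \<beta>) * len j powr (\<beta> - s))"
        by (simp only: mult_ac)
      also have "\<dots> \<le> 12 * E * (len k powr (s - 1) * len k powr (1 - \<beta>) * len j powr (\<beta> - s))"
      proof (rule mult_mono)
        have "m powr (1 - \<beta>) \<le> len k powr (1 - \<beta>)" using ml m0 \<beta> by (intro powr_mono2) auto
        then show "len k powr (s - 1) * m powr (1 - \<beta>) * len j powr (\<beta> - s) \<le> len k powr (s - 1) * len k powr (1 - \<beta>) * len j powr (\<beta> - s)"
          by (intro mult_right_mono mult_left_mono) auto
      qed (use D E in auto)
      also have "len k powr (s - 1) * len k powr (1 - \<beta>) * len j powr (\<beta> - s) = 2 powr ((\<beta> - s) * real_of_int (int k - int j))"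
        using len_ratio[of k "s - \<beta>" j] by (simp add: powr_add[symmetric])
      finally show ?thesis .
    qed
    from dist[OF ppos m0 ml mean] show ?thesis
    proof
      assume "(1 + 4 * C) * (m / p) powr \<beta> \<le> E"
      then show ?thesis using C0 osc4 by (intro fin[of "4 * C"]) auto
    next
      assume *: "2 * (m / p) powr \<beta> \<le> E \<and> (\<forall>x\<in>K. \<forall>y\<in>K. \<bar>x - y\<bar> \<le> p \<longrightarrow>
           \<bar>\<bar>deriv h x\<bar> - \<bar>deriv h y\<bar>\<bar> \<le> (m / p) * (\<bar>x - y\<bar> / p) powr \<beta>)"
      show ?thesis
      proof (rule fin[of 1])
        fix x y assume xy: "x \<in> P" "y \<in> P"
        then have "\<bar>x - y\<bar> \<le> p" unfolding p_def by (rule interval_length_le_measure[OF PI bdP])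
        then show "\<bar>\<bar>deriv h x\<bar> - \<bar>deriv h y\<bar>\<bar> \<le> 1 * (m / p) * (\<bar>x - y\<bar> / p) powr \<beta>"
          using * xy by (auto simp: P_def)
      qed (use * in auto)
    qed
  qed
  show ?thesis using B1 B2 by (simp add: ker_def)
qed

text \<open>Given the branch, for all sufficiently fine cells the constant in the kernel depends only on \<open>\<mu>\<close>: if the
  mean of \<open>\<bar>h'\<bar>\<close> over the piece is tiny it absorbs the distortion constant, and otherwise the piece is so short that
  Hoelder continuity of \<open>h'\<close> makes the distortion at most 1.\<close>

lemma piece_lev_fine:
  assumes b: "branch \<beta> C K h" and K: "K \<subseteq> {a..b}" "h ` K \<subseteq> {a..b}"
    and \<mu>: "\<And>x. x \<in> K \<Longrightarrow> \<bar>deriv h x\<bar> \<le> \<mu>" "0 < \<mu>" and \<beta>: "0 < \<beta>" "\<beta> < 1"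
  shows "\<exists>k0. \<forall>k\<ge>k0. \<forall>i<2^k. \<forall>j. lev (piece K h k i) j \<le> ker \<beta> (2 * \<mu> powr \<beta>) (int k - int j)"
proof -
  note C0 = branchD(4)[OF b]
  \<comment> \<open>Ordinary Hoelder continuity on all of \<open>K\<close>, from the distortion
    bound on subintervals of at least half the length of \<open>K\<close>, where the mean is at most
    \<open>\<mu>\<close>.\<close>
  have "\<exists>H\<ge>0. \<forall>x\<in>K. \<forall>y\<in>K. \<bar>\<bar>deriv h x\<bar> - \<bar>deriv h y\<bar>\<bar> \<le> H * \<bar>x - y\<bar> powr \<beta>"
  proof (cases "K = {}")
    case True
    then show ?thesis by auto
  next
    case False
    have KI: "is_interval K" and Ko: "open K" using branchD[OF b] by auto
    have bdK: "bounded K" using bounded_subset[OF bounded_closed_interval K(1)] .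
    define l where "l = measure lebesgue K"
    have l: "0 < l" unfolding l_def
    proof -
      obtain x e where "x \<in> K" "0 < e" "ball x e \<subseteq> K" using Ko False by (metis ex_in_conv open_contains_ball)
      then have "x + e / 2 \<in> K" by (auto simp: dist_real_def subset_iff)
      then have "e / 2 \<le> measure lebesgue K"
        using interval_length_le_measure[OF KI bdK, of "x + e / 2" x] \<open>x \<in> K\<close> \<open>0 < e\<close> by simp
      then show "0 < measure lebesgue K" using \<open>0 < e\<close> by simp
    qed
    have "\<bar>\<bar>deriv h x\<bar> - \<bar>deriv h y\<bar>\<bar> \<le> C * \<mu> * (2 / l) powr \<beta> * \<bar>x - y\<bar> powr \<beta>" if xy: "x \<in> K" "y \<in> K" for x y
    proof -
      obtain u v where uv: "u \<in> K" "v \<in> K" "l / 2 \<le> v - u" "x \<in> {u..v}" "y \<in> {u..v}"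
        using interval_exhaust[OF KI bdK _ xy] l unfolding l_def by blast
      have vu: "u < v" using uv(3) l by linarith
      obtain z where z: "z \<in> {u<..<v}" "\<bar>deriv h z\<bar> = \<bar>h v - h u\<bar> / (v - u)" using branch_mvt[OF b uv(1,2) vu] by blast
      then have "z \<in> K" using branch_interval[OF b uv(1,2)] by auto
      then have mean: "\<bar>h v - h u\<bar> / (v - u) \<le> \<mu>" using \<mu>(1) z by metis
      have "\<bar>\<bar>deriv h x\<bar> - \<bar>deriv h y\<bar>\<bar> \<le> C * (\<bar>h v - h u\<bar> / (v - u)) * (\<bar>x - y\<bar> / (v - u)) powr \<beta>"
        by (rule branchD(6)[OF b uv(1,2) vu uv(4,5)])
      also have "\<dots> \<le> C * \<mu> * (2 / l * \<bar>x - y\<bar>) powr \<beta>"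
      proof (intro mult_mono mult_left_mono powr_mono2 mean)
        have "\<bar>x - y\<bar> / (v - u) \<le> \<bar>x - y\<bar> / (l / 2)" using uv(3) l by (intro frac_le) auto
        then show "\<bar>x - y\<bar> / (v - u) \<le> 2 / l * \<bar>x - y\<bar>" by (simp add: mult.commute)
      qed (use C0 \<mu> vu \<beta> in auto)
      also have "\<dots> = C * \<mu> * (2 / l) powr \<beta> * \<bar>x - y\<bar> powr \<beta>"
        using powr_mult[of "2 / l" "\<bar>x - y\<bar>" \<beta>] l by simp
      finally show ?thesis .
    qed
    then show ?thesis using C0 \<mu>(2) by (intro exI[of _ "C * \<mu> * (2 / l) powr \<beta>"]) auto
  qed
  then obtain H where H: "0 \<le> H" "\<And>x y. x \<in> K \<Longrightarrow> y \<in> K \<Longrightarrow> \<bar>\<bar>deriv h x\<bar> - \<bar>deriv h y\<bar>\<bar> \<le> H * \<bar>x - y\<bar> powr \<beta>" by blast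
  \<comment> \<open>The size of the mean below which it pays for the distortion:
    \<open>(1 + 4 * C) * \<epsilon> powr \<beta> = \<mu> powr \<beta>\<close>.\<close>
  define \<epsilon> where "\<epsilon> = \<mu> / (1 + 4 * C) powr (1 / \<beta>)"
  have \<epsilon>: "0 < \<epsilon>" using \<mu>(2) C0 by (simp add: \<epsilon>_def)
  \<comment> \<open>If the mean exceeds \<open>\<epsilon>\<close> and the cell is shorter than
    \<open>d\<close>, then the piece has length below \<open>d / \<epsilon>\<close>, so
    \<open>(H + 1) * p powr \<beta> \<le> \<epsilon>\<close> and the distortion is at most 1. The
    summand 1 keeps the quotient meaningful for \<open>H = 0\<close>.\<close>
  define d where "d = \<epsilon> * (\<epsilon> / (H + 1)) powr (1 / \<beta>)"
  have d: "0 < d" using \<epsilon> H(1) by (simp add: d_def)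
  obtain k0 where k0: "\<And>k. k \<ge> k0 \<Longrightarrow> len k < d"
    using order_tendstoD(2)[OF len_tendsto d] by (auto simp: eventually_sequentially)
  have "lev (piece K h k i) j \<le> ker \<beta> (2 * \<mu> powr \<beta>) (int k - int j)" if k: "k \<ge> k0" and i: "i < 2 ^ k" for k i j
  proof (rule piece_lev[OF b K i \<mu>(1) _ \<beta>])
    show "0 \<le> \<mu>" "0 < 2 * \<mu> powr \<beta>" using \<mu>(2) by auto
    fix p m :: real assume p: "0 < p" and m: "0 \<le> m" "m \<le> len k" "m / p \<le> \<mu>"
    have mp0: "0 \<le> m / p" using p m by simp
    show "(1 + 4 * C) * (m / p) powr \<beta> \<le> 2 * \<mu> powr \<beta> \<or>
        2 * (m / p) powr \<beta> \<le> 2 * \<mu> powr \<beta> \<and> (\<forall>x\<in>K. \<forall>y\<in>K. \<bar>x - y\<bar> \<le> p \<longrightarrow>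
           \<bar>\<bar>deriv h x\<bar> - \<bar>deriv h y\<bar>\<bar> \<le> (m / p) * (\<bar>x - y\<bar> / p) powr \<beta>)"
    proof (cases "m / p \<le> \<epsilon>")
      case True
      have "(m / p) powr \<beta> \<le> \<epsilon> powr \<beta>" using True mp0 \<beta> by (intro powr_mono2) auto
      also have "\<epsilon> powr \<beta> = \<mu> powr \<beta> / (1 + 4 * C)" using C0 \<mu>(2) \<beta> by (simp add: \<epsilon>_def powr_divide powr_powr)
      finally have "(1 + 4 * C) * (m / p) powr \<beta> \<le> \<mu> powr \<beta>" using C0 by (simp add: le_divide_eq mult.commute)
      also have "\<dots> \<le> 2 * \<mu> powr \<beta>" by simp
      finally show ?thesis ..
    next
      case False
      then have big: "\<epsilon> < m / p" by simp
      have "\<epsilon> * p < d" using big p m k0[OF k] by (simp add: less_divide_eq)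
      then have "p \<le> (\<epsilon> / (H + 1)) powr (1 / \<beta>)" using \<epsilon> by (simp add: d_def)
      then have "p powr \<beta> \<le> ((\<epsilon> / (H + 1)) powr (1 / \<beta>)) powr \<beta>" using p \<beta> by (intro powr_mono2) auto
      also have "\<dots> = \<epsilon> / (H + 1)" using \<epsilon> H(1) \<beta> by (simp add: powr_powr)
      finally have "(H + 1) * p powr \<beta> \<le> \<epsilon>" using H(1) by (simp add: le_divide_eq mult.commute)
      then have Hp: "H * p powr \<beta> \<le> \<epsilon>" by (simp add: distrib_right) (smt (verit) powr_ge_zero)
      have "2 * (m / p) powr \<beta> \<le> 2 * \<mu> powr \<beta>" using m mp0 \<beta> by (intro mult_left_mono powr_mono2) auto
      moreover have "\<bar>\<bar>deriv h x\<bar> - \<bar>deriv h y\<bar>\<bar> \<le> (m / p) * (\<bar>x - y\<bar> / p) powr \<beta>" if "x \<in> K" "y \<in> K" for x y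
      proof -
        have "\<bar>x - y\<bar> powr \<beta> = p powr \<beta> * (\<bar>x - y\<bar> / p) powr \<beta>" using p by (simp add: powr_divide)
        then have "\<bar>\<bar>deriv h x\<bar> - \<bar>deriv h y\<bar>\<bar> \<le> H * p powr \<beta> * (\<bar>x - y\<bar> / p) powr \<beta>"
          using H(2)[OF that] by (simp add: mult.assoc)
        also have "\<dots> \<le> (m / p) * (\<bar>x - y\<bar> / p) powr \<beta>" using Hp big by (intro mult_right_mono) auto
        finally show ?thesis .
      qed
      ultimately show ?thesis by blast
    qed
  qed
  then show ?thesis by blast
qed

end

section \<open>Expanding systems\<close>

lemma sum_fun_apply: "(\<Sum>i\<in>A. f i) x = (\<Sum>i\<in>A. f i x)" for f :: "'i \<Rightarrow> 'x \<Rightarrow> 'y::ab_group_add"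
  by (induction A rule: infinite_finite_induct) auto

locale expanding_system = besov_scale a b s q for a b s q +
  fixes \<beta> \<mu> :: real and \<Lambda> :: "'i set" and K :: "'i \<Rightarrow> real set" and h :: "'i \<Rightarrow> real \<Rightarrow> real"
  assumes \<beta>: "s < \<beta>" "\<beta> < 1" and \<mu>: "0 < \<mu>" and fin: "finite \<Lambda>"
    and br: "J \<in> \<Lambda> \<Longrightarrow> \<exists>C. branch \<beta> C (K J) (h J)"
    and KI: "J \<in> \<Lambda> \<Longrightarrow> K J \<subseteq> {a..b}" "J \<in> \<Lambda> \<Longrightarrow> h J ` K J \<subseteq> {a..b}"
    and contr: "J \<in> \<Lambda> \<Longrightarrow> x \<in> K J \<Longrightarrow> \<bar>deriv (h J) x\<bar> \<le> \<mu>"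
    and disj: "J \<in> \<Lambda> \<Longrightarrow> J' \<in> \<Lambda> \<Longrightarrow> x \<in> K J \<Longrightarrow> x' \<in> K J' \<Longrightarrow> h J x = h J' x' \<Longrightarrow> J = J'"
    and cover: "AE x in lebesgue_on {a..b}. x \<in> (\<Union>J\<in>\<Lambda>. h J ` K J)"
begin

lemma \<beta>pos: "0 < \<beta>" using \<beta> s by simp

definition T :: "cfun \<Rightarrow> cfun" where
  "T \<psi> x = (\<Sum>J\<in>\<Lambda>. complex_of_real (indicator (K J) x * \<bar>deriv (h J) x\<bar>) * \<psi> (h J x))"

text \<open>Inverse branches of the iterates, indexed by words; the head of a word is applied last.
  The empty word has domain \<open>UNIV\<close>, which makes \<open>T_pow\<close> valid at exponent
  0; the inclusion in the interval therefore concerns nonempty words.\<close>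

fun wK :: "'i list \<Rightarrow> real set" and wh :: "'i list \<Rightarrow> real \<Rightarrow> real" where
  "wK [] = UNIV"
| "wK (J # js) = {x \<in> wK js. wh js x \<in> K J}"
| "wh [] = (\<lambda>x. x)"
| "wh (J # js) = (\<lambda>x. h J (wh js x))"

definition words :: "nat \<Rightarrow> 'i list set" where "words n = {js. set js \<subseteq> \<Lambda> \<and> length js = n}"

lemma finite_words: "finite (words n)"
  unfolding words_def using fin by (rule finite_lists_length_eq)

lemma words_0: "words 0 = {[]}" by (auto simp: words_def)

lemma words_Suc: "words (Suc n) = (\<lambda>(J, js). J # js) ` (\<Lambda> \<times> words n)"
  by (auto simp: words_def length_Suc_conv image_iff)

text \<open>The constant comes from repeated use of \<open>branch_comp\<close> and carries no bound
  uniform in the length of the word, so only its existence is recorded.\<close>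

lemma word_branch: "set js \<subseteq> \<Lambda> \<Longrightarrow> \<exists>C. branch \<beta> C (wK js) (wh js)"
proof (induction js)
  case Nil
  have "branch \<beta> 0 UNIV (\<lambda>x. x)"
    by (rule branch_cong[OF branch_affine[of 1 \<beta> 0]]) (use \<beta>pos in auto)
  then show ?case by auto
next
  case (Cons J js)
  then obtain C C' where "branch \<beta> C (wK js) (wh js)" "branch \<beta> C' (K J) (h J)" using br[of J] by auto
  then show ?case using branch_comp(1)[unfolded o_def, of \<beta> C' "K J" "h J" C "wK js" "wh js"] \<beta>pos \<beta> by auto
qed

lemma word_deriv:
  assumes "set (J # js) \<subseteq> \<Lambda>" "x \<in> wK (J # js)"
  shows "deriv (wh (J # js)) x = deriv (h J) (wh js x) * deriv (wh js) x"
proof -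
  obtain C C' where "branch \<beta> C (wK js) (wh js)" "branch \<beta> C' (K J) (h J)"
    using word_branch[of js] br[of J] assms(1) by auto
  then show ?thesis using branch_comp(2)[unfolded o_def, of \<beta> C' "K J" "h J" C "wK js" "wh js" x] assms(2) \<beta>pos \<beta> by auto
qed

lemma word_contr: "set js \<subseteq> \<Lambda> \<Longrightarrow> x \<in> wK js \<Longrightarrow> \<bar>deriv (wh js) x\<bar> \<le> \<mu> ^ length js"
proof (induction js)
  case (Cons J js)
  have "\<bar>deriv (wh (J # js)) x\<bar> = \<bar>deriv (h J) (wh js x)\<bar> * \<bar>deriv (wh js) x\<bar>"
    using word_deriv[OF Cons.prems] by (simp add: abs_mult)
  also have "\<dots> \<le> \<mu> * \<mu> ^ length js"
    using Cons contr[of J "wh js x"] \<mu> by (intro mult_mono) auto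
  finally show ?case by simp
qed simp

lemma word_subset: "set js \<subseteq> \<Lambda> \<Longrightarrow> js \<noteq> [] \<Longrightarrow> wK js \<subseteq> {a..b} \<and> wh js ` wK js \<subseteq> {a..b}"
proof (induction js)
  case (Cons J js)
  have J: "K J \<subseteq> {a..b}" "h J ` K J \<subseteq> {a..b}" using KI[of J] Cons.prems by auto
  have "wK (J # js) \<subseteq> {a..b}"
    using Cons J by (cases "js = []") auto
  moreover have "wh (J # js) ` wK (J # js) \<subseteq> h J ` K J" by auto
  ultimately show ?case using J by blast
qed simp

lemma word_disjoint:
  "set js \<subseteq> \<Lambda> \<Longrightarrow> set js' \<subseteq> \<Lambda> \<Longrightarrow> length js = length js' \<Longrightarrow> x \<in> wK js \<Longrightarrow> x' \<in> wK js' \<Longrightarrow>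
   wh js x = wh js' x' \<Longrightarrow> js = js'"
proof (induction js arbitrary: js')
  case (Cons J js)
  then obtain J' js'' where js': "js' = J' # js''" by (cases js') auto
  have JJ: "J = J'" using Cons.prems disj[of J J' "wh js x" "wh js'' x'"] by (auto simp: js')
  obtain C where "branch \<beta> C (K J) (h J)" using br[of J] Cons.prems by auto
  then have "inj_on (h J) (K J)" by (rule branchD)
  then have "wh js x = wh js'' x'" using Cons.prems JJ by (auto simp: js' dest: inj_onD)
  then show ?case using Cons.IH[of js''] Cons.prems JJ by (auto simp: js')
qed simp

lemma T_pow: "(T ^^ n) \<psi> x = (\<Sum>js\<in>words n. complex_of_real (indicator (wK js) x * \<bar>deriv (wh js) x\<bar>) * \<psi> (wh js x))"
proof (induction n arbitrary: \<psi>)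
  case 0
  show ?case by (simp add: words_0)
next
  case (Suc n)
  \<comment> \<open>The new factor is split off on the side of \<open>\<psi>\<close>, because the
    head letter of a word is the outermost inverse branch.\<close>
  have "(T ^^ Suc n) \<psi> x = (T ^^ n) (T \<psi>) x" by (simp add: funpow_swap1)
  also have "\<dots> = (\<Sum>js\<in>words n. \<Sum>J\<in>\<Lambda>. complex_of_real (indicator (wK js) x * \<bar>deriv (wh js) x\<bar>) *
      (complex_of_real (indicator (K J) (wh js x) * \<bar>deriv (h J) (wh js x)\<bar>) * \<psi> (h J (wh js x))))"
    unfolding Suc by (simp only: T_def sum_distrib_left)
  also have "\<dots> = (\<Sum>js\<in>words n. \<Sum>J\<in>\<Lambda>. complex_of_real (indicator (wK (J # js)) x * \<bar>deriv (wh (J # js)) x\<bar>) * \<psi> (wh (J # js) x))"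
  proof (intro sum.cong refl)
    fix js J assume *: "js \<in> words n" "J \<in> \<Lambda>"
    then have sub: "set (J # js) \<subseteq> \<Lambda>" by (auto simp: words_def)
    show "complex_of_real (indicator (wK js) x * \<bar>deriv (wh js) x\<bar>) *
      (complex_of_real (indicator (K J) (wh js x) * \<bar>deriv (h J) (wh js x)\<bar>) * \<psi> (h J (wh js x))) =
      complex_of_real (indicator (wK (J # js)) x * \<bar>deriv (wh (J # js)) x\<bar>) * \<psi> (wh (J # js) x)"
    proof (cases "x \<in> wK (J # js)")
      case True
      then show ?thesis using word_deriv[OF sub True] by (simp add: abs_mult)
    next
      case False
      then have "indicator (wK js) x * indicator (K J) (wh js x) = (0::real)" by (auto simp: indicator_def)
      then show ?thesis using False by auto
    qed
  qed
  also have "\<dots> = (\<Sum>(J, js)\<in>\<Lambda> \<times> words n. complex_of_real (indicator (wK (J # js)) x * \<bar>deriv (wh (J # js)) x\<bar>) * \<psi> (wh (J # js) x))"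
    by (subst sum.swap) (simp only: sum.cartesian_product)
  also have "\<dots> = (\<Sum>js\<in>words (Suc n). complex_of_real (indicator (wK js) x * \<bar>deriv (wh js) x\<bar>) * \<psi> (wh js x))"
    unfolding words_Suc by (subst sum.reindex) (auto simp: inj_on_def case_prod_unfold simp del: wK.simps wh.simps)
  finally show ?case .
qed

lemma T_pow_linear: "(T ^^ n) (\<lambda>x. c * \<psi> x + \<phi> x) = (\<lambda>x. c * (T ^^ n) \<psi> x + (T ^^ n) \<phi> x)"
  unfolding T_pow by (auto simp: fun_eq_iff sum_distrib_left sum.distrib[symmetric] algebra_simps intro!: sum.cong)

lemma T_pow_sum: "(T ^^ n) (\<lambda>x. \<Sum>i\<in>A. c i * f i x) = (\<lambda>x. \<Sum>i\<in>A. c i * (T ^^ n) (f i) x)"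
proof -
  have "(T ^^ n) (\<lambda>x. 0) = (\<lambda>x. 0)" unfolding T_pow by simp
  then show ?thesis
    by (induction A rule: infinite_finite_induct) (simp_all add: T_pow_linear)
qed

section \<open>Conservation of the integral\<close>

lemma sum_images: "x \<in> (\<Union>J\<in>\<Lambda>. h J ` K J) \<Longrightarrow> (\<Sum>J\<in>\<Lambda>. indicator (h J ` K J) x) = (1::real)"
proof -
  assume "x \<in> (\<Union>J\<in>\<Lambda>. h J ` K J)"
  then obtain J where J: "J \<in> \<Lambda>" "x \<in> h J ` K J" by blast
  have "(\<Sum>J'\<in>\<Lambda>. indicator (h J' ` K J') x) = (\<Sum>J'\<in>\<Lambda>. if J' = J then 1 else (0::real))"
  proof (intro sum.cong refl)
    fix J' assume J': "J' \<in> \<Lambda>"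
    have "J' = J" if x: "x \<in> h J' ` K J'"
    proof -
      obtain y where y: "x = h J' y" "y \<in> K J'" using x by (rule imageE)
      obtain y' where y': "x = h J y'" "y' \<in> K J" using J(2) by (rule imageE)
      show ?thesis by (rule disj[OF J' J(1) y(2) y'(2)]) (use y(1) y'(1) in simp)
    qed
    then have "x \<in> h J' ` K J' \<longleftrightarrow> J' = J" using J(2) by metis
    then show "indicator (h J' ` K J') x = (if J' = J then 1 else (0::real))"
      using J(2) by (cases "J' = J") auto
  qed
  then show ?thesis using J fin by simp
qed

lemma T_integral:
  fixes F :: "real \<Rightarrow> 'e::euclidean_space"
  assumes F: "integrable M F"
  shows "integrable M (\<lambda>x. \<Sum>J\<in>\<Lambda>. indicator (K J) x *\<^sub>R (\<bar>deriv (h J) x\<bar> *\<^sub>R F (h J x)))"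
    and "(LINT x|M. (\<Sum>J\<in>\<Lambda>. indicator (K J) x *\<^sub>R (\<bar>deriv (h J) x\<bar> *\<^sub>R F (h J x)))) = (LINT x|M. F x)"
proof -
  have cv: "integrable M (\<lambda>x. indicator (K J) x *\<^sub>R (\<bar>deriv (h J) x\<bar> *\<^sub>R F (h J x)))"
    "(LINT x|M. indicator (K J) x *\<^sub>R (\<bar>deriv (h J) x\<bar> *\<^sub>R F (h J x))) = (LINT x|M. indicator (h J ` K J) x *\<^sub>R F x)"
    "h J ` K J \<in> sets M" if "J \<in> \<Lambda>" for J
    using br[OF that] branch_change_of_variables[OF _ KI(1)[OF that] KI(2)[OF that] F] by blast+
  show "integrable M (\<lambda>x. \<Sum>J\<in>\<Lambda>. indicator (K J) x *\<^sub>R (\<bar>deriv (h J) x\<bar> *\<^sub>R F (h J x)))"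
    using cv(1) by (rule Bochner_Integration.integrable_sum)
  have hint: "integrable M (\<lambda>x. indicator (h J ` K J) x *\<^sub>R F x)" if "J \<in> \<Lambda>" for J
    using cv(3)[OF that] F by (rule integrable_mult_indicator)
  have "(LINT x|M. (\<Sum>J\<in>\<Lambda>. indicator (K J) x *\<^sub>R (\<bar>deriv (h J) x\<bar> *\<^sub>R F (h J x)))) =
    (\<Sum>J\<in>\<Lambda>. LINT x|M. indicator (K J) x *\<^sub>R (\<bar>deriv (h J) x\<bar> *\<^sub>R F (h J x)))"
    using cv(1) by (rule Bochner_Integration.integral_sum)
  also have "\<dots> = (\<Sum>J\<in>\<Lambda>. LINT x|M. indicator (h J ` K J) x *\<^sub>R F x)" using cv(2) by simp
  also have "\<dots> = (LINT x|M. (\<Sum>J\<in>\<Lambda>. indicator (h J ` K J) x *\<^sub>R F x))"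
    using hint by (rule Bochner_Integration.integral_sum[symmetric])
  also have "\<dots> = (LINT x|M. F x)"
  proof (rule integral_cong_AE)
    show "(\<lambda>x. \<Sum>J\<in>\<Lambda>. indicator (h J ` K J) x *\<^sub>R F x) \<in> borel_measurable M"
      using hint by (intro borel_measurable_sum borel_measurable_integrable)
    show "AE x in M. (\<Sum>J\<in>\<Lambda>. indicator (h J ` K J) x *\<^sub>R F x) = F x"
      using cover by eventually_elim (metis scaleR_sum_left scaleR_one sum_images)
  qed (use F in auto)
  finally show "(LINT x|M. (\<Sum>J\<in>\<Lambda>. indicator (K J) x *\<^sub>R (\<bar>deriv (h J) x\<bar> *\<^sub>R F (h J x)))) = (LINT x|M. F x)" .
qed

lemma T_alt: "T \<psi> x = (\<Sum>J\<in>\<Lambda>. indicator (K J) x *\<^sub>R (\<bar>deriv (h J) x\<bar> *\<^sub>R \<psi> (h J x)))"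
  by (simp add: T_def scaleR_conv_of_real mult.assoc)

lemma T_L1:
  assumes "integrable M \<psi>"
  shows "integrable M (T \<psi>)" "(LINT x|M. T \<psi> x) = (LINT x|M. \<psi> x)" "l1 (T \<psi>) \<le> l1 \<psi>"
proof -
  show I: "integrable M (T \<psi>)" "(LINT x|M. T \<psi> x) = (LINT x|M. \<psi> x)"
    using T_integral[OF assms] unfolding T_alt[abs_def] by auto
  have n: "integrable M (\<lambda>x. norm (\<psi> x))" using assms by simp
  have "l1 (T \<psi>) \<le> (LINT x|M. (\<Sum>J\<in>\<Lambda>. indicator (K J) x *\<^sub>R (\<bar>deriv (h J) x\<bar> *\<^sub>R norm (\<psi> (h J x)))))"
    unfolding l1_def
  proof (rule integral_mono[OF integrable_norm[OF I(1)] T_integral(1)[OF n]])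
    fix x
    show "cmod (T \<psi> x) \<le> (\<Sum>J\<in>\<Lambda>. indicator (K J) x *\<^sub>R (\<bar>deriv (h J) x\<bar> *\<^sub>R norm (\<psi> (h J x))))"
      unfolding T_alt by (rule order_trans[OF norm_sum]) (simp add: mult.assoc)
  qed
  also have "\<dots> = l1 \<psi>" unfolding l1_def by (rule T_integral(2)[OF n])
  finally show "l1 (T \<psi>) \<le> l1 \<psi>" .
qed

lemma T_pow_L1: "integrable M \<psi> \<Longrightarrow> integrable M ((T ^^ n) \<psi>) \<and> l1 ((T ^^ n) \<psi>) \<le> l1 \<psi>"
proof (induction n)
  case (Suc n)
  then show ?case using T_L1(1,3)[of "(T ^^ n) \<psi>"] by auto
qed simp

section \<open>Levels of transferred atoms under iterates\<close>

lemma T_pow_atom: "(T ^^ n) (atom s (cell k i)) = (\<lambda>x. \<Sum>js\<in>words n. piece (wK js) (wh js) k i x)"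
proof
  fix x
  show "(T ^^ n) (atom s (cell k i)) x = (\<Sum>js\<in>words n. piece (wK js) (wh js) k i x)"
    unfolding T_pow by (intro sum.cong refl) (auto simp: atom_cell piece_def indicator_def)
qed

lemma word_piece_integrable:
  assumes "js \<in> words n" "n \<ge> 1" "i < 2 ^ k"
  shows "integrable M (piece (wK js) (wh js) k i)"
proof -
  have js: "set js \<subseteq> \<Lambda>" "js \<noteq> []" using assms by (auto simp: words_def)
  obtain C where "branch \<beta> C (wK js) (wh js)" using word_branch[OF js(1)] by blast
  then show ?thesis using word_subset[OF js] assms(3) by (intro integrable_piece) auto
qed

lemma T_pow_atom_lev:
  assumes "n \<ge> 1" "i < 2 ^ k"
  shows "lev ((T ^^ n) (atom s (cell k i))) j \<le> (\<Sum>js\<in>words n. lev (piece (wK js) (wh js) k i) j)"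
  unfolding T_pow_atom
  using lev_sum[OF finite_words, of n "\<lambda>js. piece (wK js) (wh js) k i" "\<lambda>_. 1" j] word_piece_integrable[OF _ assms]
  by simp

text \<open>Valid for cells of every level, but with a constant and a number of words that depend on
  n. It serves for n = 1 to show that the operator is bounded.\<close>

lemma T_pow_atom_lev_coarse:
  assumes n: "n \<ge> 1"
  shows "\<exists>E>0. \<forall>k. \<forall>i<2^k. \<forall>j. lev ((T ^^ n) (atom s (cell k i))) j \<le> real (card (words n)) * ker \<beta> E (int k - int j)"
proof -
  have "\<forall>js\<in>words n. \<exists>C. branch \<beta> C (wK js) (wh js)" using word_branch by (auto simp: words_def)
  then obtain Cf where Cf: "\<And>js. js \<in> words n \<Longrightarrow> branch \<beta> (Cf js) (wK js) (wh js)" by metis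
  have C0: "0 \<le> Cf js" if "js \<in> words n" for js using branchD(4)[OF Cf[OF that]] .
  define C where "C = sum Cf (words n)"
  have CC: "Cf js \<le> C" if "js \<in> words n" for js
    unfolding C_def using that finite_words C0 by (intro member_le_sum) auto
  have "0 \<le> C" unfolding C_def using C0 by (intro sum_nonneg)
  define E where "E = (1 + 4 * C) * (\<mu> ^ n) powr \<beta>"
  have E: "0 < E" using \<open>0 \<le> C\<close> \<mu> by (simp add: E_def add_pos_nonneg)
  have "lev ((T ^^ n) (atom s (cell k i))) j \<le> real (card (words n)) * ker \<beta> E (int k - int j)" if i: "i < 2 ^ k" for k i j
  proof -
    have "lev (piece (wK js) (wh js) k i) j \<le> ker \<beta> E (int k - int j)" if js: "js \<in> words n" for js
    proof (rule piece_lev[OF Cf[OF js] _ _ i _ _ \<beta>pos \<beta>(2) E])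
      have js': "set js \<subseteq> \<Lambda>" "js \<noteq> []" "length js = n" using js n by (auto simp: words_def)
      show "wK js \<subseteq> {a..b}" "wh js ` wK js \<subseteq> {a..b}" using word_subset[OF js'(1,2)] by auto
      show "\<bar>deriv (wh js) x\<bar> \<le> \<mu> ^ n" if "x \<in> wK js" for x using word_contr[OF js'(1) that] js'(3) by simp
      show "0 \<le> \<mu> ^ n" using \<mu> by simp
      fix p m :: real assume "0 < p" "0 \<le> m" "m \<le> len k" "m / p \<le> \<mu> ^ n"
      then have "(1 + 4 * Cf js) * (m / p) powr \<beta> \<le> E"
        unfolding E_def using CC[OF js] C0[OF js] \<beta>pos by (intro mult_mono powr_mono2) auto
      then show "(1 + 4 * Cf js) * (m / p) powr \<beta> \<le> E \<or>
        2 * (m / p) powr \<beta> \<le> E \<and> (\<forall>x\<in>wK js. \<forall>y\<in>wK js. \<bar>x - y\<bar> \<le> p \<longrightarrow>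
           \<bar>\<bar>deriv (wh js) x\<bar> - \<bar>deriv (wh js) y\<bar>\<bar> \<le> (m / p) * (\<bar>x - y\<bar> / p) powr \<beta>)" ..
    qed
    then have "(\<Sum>js\<in>words n. lev (piece (wK js) (wh js) k i) j) \<le> (\<Sum>js\<in>words n. ker \<beta> E (int k - int j))"
      by (intro sum_mono)
    then show ?thesis using T_pow_atom_lev[OF n i, of j] by simp
  qed
  then show ?thesis using E by blast
qed

text \<open>Beyond a level depending on n, the kernel constant of each word depends only on the
  contraction rate by \<open>piece_lev_fine\<close>. Moreover no nonempty image of a branch fits
  into one cell, so a cell meets at most two of these disjoint images; this replaces the number of
  words by 2.\<close>

lemma T_pow_atom_lev_fine:
  assumes n: "n \<ge> 1"
  shows "\<exists>m. \<forall>k\<ge>m. \<forall>i<2^k. \<forall>j. lev ((T ^^ n) (atom s (cell k i))) j \<le> 2 * ker \<beta> (2 * (\<mu> ^ n) powr \<beta>) (int k - int j)"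
proof -
  have W: "set js \<subseteq> \<Lambda>" "js \<noteq> []" "length js = n" if "js \<in> words n" for js using that n by (auto simp: words_def)
  have "\<forall>js\<in>words n. \<exists>k0. \<forall>k\<ge>k0. \<forall>i<2^k. \<forall>j. lev (piece (wK js) (wh js) k i) j \<le> ker \<beta> (2 * (\<mu> ^ n) powr \<beta>) (int k - int j)"
  proof
    fix js assume js: "js \<in> words n"
    obtain C where C: "branch \<beta> C (wK js) (wh js)" using word_branch[OF W(1)[OF js]] by blast
    show "\<exists>k0. \<forall>k\<ge>k0. \<forall>i<2^k. \<forall>j. lev (piece (wK js) (wh js) k i) j \<le> ker \<beta> (2 * (\<mu> ^ n) powr \<beta>) (int k - int j)"
      by (rule piece_lev_fine[OF C _ _ _ _ \<beta>pos \<beta>(2)])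
        (use word_subset[OF W(1)[OF js] W(2)[OF js]] word_contr[OF W(1)[OF js]] W(3)[OF js] \<mu> in auto)
  qed
  then obtain k0 where k0: "\<And>js k i j. js \<in> words n \<Longrightarrow> k \<ge> k0 js \<Longrightarrow> i < 2 ^ k \<Longrightarrow>
      lev (piece (wK js) (wh js) k i) j \<le> ker \<beta> (2 * (\<mu> ^ n) powr \<beta>) (int k - int j)" by metis
  have "\<forall>js\<in>words n. \<exists>k1. \<forall>k\<ge>k1. \<forall>i. wK js \<noteq> {} \<longrightarrow> \<not> wh js ` wK js \<subseteq> cell k i"
  proof
    fix js assume js: "js \<in> words n"
    show "\<exists>k1. \<forall>k\<ge>k1. \<forall>i. wK js \<noteq> {} \<longrightarrow> \<not> wh js ` wK js \<subseteq> cell k i"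
    proof (cases "wK js = {}")
      case False
      obtain C where C: "branch \<beta> C (wK js) (wh js)" using word_branch[OF W(1)[OF js]] by blast
      obtain x where x: "x \<in> wK js" using False by blast
      obtain e where e: "0 < e" "ball x e \<subseteq> wK js" using branchD(1)[OF C] x by (meson open_contains_ball)
      then have y: "x + e / 2 \<in> wK js" by (auto simp: dist_real_def subset_iff)
      have ne: "wh js x \<noteq> wh js (x + e / 2)" using inj_onD[OF branchD(3)[OF C] _ x y] e(1) by auto
      define d where "d = \<bar>wh js x - wh js (x + e / 2)\<bar>"
      have d: "0 < d" using ne by (simp add: d_def)
      obtain k1 where k1: "\<And>k. k \<ge> k1 \<Longrightarrow> len k < d"
        using order_tendstoD(2)[OF len_tendsto d] by (auto simp: eventually_sequentially)
      have "\<not> wh js ` wK js \<subseteq> cell k i" if "k \<ge> k1" for k i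
      proof
        assume "wh js ` wK js \<subseteq> cell k i"
        then have "wh js x \<in> cell k i" "wh js (x + e / 2) \<in> cell k i" using x y by auto
        then have "d \<le> len k" by (auto simp: d_def cell_alt distrib_right)
        then show False using k1[OF that] by simp
      qed
      then show ?thesis by blast
    qed simp
  qed
  then obtain k1 where k1: "\<And>js k i. js \<in> words n \<Longrightarrow> k \<ge> k1 js \<Longrightarrow> wK js \<noteq> {} \<Longrightarrow> \<not> wh js ` wK js \<subseteq> cell k i" by metis
  \<comment> \<open>Summing the thresholds over the finitely many words is a convenient upper bound
    for all of them.\<close>
  define m where "m = (\<Sum>js\<in>words n. k0 js + k1 js)"
  have mle: "k0 js \<le> m" "k1 js \<le> m" if "js \<in> words n" for js
    using member_le_sum[OF that, of "\<lambda>js. k0 js + k1 js"] finite_words[of n] unfolding m_def by auto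
  have "lev ((T ^^ n) (atom s (cell k i))) j \<le> 2 * ker \<beta> (2 * (\<mu> ^ n) powr \<beta>) (int k - int j)"
    if k: "k \<ge> m" and i: "i < 2 ^ k" for k i j
  proof -
    let ?k = "ker \<beta> (2 * (\<mu> ^ n) powr \<beta>) (int k - int j)"
    let ?S = "\<lambda>js. wh js ` wK js"
    let ?B = "{js \<in> words n. ?S js \<inter> cell k i \<noteq> {} \<and> \<not> ?S js \<subseteq> cell k i}"
    have kn: "0 \<le> ?k" by (intro ker_nonneg) simp
    have "lev (piece (wK js) (wh js) k i) j \<le> (if js \<in> ?B then ?k else 0)" if js: "js \<in> words n" for js
    proof (cases "?S js \<inter> cell k i = {}")
      case True
      then have "piece (wK js) (wh js) k i = (\<lambda>x. 0)" by (auto simp: piece_def indicator_def fun_eq_iff)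
      then show ?thesis using kn by simp
    next
      case False
      then have "js \<in> ?B" using k1[OF js _ _, of k i] mle(2)[OF js] k js by auto
      then show ?thesis using k0[OF js _ i, of j] mle(1)[OF js] k by auto
    qed
    then have "(\<Sum>js\<in>words n. lev (piece (wK js) (wh js) k i) j) \<le> (\<Sum>js\<in>words n. if js \<in> ?B then ?k else 0)"
      by (intro sum_mono)
    also have "\<dots> = real (card ?B) * ?k"
    proof -
      have "words n \<inter> ?B = ?B" by auto
      then show ?thesis by (simp only: sum.If_cases[OF finite_words] Collect_mem_eq) simp
    qed
    also have "\<dots> \<le> 2 * ?k"
    proof (intro mult_right_mono kn)
      have "card ?B \<le> 2"
      proof (rule card_boundary_le_2[OF _ _ cell_interval])
        fix js assume js: "js \<in> words n"
        obtain C where C: "branch \<beta> C (wK js) (wh js)" using word_branch[OF W(1)[OF js]] by blast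
        then show "is_interval (?S js)"
          using branchD(2)[OF C] branch_continuous[OF C]
          by (simp add: is_interval_connected_1 connected_continuous_image)
      next
        fix js js' x assume *: "js \<in> words n" "js' \<in> words n" "x \<in> ?S js" "x \<in> ?S js'"
        obtain y where y: "x = wh js y" "y \<in> wK js" using *(3) by (rule imageE)
        obtain y' where y': "x = wh js' y'" "y' \<in> wK js'" using *(4) by (rule imageE)
        show "js = js'"
          using word_disjoint[OF W(1)[OF *(1)] W(1)[OF *(2)] _ y(2) y'(2)] W(3)[OF *(1)] W(3)[OF *(2)] y(1) y'(1) by simp
      qed (simp add: cell_def)
      then show "real (card ?B) \<le> 2" by simp
    qed
    finally show ?thesis using T_pow_atom_lev[OF n i, of j] by simp
  qed
  then show ?thesis by blast
qed

text \<open>The coefficients below level m are set to 0, so the atom bound is required from level m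
  on. The transferred series still converges because the iterates do not increase the L1
  norm.\<close>

lemma T_pow_tail:
  fixes L :: "int \<Rightarrow> real"
  assumes \<psi>: "\<psi> \<in> V"
    and L: "\<And>i. 0 \<le> L i" "\<And>F. finite F \<Longrightarrow> sum L F \<le> \<kappa>"
    and lev: "\<And>k i j. m \<le> k \<Longrightarrow> i < 2 ^ k \<Longrightarrow> lev ((T ^^ n) (atom s (cell k i))) j \<le> L (int k - int j)"
  shows "(T ^^ n) (\<lambda>x. \<psi> x - mpart m \<psi> x) \<in> V"
    and "N ((T ^^ n) (\<lambda>x. \<psi> x - mpart m \<psi> x)) \<le> \<kappa> * (\<kappa>0 * N \<psi>)"
proof -
  note \<psi>i = besov_integrable[OF \<psi>]
  define c where "c k i = (if m \<le> k then mcoef k i \<psi> else 0)" for k i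
  let ?R = "\<lambda>x. \<psi> x - mpart m \<psi> x"
  have Ri: "integrable M ?R" using \<psi>i integrable_mpart by auto
  have lq: "lq_le q (lev ((T ^^ n) ?R)) (\<kappa> * (\<kappa>0 * N \<psi>))"
  proof (rule lq_le_lev_series[where g="\<lambda>k i. (T ^^ n) (atom s (cell k i))" and c=c and K=L])
    show "integrable M ((T ^^ n) (atom s (cell k i)))" if "i < 2 ^ k" for k i
      using T_pow_L1[OF integrable_atom[OF that]] by simp
    show "integrable M ((T ^^ n) ?R)" using T_pow_L1[OF Ri] by simp
    show "lq_le q (\<lambda>k. \<Sum>i<2^k. cmod (c k i)) (\<kappa>0 * N \<psi>)"
    proof (rule lq_le_mono[OF q lev_besov_norm[OF \<psi>]])
      show "0 \<le> (\<Sum>i<2^k. cmod (c k i))" for k by (simp add: sum_nonneg)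
      show "(\<Sum>i<2^k. cmod (c k i)) \<le> lev \<psi> k" for k unfolding lev_def c_def by (intro sum_mono) auto
    qed simp
    show "(\<lambda>N. l1 (\<lambda>x. (T ^^ n) ?R x - (\<Sum>k<N. \<Sum>i<2^k. c k i * (T ^^ n) (atom s (cell k i)) x))) \<longlonglongrightarrow> 0"
    proof (rule Lim_null_comparison[OF _ mpart_tendsto[OF \<psi>i lev_besov_norm[OF \<psi>]]], rule eventually_sequentiallyI[of m])
      fix N' :: nat assume N': "m \<le> N'"
      let ?c = "\<lambda>x. \<Sum>k<N'. \<Sum>i<2^k. c k i * atom s (cell k i) x"
      have split: "mpart N' \<psi> x = mpart m \<psi> x + ?c x" for x
      proof -
        have "mpart N' \<psi> x = (\<Sum>k<m. \<Sum>i<2^k. mcoef k i \<psi> * atom s (cell k i) x) + (\<Sum>k\<in>{m..<N'}. \<Sum>i<2^k. mcoef k i \<psi> * atom s (cell k i) x)"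
          unfolding mpart_def lessThan_atLeast0 using N' by (subst sum.atLeastLessThan_concat) auto
        also have "(\<Sum>k\<in>{m..<N'}. \<Sum>i<2^k. mcoef k i \<psi> * atom s (cell k i) x) = ?c x"
          unfolding c_def by (intro sum.mono_neutral_cong_left) auto
        finally show ?thesis by (simp add: mpart_def)
      qed
      have "(T ^^ n) (\<lambda>x. \<Sum>i<2^k. c k i * atom s (cell k i) x) = (\<lambda>x. \<Sum>i<2^k. c k i * (T ^^ n) (atom s (cell k i)) x)" for k
        by (rule T_pow_sum)
      then have Tc: "(T ^^ n) ?c = (\<lambda>x. \<Sum>k<N'. \<Sum>i<2^k. c k i * (T ^^ n) (atom s (cell k i)) x)"
        using T_pow_sum[where c="\<lambda>_. 1" and A="{..<N'}" and f="\<lambda>k x. \<Sum>i<2^k. c k i * atom s (cell k i) x" and n=n] by simp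
      have e: "(\<lambda>x. \<psi> x - mpart N' \<psi> x) = (\<lambda>x. (- 1) * ?c x + ?R x)"
        unfolding split by (simp add: fun_eq_iff)
      have "(T ^^ n) (\<lambda>x. \<psi> x - mpart N' \<psi> x) = (\<lambda>x. (- 1) * (T ^^ n) ?c x + (T ^^ n) ?R x)"
        unfolding e by (rule T_pow_linear)
      then have eq: "(\<lambda>x. (T ^^ n) ?R x - (\<Sum>k<N'. \<Sum>i<2^k. c k i * (T ^^ n) (atom s (cell k i)) x)) =
          (T ^^ n) (\<lambda>x. \<psi> x - mpart N' \<psi> x)" unfolding Tc by simp
      show "norm (l1 (\<lambda>x. (T ^^ n) ?R x - (\<Sum>k<N'. \<Sum>i<2^k. c k i * (T ^^ n) (atom s (cell k i)) x)))
          \<le> l1 (\<lambda>x. \<psi> x - mpart N' \<psi> x)"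
        unfolding eq using T_pow_L1[of "\<lambda>x. \<psi> x - mpart N' \<psi> x" n] \<psi>i integrable_mpart by simp
    qed
    show "lev ((T ^^ n) (atom s (cell k i))) j \<le> L (int k - int j)" if "i < 2 ^ k" "c k i \<noteq> 0" for k i j
      using that by (intro lev) (auto simp: c_def split: if_splits)
  qed (use L in auto)
  show "(T ^^ n) ?R \<in> V" "N ((T ^^ n) ?R) \<le> \<kappa> * (\<kappa>0 * N \<psi>)"
    using besov_lev[OF _ lq] T_pow_L1[OF Ri] by auto
qed

lemma C2_nonneg: "0 \<le> C2 \<beta>" using sum_ker_le[OF \<beta>(1), of 1 "{}"] by simp

lemma T_bounded: "\<exists>C\<ge>0. \<forall>\<psi>\<in>V. T \<psi> \<in> V \<and> N (T \<psi>) \<le> C * N \<psi>"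
proof -
  obtain E where E: "0 < E" and lev: "\<And>k i j. i < 2 ^ k \<Longrightarrow>
      lev ((T ^^ 1) (atom s (cell k i))) j \<le> real (card (words 1)) * ker \<beta> E (int k - int j)"
    using T_pow_atom_lev_coarse[of 1] by auto
  let ?\<kappa> = "real (card (words 1)) * (C2 \<beta> * E powr (s / \<beta>))"
  have k: "0 \<le> ?\<kappa>" using C2_nonneg by simp
  have "T \<psi> \<in> V \<and> N (T \<psi>) \<le> ?\<kappa> * \<kappa>0 * N \<psi>" if \<psi>: "\<psi> \<in> V" for \<psi>
  proof -
    \<comment> \<open>With \<open>m = 0\<close> nothing is removed and the tail estimate applies to
      \<open>\<psi>\<close> itself.\<close>
    have m0: "(\<lambda>x. \<psi> x - mpart 0 \<psi> x) = \<psi>" by (simp add: mpart_def)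
    have "sum (\<lambda>z. real (card (words 1)) * ker \<beta> E z) F \<le> ?\<kappa>" if "finite F" for F
      unfolding sum_distrib_left[symmetric] using sum_ker_le[OF \<beta>(1) E that] by (intro mult_left_mono) auto
    then show ?thesis
      using T_pow_tail[OF \<psi>, of "\<lambda>z. real (card (words 1)) * ker \<beta> E z" ?\<kappa> 0 1] lev ker_nonneg[of E \<beta>] E
      unfolding m0 by (auto simp: mult.assoc)
  qed
  then show ?thesis using k \<kappa>0_pos by (intro exI[of _ "?\<kappa> * \<kappa>0"]) auto
qed

lemma atom_in_V: assumes "i < 2 ^ k" shows "atom s (cell k i) \<in> V"
proof -
  have "\<exists>t. lq_le q (lev (atom s (cell k i))) t"
  proof (rule lq_le_finite_support[OF q])
    show "lev (atom s (cell k i)) j = 0" if "Suc k \<le> j" for j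
      using lev_atom[OF assms, of j] that lev_nonneg[of "atom s (cell k i)" j] by simp
  qed simp
  then show ?thesis using besov_lev(1)[OF integrable_atom[OF assms]] by blast
qed

lemma T_linear_in: "besov.linear_in T"
  unfolding besov.linear_in_def
proof (intro conjI ballI allI)
  show "T \<psi> \<in> V" if "\<psi> \<in> V" for \<psi> using T_bounded that by blast
  show "T (cscale c \<psi> + \<phi>) = cscale c (T \<psi>) + T \<phi>" for c \<psi> \<phi>
    using T_pow_linear[of 1 c \<psi> \<phi>] by (simp add: cscale_def plus_fun_def)
qed

lemma mcoef_functional: assumes "i < 2 ^ k" shows "besov.functional_in (mcoef k i)"
  unfolding besov.functional_in_def
proof (intro conjI ballI allI exI)
  fix \<psi> \<phi> c assume "\<psi> \<in> V" "\<phi> \<in> V"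
  then show "mcoef k i (cscale c \<psi> + \<phi>) = c * mcoef k i \<psi> + mcoef k i \<phi>"
    using mcoef_linear[of \<psi> \<phi> i k c] assms besov_integrable by (simp add: cscale_def plus_fun_def)
next
  fix \<psi> assume \<psi>: "\<psi> \<in> V"
  have "cmod (mcoef k i \<psi>) \<le> lev \<psi> k" unfolding lev_def using assms by (intro member_le_sum) auto
  also have "\<dots> \<le> \<kappa>0 * N \<psi>" by (rule lq_le_component[OF q lev_besov_norm[OF \<psi>]])
  finally show "cmod (mcoef k i \<psi>) \<le> \<kappa>0 * N \<psi>" .
qed

text \<open>The finite rank operator is \<open>T ^^ n\<close> applied to
  \<open>mpart m \<psi>\<close>: its functionals are the martingale coefficients of the levels below
  m, its vectors the transferred atoms. What remains has norm at most \<open>\<kappa>\<close>, which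
  is below \<open>cmod z ^ n\<close>.\<close>

lemma T_fredholm:
  assumes z: "\<mu> powr s < cmod z"
  shows "fredholm_on V N (shifted z T)"
proof -
  \<comment> \<open>The constants independent of n: 2 for the images met by a fine cell,
    \<open>C2 \<beta>\<close> for the kernel sum, \<open>2 powr (s / \<beta>)\<close> for the factor
    2 in \<open>?E\<close>, and \<open>\<kappa>0\<close> for the comparison of norms.\<close>
  define B where "B = 2 * C2 \<beta> * 2 powr (s / \<beta>) * \<kappa>0"
  define r where "r = \<mu> powr s / cmod z"
  have z0: "0 < cmod z" using z by (meson le_less_trans powr_ge_zero)
  have r: "0 \<le> r" "r < 1" using z z0 by (auto simp: r_def divide_less_eq)
  have B0: "0 \<le> B" using C2_nonneg \<kappa>0_pos by (simp add: B_def)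
  have "(\<lambda>n. B * r ^ n) \<longlonglongrightarrow> B * 0" using r by (intro tendsto_intros LIMSEQ_power_zero) auto
  then have "\<forall>\<^sub>F n in sequentially. B * r ^ n < 1" by (rule order_tendstoD(2)) simp
  then obtain n0 where n0: "\<And>n. n \<ge> n0 \<Longrightarrow> B * r ^ n < 1" by (auto simp: eventually_sequentially)
  define n where "n = Suc n0"
  have n: "n \<ge> 1" by (simp add: n_def)
  define \<kappa> where "\<kappa> = B * (\<mu> powr s) ^ n"
  have \<kappa>: "0 \<le> \<kappa>" "\<kappa> < cmod z ^ n"
  proof -
    show "0 \<le> \<kappa>" using B0 by (simp add: \<kappa>_def)
    have "B * (\<mu> powr s / cmod z) ^ n < 1" using n0[of n] by (simp add: n_def r_def)
    then show "\<kappa> < cmod z ^ n" using z0 by (simp add: \<kappa>_def power_divide divide_less_eq)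
  qed
  let ?E = "2 * (\<mu> ^ n) powr \<beta>"
  have E: "0 < ?E" using \<mu> by simp
  have Ep: "?E powr (s / \<beta>) = 2 powr (s / \<beta>) * (\<mu> powr s) ^ n"
  proof -
    have "?E powr (s / \<beta>) = 2 powr (s / \<beta>) * ((\<mu> ^ n) powr \<beta>) powr (s / \<beta>)" by (simp add: powr_mult)
    also have "((\<mu> ^ n) powr \<beta>) powr (s / \<beta>) = (\<mu> ^ n) powr s" using \<beta>pos by (simp add: powr_powr)
    also have "\<dots> = (\<mu> powr s) ^ n" using \<mu> by (simp add: powr_realpow[symmetric] powr_powr mult.commute powr_power)
    finally show ?thesis .
  qed
  obtain m where m: "\<And>k i j. k \<ge> m \<Longrightarrow> i < 2 ^ k \<Longrightarrow>
      lev ((T ^^ n) (atom s (cell k i))) j \<le> 2 * ker \<beta> ?E (int k - int j)"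
    using T_pow_atom_lev_fine[OF n] by blast
  define I where "I = Sigma {..<m} (\<lambda>k. {..<2 ^ k :: nat})"
  let ?l = "\<lambda>p. mcoef (fst p) (snd p)" and ?g = "\<lambda>p. (T ^^ n) (atom s (cell (fst p) (snd p)))"
  have finI: "finite I" by (simp add: I_def)
  have gV: "?g p \<in> V" if "p \<in> I" for p
    using besov.linear_in_funpow[OF T_linear_in, of n] atom_in_V that by (auto simp: I_def besov.linear_in_def)
  have small: "N ((T ^^ n) \<psi> - (\<Sum>p\<in>I. cscale (?l p \<psi>) (?g p))) \<le> \<kappa> * N \<psi>" if \<psi>: "\<psi> \<in> V" for \<psi>
  proof -
    have "(\<Sum>p\<in>I. cscale (?l p \<psi>) (?g p)) = (T ^^ n) (mpart m \<psi>)"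
    proof -
      have eq: "mpart m \<psi> = (\<lambda>x. \<Sum>p\<in>I. ?l p \<psi> * atom s (cell (fst p) (snd p)) x)"
        unfolding mpart_def[abs_def] I_def by (subst sum.Sigma) (auto simp: case_prod_unfold)
      have "(T ^^ n) (mpart m \<psi>) = (\<lambda>x. \<Sum>p\<in>I. ?l p \<psi> * ?g p x)" unfolding eq by (rule T_pow_sum)
      then show ?thesis by (auto simp: fun_eq_iff sum_fun_apply cscale_def)
    qed
    then have "(T ^^ n) \<psi> - (\<Sum>p\<in>I. cscale (?l p \<psi>) (?g p)) = (T ^^ n) (\<lambda>x. \<psi> x - mpart m \<psi> x)"
      using T_pow_linear[of n "-1" "mpart m \<psi>" \<psi>] by (simp add: fun_eq_iff)
    moreover have "N ((T ^^ n) (\<lambda>x. \<psi> x - mpart m \<psi> x)) \<le> 2 * (C2 \<beta> * ?E powr (s / \<beta>)) * (\<kappa>0 * N \<psi>)"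
    proof (rule T_pow_tail(2)[OF \<psi>, of "\<lambda>z. 2 * ker \<beta> ?E z"])
      show "0 \<le> 2 * ker \<beta> ?E i" for i using ker_nonneg[of ?E \<beta> i] E by simp
      show "(\<Sum>z\<in>F. 2 * ker \<beta> ?E z) \<le> 2 * (C2 \<beta> * ?E powr (s / \<beta>))" if "finite F" for F
        unfolding sum_distrib_left[symmetric] using sum_ker_le[OF \<beta>(1) E that] by (intro mult_left_mono) auto
    qed (rule m)
    ultimately show ?thesis unfolding Ep by (simp add: \<kappa>_def B_def mult_ac)
  qed
  obtain C where C: "\<And>\<psi>. \<psi> \<in> V \<Longrightarrow> N (T \<psi>) \<le> C * N \<psi>" using T_bounded by blast
  have fl: "besov.functional_in (?l p)" if "p \<in> I" for p using mcoef_functional that by (auto simp: I_def)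
  note F = besov.fredholm_finite_rank_perturbation[OF T_linear_in C finI fl gV small \<kappa>]
  have A: "cscale z x - T x = shifted z T x" for x by (auto simp: fun_eq_iff shifted_def cscale_def)
  have lc: "(\<lambda>x. \<psi> x - (\<Sum>e\<in>B. u e * e x)) = \<psi> - (\<Sum>e\<in>B. cscale (u e) e)" for \<psi> u and B :: "cfun set"
    by (auto simp: fun_eq_iff sum_fun_apply cscale_def)
  have lc2: "(\<lambda>x. \<psi> x - (\<phi> x + (\<Sum>e\<in>B. u e * e x))) = \<psi> - (\<phi> + (\<Sum>e\<in>B. cscale (u e) e))" for \<psi> \<phi> u and B :: "cfun set"
    by (auto simp: fun_eq_iff sum_fun_apply cscale_def)
  have df: "(\<lambda>x. \<psi> x - \<phi> x) = \<psi> - \<phi>" for \<psi> \<phi> :: cfun by (auto simp: fun_eq_iff)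
  show ?thesis
    unfolding fredholm_on_def lc lc2 df
  proof (intro conjI)
    show "\<exists>B. finite B \<and> B \<subseteq> V \<and> (\<forall>\<psi>\<in>V. N (shifted z T \<psi>) = 0 \<longrightarrow> (\<exists>u. N (\<psi> - (\<Sum>e\<in>B. cscale (u e) e)) = 0))"
      using F(1) unfolding A by blast
    show "\<forall>\<phi> \<psi>. (\<forall>n::nat. \<phi> n \<in> V) \<and> \<psi> \<in> V \<and> (\<lambda>n. N (shifted z T (\<phi> n) - \<psi>)) \<longlonglongrightarrow> 0 \<longrightarrow>
        (\<exists>\<xi>\<in>V. N (shifted z T \<xi> - \<psi>) = 0)"
      using F(2) unfolding A by blast
    show "\<exists>B. finite B \<and> B \<subseteq> V \<and> (\<forall>\<psi>\<in>V. \<exists>\<xi>\<in>V. \<exists>u. N (\<psi> - (shifted z T \<xi> + (\<Sum>e\<in>B. cscale (u e) e))) = 0)"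
      using F(3) unfolding A by blast
  qed
qed

section \<open>Spectrum and quasi-compactness\<close>

lemma T_bounded_operator: "bounded_operator V N T"
  unfolding bounded_operator_def
proof (intro conjI ballI allI)
  show "T \<psi> \<in> V" if "\<psi> \<in> V" for \<psi> using T_bounded that by blast
  show "N (\<lambda>x. T (\<lambda>y. c * \<psi> y + \<phi> y) x - (c * T \<psi> x + T \<phi> x)) = 0" for \<psi> \<phi> c
    using T_pow_linear[of 1 c \<psi> \<phi>] besov_zero(2) by simp
  show "\<exists>C. \<forall>\<psi>\<in>V. N (T \<psi>) \<le> C * N \<psi>" using T_bounded by blast
qed

text \<open>The integral vanishes on the range of 1 minus the operator but not on the atom of the
  whole interval, so this atom has no preimage. Null vectors do not matter, since by
  \<open>l1_besov_norm\<close> their integral is 0.\<close>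

lemma one_in_spectrum: "1 \<in> spectrum_on V N T"
proof (rule ccontr)
  assume "1 \<notin> spectrum_on V N T"
  then obtain R where R: "bounded_operator V N R"
    "\<And>\<psi>. \<psi> \<in> V \<Longrightarrow> N (\<lambda>x. shifted 1 T (R \<psi>) x - \<psi> x) = 0"
    unfolding spectrum_on_def by blast
  let ?\<psi> = "atom s (cell 0 0)"
  have V: "?\<psi> \<in> V" by (rule atom_in_V) simp
  have RV: "R ?\<psi> \<in> V" using R(1) V unfolding bounded_operator_def by blast
  let ?d = "\<lambda>x. shifted 1 T (R ?\<psi>) x - ?\<psi> x"
  have "?d = (R ?\<psi> - T (R ?\<psi>)) - ?\<psi>" by (auto simp: shifted_def fun_eq_iff)
  moreover have "(R ?\<psi> - T (R ?\<psi>)) - ?\<psi> \<in> V"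
    using V RV T_linear_in by (intro besov.V_diff) (auto simp: besov.linear_in_def)
  ultimately have dV: "?d \<in> V" by simp
  have "l1 ?d \<le> 0" using l1_besov_norm[OF dV] R(2)[OF V] by simp
  moreover have "cmod (LINT x|M. ?d x) \<le> l1 ?d" unfolding l1_def by (rule integral_norm_bound)
  ultimately have "cmod (LINT x|M. ?d x) \<le> 0" by linarith
  then have "(LINT x|M. ?d x) = 0" by (rule norm_le_zero_iff[THEN iffD1])
  moreover have "(LINT x|M. ?d x) = (LINT x|M. R ?\<psi> x) - (LINT x|M. T (R ?\<psi>) x) - (LINT x|M. ?\<psi> x)"
    using besov_integrable[OF RV] T_L1(1) besov_integrable[OF V] by (simp add: shifted_def)
  moreover have "(LINT x|M. ?\<psi> x) \<noteq> 0"
  proof -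
    have "(LINT x|M. ?\<psi> x) = complex_of_real (LINT x|M. len 0 powr (s - 1) * indicator (cell 0 0) x)"
      unfolding atom_cell by (rule integral_complex_of_real)
    also have "(LINT x|M. len 0 powr (s - 1) * indicator (cell 0 0) x) = len 0 powr (s - 1) * len 0"
      using integral_cell[of 0 0] by simp
    finally show ?thesis by simp
  qed
  ultimately show False using T_L1(2)[OF besov_integrable[OF RV]] by simp
qed

lemma T_quasi_compact:
  assumes "\<mu> < 1"
  shows "quasi_compact_on V N T" and "ess_spectral_radius_on V N T \<le> ennreal (\<mu> powr s)"
proof -
  show ess: "ess_spectral_radius_on V N T \<le> ennreal (\<mu> powr s)"
    unfolding ess_spectral_radius_on_def
  proof (rule SUP_least)
    fix z assume "z \<in> ess_spectrum_on V N T"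
    then have "cmod z \<le> \<mu> powr s" using T_fredholm[of z] unfolding ess_spectrum_on_def by force
    then show "ennreal (cmod z) \<le> ennreal (\<mu> powr s)" by (rule ennreal_leI)
  qed
  also have "ennreal (\<mu> powr s) < 1" using assms \<mu> s powr_less_mono2[of s \<mu> 1] by (simp add: ennreal_less_one_iff)
  also have "1 \<le> spectral_radius_on V N T"
    unfolding spectral_radius_on_def using SUP_upper[OF one_in_spectrum, of "\<lambda>z. ennreal (cmod z)"] by simp
  finally show "quasi_compact_on V N T" using T_bounded_operator by (simp add: quasi_compact_on_def)
qed

end

text \<open>On the interior of each cell f is differentiable and injective, and the derivative of
  the inverse branch is the reciprocal of that of f; this turns the infimum \<open>\<alpha>\<close>
  into the contraction rate \<open>1 / \<alpha>\<close>.\<close>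

lemma transfer_operator_expanding_system:
  fixes a b \<beta> \<epsilon> s \<alpha> :: real and q :: ereal and \<Lambda> :: "real set set" and f :: "real \<Rightarrow> real"
  assumes ab: "a < b" and pos: "0 < \<beta>" "0 < \<epsilon>" "0 < s" "s < \<beta>" "\<beta> < 1" and q: "1 \<le> q"
    and \<Lambda>: "\<Lambda> division_of {a..b}" and ne: "\<forall>J\<in>\<Lambda>. interior J \<noteq> {}"
    and img: "\<forall>J\<in>\<Lambda>. f ` interior J \<subseteq> {a..b}"
    and type: "\<forall>J\<in>\<Lambda>. type_I_branch (\<beta> + \<epsilon>) J f \<or> type_II_branch \<beta> (\<beta> + \<epsilon>) J f"
    and \<alpha>: "\<alpha> = (INF x\<in>(\<Union>J\<in>\<Lambda>. interior J). \<bar>deriv f x\<bar>)" "1 < \<alpha>"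
  shows "expanding_system a b s q \<beta> (1 / \<alpha>) \<Lambda> (\<lambda>J. f ` interior J) (\<lambda>J. inv_into (interior J) f)"
    and "transfer_operator \<Lambda> f = expanding_system.T \<Lambda> (\<lambda>J. f ` interior J) (\<lambda>J. inv_into (interior J) f)"
proof -
  have Icc: "\<exists>c d. c < d \<and> J = {c..d} \<and> interior J = {c<..<d}" if J\<Lambda>: "J \<in> \<Lambda>" for J
  proof -
    obtain c d where J: "J = {c..d}" using division_ofD(4)[OF \<Lambda> J\<Lambda>] by auto
    then have "interior J = {c<..<d}" by (simp add: interior_atLeastAtMost_real)
    moreover have "c < d" using ne J\<Lambda> calculation by fastforce
    ultimately show ?thesis using J by blast
  qed
  have inverse: "(\<exists>C. branch \<beta> C (f ` interior J) (inv_into (interior J) f)) \<and> inj_on f (interior J) \<and>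
      (\<forall>x\<in>interior J. \<exists>D. (f has_real_derivative D) (at x))" if J: "J \<in> \<Lambda>" for J
  proof -
    obtain c d where cd: "c < d" "J = {c..d}" "interior J = {c<..<d}" using Icc[OF J] by blast
    from type J have "type_I_branch (\<beta> + \<epsilon>) {c..d} f \<or> type_II_branch \<beta> (\<beta> + \<epsilon>) {c..d} f" unfolding cd(2) by blast
    then show ?thesis unfolding cd(3)
      using type_I_branch_inverse[of "\<beta> + \<epsilon>" c d f \<beta>] type_II_branch_inverse[of \<beta> "\<beta> + \<epsilon>" c d f] cd(1) pos by auto
  qed
  have hK: "inv_into (interior J) f ` f ` interior J = interior J" if "J \<in> \<Lambda>" for J
    using inverse[OF that] by (auto intro: inv_into_into image_eqI[where x="f _"])
  have sub: "interior J \<subseteq> {a..b}" if "J \<in> \<Lambda>" for J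
    using division_ofD(2)[OF \<Lambda> that] interior_subset by blast
  show sys: "expanding_system a b s q \<beta> (1 / \<alpha>) \<Lambda> (\<lambda>J. f ` interior J) (\<lambda>J. inv_into (interior J) f)"
  proof (unfold_locales)
    show "a < b" "0 < s" "1 \<le> q" "s < \<beta>" "\<beta> < 1" "0 < 1 / \<alpha>" using ab pos q \<alpha>(2) by auto
    show "finite \<Lambda>" using \<Lambda> by (rule division_ofD)
    show "\<exists>C. branch \<beta> C (f ` interior J) (inv_into (interior J) f)" if "J \<in> \<Lambda>" for J using inverse[OF that] by blast
    show "f ` interior J \<subseteq> {a..b}" if "J \<in> \<Lambda>" for J using img that by blast
    show "inv_into (interior J) f ` f ` interior J \<subseteq> {a..b}" if "J \<in> \<Lambda>" for J using hK[OF that] sub[OF that] by simp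
    show "\<bar>deriv (inv_into (interior J) f) y\<bar> \<le> 1 / \<alpha>" if J: "J \<in> \<Lambda>" and y: "y \<in> f ` interior J" for J y
    proof -
      let ?h = "inv_into (interior J) f"
      obtain x where x: "x \<in> interior J" "y = f x" using y by blast
      obtain D where D: "(f has_real_derivative D) (at x)" using inverse[OF J] x(1) by blast
      obtain C where C: "branch \<beta> C (f ` interior J) ?h" using inverse[OF J] by blast
      have inj: "inj_on f (interior J)" using inverse[OF J] by blast
      have "((\<lambda>z. ?h (f z)) has_real_derivative deriv ?h (f x) * D) (at x)"
        using x by (intro DERIV_chain2[OF branchD(5)[OF C] D]) auto
      moreover have "((\<lambda>z. ?h (f z)) has_real_derivative 1) (at x)"
        by (rule has_field_derivative_transform_within_open[OF DERIV_ident open_interior x(1)])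
          (simp add: inv_into_f_f[OF inj])
      ultimately have "deriv ?h y * D = 1" using DERIV_unique x(2) by blast
      then have "\<bar>deriv ?h y\<bar> * \<bar>D\<bar> = 1" by (metis abs_mult abs_one)
      moreover have "\<alpha> \<le> \<bar>D\<bar>"
      proof -
        have "\<alpha> \<le> \<bar>deriv f x\<bar>"
          unfolding \<alpha>(1) using J x(1) by (intro cINF_lower bdd_belowI2[where m=0]) auto
        then show ?thesis using DERIV_imp_deriv[OF D] by simp
      qed
      ultimately have "\<bar>deriv ?h y\<bar> * \<alpha> \<le> 1" by (metis abs_ge_zero mult_left_mono)
      then show ?thesis using \<alpha>(2) by (simp add: le_divide_eq)
    qed
    show "J = J'" if JJ: "J \<in> \<Lambda>" "J' \<in> \<Lambda>" and x: "x \<in> f ` interior J" "x' \<in> f ` interior J'"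
      and eq: "inv_into (interior J) f x = inv_into (interior J') f x'" for J J' x x'
    proof (rule ccontr)
      assume "J \<noteq> J'"
      then have "interior J \<inter> interior J' = {}" using division_ofD(5)[OF \<Lambda> JJ] by blast
      then show False using inv_into_into[OF x(1)] inv_into_into[OF x(2)] eq by auto
    qed
    show "AE x in lebesgue_on {a..b}. x \<in> (\<Union>J\<in>\<Lambda>. inv_into (interior J) f ` f ` interior J)"
    proof -
      \<comment> \<open>The interiors of the cells miss only their end points, a finite set.\<close>
      let ?E = "\<Union>J\<in>\<Lambda>. J - interior J"
      have "finite (J - interior J)" if J\<Lambda>: "J \<in> \<Lambda>" for J
      proof -
        obtain c d where "J = {c..d}" "interior J = {c<..<d}" using Icc[OF J\<Lambda>] by blast
        then have "J - interior J \<subseteq> {c, d}" by auto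
        then show ?thesis by (rule finite_subset) simp
      qed
      then have "finite ?E" using division_ofD(1)[OF \<Lambda>] by blast
      then have "?E \<in> null_sets lebesgue" using negligible_finite negligible_iff_null_sets by blast
      then have "AE x in lebesgue. x \<notin> ?E" by (rule AE_not_in)
      then have "AE x in lebesgue. x \<in> {a..b} \<longrightarrow> x \<in> (\<Union>J\<in>\<Lambda>. interior J)"
      proof eventually_elim
        case (elim x)
        show ?case
        proof
          assume "x \<in> {a..b}"
          then obtain J where "J \<in> \<Lambda>" "x \<in> J" using division_ofD(6)[OF \<Lambda>] by blast
          then show "x \<in> (\<Union>J\<in>\<Lambda>. interior J)" using elim by blast
        qed
      qed
      then have "AE x in lebesgue_on {a..b}. x \<in> (\<Union>J\<in>\<Lambda>. interior J)"
        by (subst AE_restrict_space_iff) auto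
      then show ?thesis using hK by simp
    qed
  qed
  interpret expanding_system a b s q \<beta> "1 / \<alpha>" \<Lambda> "\<lambda>J. f ` interior J" "\<lambda>J. inv_into (interior J) f" by (rule sys)
  show "transfer_operator \<Lambda> f = T"
  proof (intro ext)
    fix \<psi> x
    show "transfer_operator \<Lambda> f \<psi> x = T \<psi> x"
      \<comment> \<open>One side restricts the index set to the branches whose image contains x, the
        other multiplies by the indicator of the image.\<close>
      unfolding transfer_operator_def T_def using fin
      by (subst sum.inter_filter) (auto intro!: sum.cong simp: indicator_def)
  qed
qed

theorem corollary11p1:
  fixes a b \<beta> \<epsilon> s \<alpha> :: real and q :: ereal
    and \<Lambda> :: "real set set" and f :: "real \<Rightarrow> real"
  assumes "a < b"
    and "\<beta> > 0" and "\<epsilon> > 0"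
    and "0 < s" and "s < \<beta>" and "\<beta> < 1"
    and "1 \<le> q"
    and "\<Lambda> division_of {a..b}" and "\<forall>J\<in>\<Lambda>. interior J \<noteq> {}"
    and "\<forall>J\<in>\<Lambda>. f ` interior J \<subseteq> {a..b}"
    and "\<forall>J\<in>\<Lambda>. type_I_branch (\<beta> + \<epsilon>) J f \<or> type_II_branch \<beta> (\<beta> + \<epsilon>) J f"
    and "\<alpha> = (INF x\<in>(\<Union>J\<in>\<Lambda>. interior J). \<bar>deriv f x\<bar>)" and "\<alpha> > 1"
  shows "quasi_compact_on (besov a b s q) (besov_norm a b s q) (transfer_operator \<Lambda> f) \<and>
         ess_spectral_radius_on (besov a b s q) (besov_norm a b s q) (transfer_operator \<Lambda> f)
           \<le> ennreal (\<alpha> powr (- s))"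
proof -
  note sys = transfer_operator_expanding_system[OF assms]
  have "1 / \<alpha> < 1" "(1 / \<alpha>) powr s = \<alpha> powr (- s)"
    using \<open>\<alpha> > 1\<close> by (simp_all add: powr_divide powr_minus_divide)
  then show ?thesis
    using expanding_system.T_quasi_compact[OF sys(1)] unfolding sys(2) by simp
qed

end
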